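(* Let $\delta\ge 1$ be an integer, $0<\lambda\le 1$ and $\mathfrak p,\mathfrak q,\mathfrak r\ge 1$ real numbers, and let $\boldsymbol\gamma=(\gamma_v)_{v\subset\mathbb N}$ be an indexed set of non-negative real numbers. Let $f:[0,1)^s\to\mathbb R$ be such that the partial mixed derivatives of $f$ up to order $\delta$ in each variable exist and are continuous, and such that $N_{\delta,\lambda,\boldsymbol\gamma}(f)<\infty$. Then there is a constant $C_{f,q,s,\boldsymbol\gamma}>0$, independent of $\boldsymbol k$, such that for every $\boldsymbol k\in\mathbb N_0^s\setminus\{\boldsymbol 0\}$ $$|\hat f(\boldsymbol k)|\le C_{f,q,s,\boldsymbol\gamma}\,q^{-\mu_{q,\delta+\lambda}(\boldsymbol k)}.$$
   Context: $\mathbb N=\{1,2,\dots\}$, $\mathbb N_0=\mathbb N\cup\{0\}$, $\mathcal S=\{1,\dots,s\}$. Walsh functions. Let $p$ be prime, $q=p^r$ with $r\ge 1$, $\mathbb F_q$ the field with $q$ elements, and $\varphi:\{0,\dots,q-1\}\to\mathbb F_q$ a fixed bijection with $\varphi(0)=0$. Write $\mathbb F_q=\mathbb Z_p[\theta]$ with $\mathbb Z_p$-basis $1,\theta,\dots,\theta^{r-1}$, let $\psi:\mathbb F_q\to\mathbb Z_p^r$ be the coordinate map with respect to this basis, and put $\eta=\psi\circ\varphi=(\eta_1,\dots,\eta_r)$. For $k\in\mathbb N_0$ with base $q$ expansion $k=\kappa_0+\kappa_1q+\cdots+\kappa_{m-1}q^{m-1}$ and $x\in[0,1)$ with base $q$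 expansion $x=x_1q^{-1}+x_2q^{-2}+\cdots$ (infinitely many $x_l\ne q-1$), let $\mathrm{wal}_k(x)=\exp\left(\frac{2\pi \mathrm i}{p}\sum_{l=0}^{m-1}\sum_{i=1}^r\eta_i(\kappa_l)\eta_i(x_{l+1})\right)$; for $\boldsymbol k\in\mathbb N_0^s$, $\boldsymbol x\in[0,1)^s$ let $\mathrm{wal}_{\boldsymbol k}(\boldsymbol x)=\prod_{j=1}^s\mathrm{wal}_{k_j}(x_j)$. The Walsh coefficients of $f$ are $\hat f(\boldsymbol k)=\int_{[0,1)^s}f(\boldsymbol x)\overline{\mathrm{wal}_{\boldsymbol k}(\boldsymbol x)}\,d\boldsymbol x$. The function $\mu$. For $k\in\mathbb N$ write $k=\kappa_1q^{a_1-1}+\cdots+\kappa_vq^{a_v-1}$ with $v\ge1$, $\kappa_i\in\{1,\dots,q-1\}$, $1\le a_v<\cdots<a_1$. Then $\mu_{q,\delta+\lambda}(0)=0$, $\mu_{q,\delta+\lambda}(k)=a_1+\cdots+a_v$ if $v\le\delta$, $\mu_{q,\delta+\lambda}(k)=a_1+\cdots+a_\delta+\lambda a_{\delta+1}$ if $v>\delta$; and $\mu_{q,\delta+\lambda}(\boldsymbol k)=\sum_{j=1}^s\mu_{q,\delta+\lambda}(k_j)$. Variation. For a function $g:[0,1)^d\to\mathbb R$ and a box $J=\prod_{j=1}^d[x_j,y_j)$, $x_j<y_j$, with all vertices in $[0,1)^d$, let $\Delta(g,J)=\sum_{v\subseteq\{1,\dots,d\}}(-1)^{|v|}g(\boldsymbol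 z_v)$, where $\boldsymbol z_v$ has $j$-th coordinate $y_j$ if $j\in v$ and $x_j$ otherwise. The generalized Vitali variation is $$V^{(d)}_{\lambda,\mathfrak p}(g)=\sup_{\mathcal P}\left(\sum_{J\in\mathcal P}\mathrm{Vol}(J)\left|\frac{\Delta(g,J)}{\mathrm{Vol}(J)^\lambda}\right|^{\mathfrak p}\right)^{1/\mathfrak p},$$ the supremum being over all finite partitions $\mathcal P$ of $[0,1)^d$ into subintervals (boxes), where boxes having a vertex outside $[0,1)^d$ are omitted from the sum. For a function $g$ of variables indexed by a finite set $u$ and $w\subseteq u$, let $g_w$ be the function of $\boldsymbol x_w=(x_j)_{j\in w}$ obtained by integrating $g$ over $[0,1)$ in all variables $x_j$, $j\in u\setminus w$ (existence of these integrals is part of the requirement that the variation be finite); let $V^{(|w|)}_{\lambda,\mathfrak p}(g_w;w)$ be its generalized Vitali variation if $w\ne\emptyset$, and $|g_\emptyset|$ if $w=\emptyset$. The generalized Hardy and Krause variation (all weights $1$) is $V^{(|u|)}_{\lambda,\mathfrak p,\mathfrak q,\boldsymbol 1}(g)=\left(\sum_{w\subseteq u}V^{(|w|)}_{\lambda,\mathfrak p}(g_w;w)^{\mathfrak q}\right)^{1/\mathfrak q}$. The functional $N$. For $\boldsymbol\tau\in\{0,\dots,\delta\}^s$ let $f^{(\boldsymbol\tau)}=\frac{\partial^{\tau_1+\cdots+\tau_s}f}{\partial x_1^{\tau_1}\cdots\partial x_s^{\tau_s}}$ (one-sided at $0$), $u(\boldsymbol\tau)=\{j:\tau_j=\delta\}$,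 $v(\boldsymbol\tau)=\{j:\tau_j>0\}$. Then $$N_{\delta,\lambda,\boldsymbol\gamma}(f)=\left(\sum_{\boldsymbol\tau\in\{0,\dots,\delta\}^s}\gamma_{v(\boldsymbol\tau)}^{-1}\left[V^{(|u(\boldsymbol\tau)|)}_{\lambda,\mathfrak p,\mathfrak q,\boldsymbol 1}\bigl(f^{(\boldsymbol\tau)}(\cdot,\boldsymbol 0_{\mathcal S\setminus u(\boldsymbol\tau)})\bigr)\right]^{\mathfrak r}\right)^{1/\mathfrak r},$$ where $f^{(\boldsymbol\tau)}(\cdot,\boldsymbol 0_{\mathcal S\setminus u(\boldsymbol\tau)})$ is the function of the variables $x_j$, $j\in u(\boldsymbol\tau)$, with all other variables set to $0$, and for $u(\boldsymbol\tau)=\emptyset$ the bracket is $|f^{(\boldsymbol\tau)}(\boldsymbol 0)|$. If $\gamma_{v(\boldsymbol\tau)}=0$ the bracket is assumed to be $0$ and $0/0:=0$ (so $N=\infty$ otherwise). *)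

theory Defs
  imports "HOL-Analysis.Analysis" "HOL-Computational_Algebra.Primes"
begin

text \<open>
  Points with coordinates indexed by a finite set \<open>u\<close> of naturals are extensional functions
  \<open>nat \<Rightarrow> real\<close>, so that \<open>cube u\<close> is \<open>[0,1)\<close> to the power \<open>u\<close> with its usual topology.
  Functions on \<open>cube u\<close> are total functions whose values elsewhere are never used.
\<close>

definition cube :: "nat set \<Rightarrow> (nat \<Rightarrow> real) set" where
  "cube u = (\<Pi>\<^sub>E j\<in>u. {0..<1})"

abbreviation lebesgue_on_coords :: "nat set \<Rightarrow> (nat \<Rightarrow> real) measure" where
  "lebesgue_on_coords u \<equiv> (\<Pi>\<^sub>M j\<in>u. lborel)"


section \<open>Walsh functions\<close>

text \<open>
  A finite field is a type \<open>'a\<close> of class \<open>field\<close> with \<open>p ^ r\<close> elements.  Elements of \<open>Z\<^sub>p\<close> are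
  represented by naturals below \<open>p\<close> and act on the field through \<open>of_nat\<close>.
\<close>

definition Zp_vectors :: "nat \<Rightarrow> nat \<Rightarrow> (nat \<Rightarrow> nat) set" where
  "Zp_vectors p r = (\<Pi>\<^sub>E i\<in>{1..r}. {..<p})"

definition Zp_combination :: "nat \<Rightarrow> 'a::field \<Rightarrow> (nat \<Rightarrow> nat) \<Rightarrow> 'a" where
  "Zp_combination r \<theta> c = (\<Sum>i=1..r. of_nat (c i) * \<theta> ^ (i - 1))"

text \<open>\<open>1, \<theta>, \<dots>, \<theta> ^ (r - 1)\<close> is a \<open>Z\<^sub>p\<close>-basis: every element is a combination in exactly one way.\<close>

definition is_power_basis :: "nat \<Rightarrow> nat \<Rightarrow> 'a::field \<Rightarrow> bool" where
  "is_power_basis p r \<theta> \<longleftrightarrow> bij_betw (Zp_combination r \<theta>) (Zp_vectors p r) UNIV"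

definition Zp_coords :: "nat \<Rightarrow> nat \<Rightarrow> 'a::field \<Rightarrow> 'a \<Rightarrow> (nat \<Rightarrow> nat)" where
  "Zp_coords p r \<theta> = the_inv_into (Zp_vectors p r) (Zp_combination r \<theta>)"

definition nat_digit :: "nat \<Rightarrow> nat \<Rightarrow> nat \<Rightarrow> nat" where
  "nat_digit q k l = k div q ^ l mod q"

text \<open>\<open>real_digit q x l\<close> is the digit of \<open>x\<close> belonging to \<open>q\<close> to the power \<open>- (l + 1)\<close>.\<close>

definition real_digit :: "nat \<Rightarrow> real \<Rightarrow> nat \<Rightarrow> nat" where
  "real_digit q x = (THE d. (\<forall>l. d l < q) \<and> (\<lambda>l. real (d l) / real q ^ (l + 1)) sums x
                          \<and> infinite {l. d l \<noteq> q - 1})"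

text \<open>The digits of \<open>k\<close> at the positions \<open>l\<close> with \<open>k < q ^ l\<close> are \<open>0\<close>.\<close>

definition wal1 :: "nat \<Rightarrow> nat \<Rightarrow> 'a::field \<Rightarrow> (nat \<Rightarrow> 'a) \<Rightarrow> nat \<Rightarrow> real \<Rightarrow> complex" where
  "wal1 p r \<theta> \<phi> k x =
     (let q = p ^ r; \<eta> = (\<lambda>i n. Zp_coords p r \<theta> (\<phi> n) i) in
      exp (2 * pi * \<i> / of_nat p *
           of_nat (\<Sum>l | q ^ l \<le> k. \<Sum>i=1..r. \<eta> i (nat_digit q k l) * \<eta> i (real_digit q x l))))"

definition wal ::
  "nat \<Rightarrow> nat \<Rightarrow> 'a::field \<Rightarrow> (nat \<Rightarrow> 'a) \<Rightarrow> nat \<Rightarrow> (nat \<Rightarrow> nat) \<Rightarrow> (nat \<Rightarrow> real) \<Rightarrow> complex" where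
  "wal p r \<theta> \<phi> s k x = (\<Prod>j=1..s. wal1 p r \<theta> \<phi> (k j) (x j))"

definition walsh_coeff ::
  "nat \<Rightarrow> nat \<Rightarrow> 'a::field \<Rightarrow> (nat \<Rightarrow> 'a) \<Rightarrow> nat \<Rightarrow> ((nat \<Rightarrow> real) \<Rightarrow> real) \<Rightarrow> (nat \<Rightarrow> nat) \<Rightarrow> complex" where
  "walsh_coeff p r \<theta> \<phi> s f k =
     (LINT x : cube {1..s} | lebesgue_on_coords {1..s}.
        complex_of_real (f x) * cnj (wal p r \<theta> \<phi> s k x))"


section \<open>The digit weight\<close>

text \<open>The list \<open>[a\<^sub>1, \<dots>, a\<^sub>v]\<close> of positions of nonzero digits, counted from \<open>1\<close>, in decreasing order.\<close>

definition digit_positions :: "nat \<Rightarrow> nat \<Rightarrow> nat list" where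
  "digit_positions q k = rev (sorted_list_of_set {a. 1 \<le> a \<and> nat_digit q k (a - 1) \<noteq> 0})"

definition mu1 :: "nat \<Rightarrow> nat \<Rightarrow> real \<Rightarrow> nat \<Rightarrow> real" where
  "mu1 q \<delta> lam k =
     (let a = digit_positions q k in
      if length a \<le> \<delta> then real (sum_list a)
      else real (sum_list (take \<delta> a)) + lam * real (a ! \<delta>))"

definition mu :: "nat \<Rightarrow> nat \<Rightarrow> real \<Rightarrow> nat \<Rightarrow> (nat \<Rightarrow> nat) \<Rightarrow> real" where
  "mu q \<delta> lam s k = (\<Sum>j=1..s. mu1 q \<delta> lam (k j))"


section \<open>Generalized variation\<close>

text \<open>Powers with positive exponent on \<open>[0,\<infinity>]\<close>.\<close>

definition epowr :: "ennreal \<Rightarrow> real \<Rightarrow> ennreal" where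
  "epowr x a = (if x = \<infinity> then \<infinity> else ennreal (enn2real x powr a))"

text \<open>A pair \<open>(a, b)\<close> stands for the box with \<open>j\<close>-th side \<open>[a j, b j)\<close>.\<close>

type_synonym corners = "(nat \<Rightarrow> real) \<times> (nat \<Rightarrow> real)"

definition hbox :: "nat set \<Rightarrow> corners \<Rightarrow> (nat \<Rightarrow> real) set" where
  "hbox u J = (\<Pi>\<^sub>E j\<in>u. {fst J j..<snd J j})"

definition vol :: "nat set \<Rightarrow> corners \<Rightarrow> real" where
  "vol u J = (\<Prod>j\<in>u. snd J j - fst J j)"

definition vertex :: "nat set \<Rightarrow> corners \<Rightarrow> nat set \<Rightarrow> (nat \<Rightarrow> real)" where
  "vertex u J v = (\<lambda>j\<in>u. if j \<in> v then snd J j else fst J j)"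

definition Delta :: "nat set \<Rightarrow> ((nat \<Rightarrow> real) \<Rightarrow> real) \<Rightarrow> corners \<Rightarrow> real" where
  "Delta u g J = (\<Sum>v\<in>Pow u. (-1) ^ card v * g (vertex u J v))"

text \<open>Corners are extensional on \<open>u\<close>, so that each box is given by exactly one pair.\<close>

definition box_partitions :: "nat set \<Rightarrow> corners set set" where
  "box_partitions u =
     {P. finite P
       \<and> (\<forall>(a, b)\<in>P. a \<in> extensional u \<and> b \<in> extensional u \<and> (\<forall>j\<in>u. a j < b j))
       \<and> disjoint_family_on (hbox u) P \<and> (\<Union>J\<in>P. hbox u J) = cube u}"

definition Vitali_var :: "real \<Rightarrow> real \<Rightarrow> nat set \<Rightarrow> ((nat \<Rightarrow> real) \<Rightarrow> real) \<Rightarrow> ennreal" where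
  "Vitali_var lam \<pp> u g =
     (SUP P\<in>box_partitions u.
        ennreal ((\<Sum>J | J \<in> P \<and> (\<forall>v\<subseteq>u. vertex u J v \<in> cube u).
                    vol u J * \<bar>Delta u g J / vol u J powr lam\<bar> powr \<pp>) powr (1 / \<pp>)))"

definition proj_integrable :: "nat set \<Rightarrow> nat set \<Rightarrow> ((nat \<Rightarrow> real) \<Rightarrow> real) \<Rightarrow> bool" where
  "proj_integrable u w g \<longleftrightarrow>
     (\<forall>x\<in>cube w. set_integrable (lebesgue_on_coords (u - w)) (cube (u - w))
                   (\<lambda>y. g (merge w (u - w) (x, y))))"

definition proj :: "nat set \<Rightarrow> nat set \<Rightarrow> ((nat \<Rightarrow> real) \<Rightarrow> real) \<Rightarrow> (nat \<Rightarrow> real) \<Rightarrow> real" where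
  "proj u w g x =
     (LINT y : cube (u - w) | lebesgue_on_coords (u - w). g (merge w (u - w) (x, y)))"

text \<open>
  The only point of \<open>cube {}\<close> is \<open>\<lambda>_. undefined\<close>, at which the constant \<open>proj u {} g\<close> is read off.
  For \<open>u = {}\<close> the variation is thus the absolute value of \<open>g\<close> at that point.
\<close>

definition HK_var :: "real \<Rightarrow> real \<Rightarrow> real \<Rightarrow> nat set \<Rightarrow> ((nat \<Rightarrow> real) \<Rightarrow> real) \<Rightarrow> ennreal" where
  "HK_var lam \<pp> \<qq> u g =
     (if \<forall>w\<subseteq>u. proj_integrable u w g
      then epowr (\<Sum>w\<in>Pow u.
             epowr (if w = {} then ennreal \<bar>proj u {} g (\<lambda>_. undefined)\<bar>
                    else Vitali_var lam \<pp> w (proj u w g)) \<qq>) (1 / \<qq>)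
      else \<infinity>)"


section \<open>Mixed partial derivatives and the functional N\<close>

text \<open>Derivatives are taken within \<open>[0,1)\<close>, hence one-sided at \<open>0\<close>.\<close>

definition pderiv_at :: "nat \<Rightarrow> ((nat \<Rightarrow> real) \<Rightarrow> real) \<Rightarrow> (nat \<Rightarrow> real) \<Rightarrow> real" where
  "pderiv_at j g x = vector_derivative (\<lambda>t. g (x(j := t))) (at (x j) within {0..<1})"

definition has_pderiv_on_cube :: "nat set \<Rightarrow> nat \<Rightarrow> ((nat \<Rightarrow> real) \<Rightarrow> real) \<Rightarrow> bool" where
  "has_pderiv_on_cube u j g \<longleftrightarrow>
     (\<forall>x\<in>cube u. (\<lambda>t. g (x(j := t))) differentiable (at (x j) within {0..<1}))"

text \<open>The head of the list is the variable of the last differentiation.\<close>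

definition iter_pderiv :: "nat list \<Rightarrow> ((nat \<Rightarrow> real) \<Rightarrow> real) \<Rightarrow> (nat \<Rightarrow> real) \<Rightarrow> real" where
  "iter_pderiv js g = foldr pderiv_at js g"

text \<open>
  The differentiations may be carried out in any order, each variable being used at most
  \<open>\<delta>\<close> times.
\<close>

definition admissible :: "nat \<Rightarrow> nat \<Rightarrow> nat list \<Rightarrow> bool" where
  "admissible \<delta> s js \<longleftrightarrow> set js \<subseteq> {1..s} \<and> (\<forall>j. count_list js j \<le> \<delta>)"

definition cont_mixed_pderivs :: "nat \<Rightarrow> nat \<Rightarrow> ((nat \<Rightarrow> real) \<Rightarrow> real) \<Rightarrow> bool" where
  "cont_mixed_pderivs \<delta> s f \<longleftrightarrow>
     (\<forall>j js. admissible \<delta> s (j # js) \<longrightarrow> has_pderiv_on_cube {1..s} j (iter_pderiv js f))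
   \<and> (\<forall>js. admissible \<delta> s js \<longrightarrow> continuous_on (cube {1..s}) (iter_pderiv js f))"

definition mixed_pderiv ::
  "nat \<Rightarrow> (nat \<Rightarrow> nat) \<Rightarrow> ((nat \<Rightarrow> real) \<Rightarrow> real) \<Rightarrow> (nat \<Rightarrow> real) \<Rightarrow> real" where
  "mixed_pderiv s \<tau> f = iter_pderiv (concat (map (\<lambda>j. replicate (\<tau> j) j) [1..<Suc s])) f"

text \<open>
  Division by \<open>\<gamma> v = 0\<close> follows the conventions of \<^typ>\<open>ennreal\<close>: \<open>0 / 0 = 0\<close>, and \<open>x / 0 = \<infinity>\<close> for
  \<open>x \<noteq> 0\<close>.
\<close>

definition N_functional ::
  "nat \<Rightarrow> real \<Rightarrow> real \<Rightarrow> real \<Rightarrow> real \<Rightarrow> (nat set \<Rightarrow> real) \<Rightarrow> nat \<Rightarrow> ((nat \<Rightarrow> real) \<Rightarrow> real) \<Rightarrow> ennreal" where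
  "N_functional \<delta> lam \<pp> \<qq> \<rr> \<gamma> s f =
     epowr (\<Sum>\<tau> \<in> (\<Pi>\<^sub>E j\<in>{1..s}. {0..\<delta>}).
        (let u = {j\<in>{1..s}. \<tau> j = \<delta>}; v = {j\<in>{1..s}. \<tau> j > 0} in
         epowr (HK_var lam \<pp> \<qq> u
                  (\<lambda>x. mixed_pderiv s \<tau> f (merge u ({1..s} - u) (x, \<lambda>_. 0)))) \<rr>
         / ennreal (\<gamma> v))) (1 / \<rr>)"

end

theory Submission
  imports Defs
begin

text \<open>
  Write \<open>W\<close> for the complex conjugate of a one-dimensional Walsh function with digit positions
  \<open>a\<^sub>1 > a\<^sub>2 > \<dots> > a\<^sub>v\<close>, and let \<open>I\<^sup>m W\<close> be its \<open>m\<close>-fold antiderivative vanishing at \<open>1\<close>.  Inside a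
  \<open>q\<close>-adic cell of length \<open>q\<close> to the power \<open>1 - a\<^sub>m\<close> the \<open>q\<close> subcells carry multiples of one
  function, and the factors sum to \<open>0\<close> because they are the values of a nontrivial character.  By
  induction on \<open>m \<le> v\<close>, \<open>I\<^sup>m W\<close> vanishes on the grid of these cells and is bounded by \<open>q\<close> to the power
  \<open>m - (a\<^sub>1 + \<dots> + a\<^sub>m)\<close>; if \<open>v > \<delta>\<close>, then \<open>I\<^sup>\<delta> W\<close> moreover has mean \<open>0\<close> on the cells belonging to
  \<open>a\<^sub>\<delta>\<^sub>+\<^sub>1\<close>.

  Taylor's formula at \<open>0\<close> with integral remainder in each variable turns a Walsh coefficient of \<open>f\<close> into
  a finite sum, over \<open>\<tau>\<close>, of products of values \<open>I W (0)\<close> and integrals of \<open>f\<^bsup>(\<tau>)\<^esup>\<close>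
  against products of functions \<open>I\<^sup>\<delta> W\<close>.  Splitting each \<open>I\<^sup>\<delta> W\<close> into its mean and a remainder
  produces the projections that occur in the Hardy and Krause variation, integrated against functions
  of mean \<open>0\<close> on cells.  On one cell such an integral is at most a constant times the volume times one
  difference \<open>\<Delta>\<close> over a box in the cell whose sides are at least a quarter of those of the cell; the
  boxes chosen in all cells are part of a partition, so the sum of the differences is controlled by
  the variation.
\<close>

section \<open>Iterated integrals of functions with a digit structure\<close>

text \<open>The derivatives are known on the half-open cube only, so continuity gives neither bounds
  nor integrability near 1. Two facts replace them: for fixed \<open>x\<close> the Taylor kernels
  live on a compact box below \<open>x\<close>, and a finite Hardy and Krause variation includes the
  existence of the integral over all variables. Exchanging the integrals leaves in each variable the
  Walsh function integrated against a kernel supported on \<open>x \<ge> t\<close>; this is why its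
  antiderivatives are taken from 1. Up to \<open>\<delta>\<close> nonzero digits are paid for by
  integration, with full weight. The next digit is paid for by the variation, which controls a
  difference only relative to the volume to the power \<open>lam\<close>; hence the factor
  \<open>lam\<close> in the digit weight. The variation weights a difference by the volume of its
  own box, whereas the integrals produce the volume of the cell. The lower bound on the sides makes
  the two comparable. As the variation is a supremum over all partitions, one constant serves all
  grids and hence all \<open>k\<close>.\<close>

lemma norm_set_integral_le_AE:
  fixes F :: "'a \<Rightarrow> 'b::{banach, second_countable_topology}"
  assumes [measurable]: "A \<in> sets M" and fin: "emeasure M A < \<infinity>" and "0 \<le> c"
    and c: "AE x in M. x \<in> A \<longrightarrow> norm (F x) \<le> c"
  shows "norm (LINT x:A|M. F x) \<le> c * measure M A"
proof (cases "set_integrable M A F")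
  case True
  have "norm (LINT x:A|M. F x) \<le> (LINT x:A|M. norm (F x))"
    using True by (rule set_integral_norm_bound)
  also have "\<dots> \<le> (LINT x:A|M. c)"
    using set_integrable_norm[OF True] fin c
    by (intro set_integral_mono_AE) (auto simp: set_integrable_def integrable_real_indicator)
  also have "\<dots> = c * measure M A"
    using fin by (subst set_integral_const) auto
  finally show ?thesis .
next
  \<comment> \<open>By convention the integral of a function that is not integrable is 0, so
    integrability need not be assumed.\<close>
  case False
  with \<open>0 \<le> c\<close> show ?thesis
    by (simp add: set_lebesgue_integral_def set_integrable_def not_integrable_integral_eq)
qed

lemma norm_set_integral_le:
  fixes F :: "'a \<Rightarrow> 'b::{banach, second_countable_topology}"
  assumes "A \<in> sets M" "emeasure M A < \<infinity>" and c: "\<And>x. x \<in> A \<Longrightarrow> norm (F x) \<le> c"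
  shows "norm (LINT x:A|M. F x) \<le> c * measure M A"
proof (cases "A = {}")
  case False
  then obtain x where "x \<in> A" by auto
  with c have "0 \<le> c" using norm_ge_zero order_trans by blast
  then show ?thesis using assms by (intro norm_set_integral_le_AE) auto
qed (simp add: set_lebesgue_integral_def)

text \<open>Integrating from \<open>t\<close> up to 1 avoids alternating signs: the
  \<open>m\<close>-fold antiderivative is \<open>W\<close> integrated against the nonnegative kernel
  of Taylor's remainder, see \<open>iterint_eq_kernel\<close>.\<close>

primrec iterint :: "(real \<Rightarrow> complex) \<Rightarrow> nat \<Rightarrow> real \<Rightarrow> complex" where
  "iterint W 0 = W"
| "iterint W (Suc m) = (\<lambda>t. LBINT x:{t..<1}. iterint W m x)"

lemma iterint_measurable [measurable]:
  assumes [measurable]: "W \<in> borel_measurable borel"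
  shows "iterint W m \<in> borel_measurable borel"
proof (induction m)
  case (Suc m)
  note [measurable] = Suc
  \<comment> \<open>With the moving limit written into the integrand, measurability in
    \<open>t\<close> is that of an integral with a parameter.\<close>
  have "iterint W (Suc m) = (\<lambda>t. LINT x|lborel. (if t \<le> x \<and> x < 1 then iterint W m x else 0))"
    by (auto simp: fun_eq_iff set_lebesgue_integral_def indicator_def intro!: Bochner_Integration.integral_cong)
  also have "\<dots> \<in> borel_measurable borel"
    by measurable
  finally show ?case .
qed simp

lemma norm_iterint_Suc_le:
  assumes "\<And>x. x \<in> {0..<1} \<Longrightarrow> norm (iterint W m x) \<le> c" and "0 \<le> c" "0 \<le> t" "t \<le> 1"
  shows "norm (iterint W (Suc m) t) \<le> c"
proof -
  have "norm (iterint W (Suc m) t) \<le> c * measure lborel {t..<1}"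
    using assms by (simp del: measure_lborel_Ico) (rule norm_set_integral_le, auto)
  also have "\<dots> \<le> c * 1"
    using assms by (intro mult_left_mono) auto
  finally show ?thesis by simp
qed

text \<open>Integrating over a part of \<open>[0,1)\<close> cannot increase a bound. This serves the
  orders beyond the number of nonzero digits, where no further decay is gained.\<close>

lemma norm_iterint_mono:
  assumes "\<And>x. x \<in> {0..<1} \<Longrightarrow> norm (iterint W m x) \<le> c" and "0 \<le> c" "m \<le> n" "x \<in> {0..<1}"
  shows "norm (iterint W n x) \<le> c"
  using assms(3,4)
proof (induction n arbitrary: x rule: dec_induct)
  case (step n)
  then show ?case by (intro norm_iterint_Suc_le) (use assms in auto)
qed (use assms in auto)

lemma norm_iterint_le_1:
  assumes "\<And>x. norm (W x) \<le> 1" "x \<in> {0..<1}"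
  shows "norm (iterint W m x) \<le> 1"
  using norm_iterint_mono[of W 0 1 m x] assms by auto

lemma iterint_set_integrable:
  assumes [measurable]: "W \<in> borel_measurable borel" and "\<And>x. norm (W x) \<le> 1" "0 \<le> s" "t \<le> 1"
  shows "set_integrable lborel {s..<t} (iterint W m)"
  unfolding set_integrable_def
proof (rule integrableI_bounded_set_indicator[where B = 1])
  show "AE x in lborel. x \<in> {s..<t} \<longrightarrow> norm (iterint W m x) \<le> 1"
    using assms by (intro AE_I2 impI norm_iterint_le_1) auto
  show "emeasure lborel {s..<t} < \<infinity>" by (cases "s \<le> t") auto
qed measurable

lemma iterint_split:
  assumes "W \<in> borel_measurable borel" and "\<And>x. norm (W x) \<le> 1" "0 \<le> s" "s \<le> t" "t \<le> 1"
  shows "iterint W (Suc m) s = (LBINT x:{s..<t}. iterint W m x) + iterint W (Suc m) t"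
proof -
  have "{s..<1} = {s..<t} \<union> {t..<1}" using assms by auto
  moreover have "(LBINT x:{s..<t} \<union> {t..<1}. iterint W m x) = (LBINT x:{s..<t}. iterint W m x) + (LBINT x:{t..<1}. iterint W m x)"
    by (rule set_integral_Un) (use assms in \<open>auto intro!: iterint_set_integrable\<close>)
  ultimately show ?thesis by simp
qed

lemma set_integral_shift:
  fixes F :: "real \<Rightarrow> 'b::{banach, second_countable_topology}"
  shows "(LBINT x:{c+s..<c+t}. F x) = (LBINT x:{s..<t}. F (c + x))"
  unfolding set_lebesgue_integral_def
  by (subst lborel_integral_real_affine[where c = 1 and t = c])
     (auto intro!: Bochner_Integration.integral_cong simp: indicator_def)

text \<open>Keeps of a Walsh function only what repeated integration uses. \<open>L i\<close> stands
  for the position, counted from 0, of the nonzero digit number \<open>i + 1\<close>; the grids of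
  mesh \<open>1 / q ^ L i\<close> get coarser as \<open>i\<close> grows. The factors
  \<open>\<rho>\<close> may depend on the cell.\<close>

locale walsh_structure =
  fixes q v :: nat and W :: "real \<Rightarrow> complex" and L :: "nat \<Rightarrow> nat"
  assumes q: "q \<ge> 2"
    and W_measurable [measurable]: "W \<in> borel_measurable borel"
    and W_le_1: "norm (W x) \<le> 1"
    and L_less: "i < j \<Longrightarrow> j < v \<Longrightarrow> L j < L i"
    and digit_copies: "i < v \<Longrightarrow> n < q ^ L i \<Longrightarrow> \<exists>\<rho>. (\<Sum>d<q. \<rho> d) = 0 \<and>
      (\<forall>d<q. \<forall>y\<in>{0..<1 / real q ^ Suc (L i)}.
         W (real n / real q ^ L i + real d / real q ^ Suc (L i) + y) = \<rho> d * W (real n / real q ^ L i + y))"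
begin

lemma grid_le_1: "N \<le> q ^ l \<Longrightarrow> real N / real q ^ l \<le> 1"
  using q by (simp add: divide_le_eq)

lemma grid_coarsen:
  assumes "l \<le> l'" "N \<le> q ^ l"
  obtains N' where "N' \<le> q ^ l'" "real N / real q ^ l = real N' / real q ^ l'"
proof
  show "N * q ^ (l' - l) \<le> q ^ l'"
    using assms mult_right_mono[of N "q ^ l" "q ^ (l' - l)"] by (simp flip: power_add)
  show "real N / real q ^ l = real (N * q ^ (l' - l)) / real q ^ l'"
    using assms q by (simp add: field_simps flip: power_add)
qed

text \<open>The levels \<open>L\<close> are indexed from 0, so integration number \<open>m\<close>
  belongs to \<open>L (m - 1)\<close>. The endpoint 1 counts as a grid point.\<close>

definition vanishes where
  "vanishes m \<longleftrightarrow> (\<forall>N\<le>q ^ L (m - 1). iterint W m (real N / real q ^ L (m - 1)) = 0)"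

text \<open>The proportionality of \<open>W\<close> on the subcells survives \<open>m\<close> integrations because the earlier
  antiderivatives vanish at the endpoints of the subcells.\<close>

lemma iterint_copies:
  assumes m: "m < v" and van: "\<And>i. 1 \<le> i \<Longrightarrow> i \<le> m \<Longrightarrow> vanishes i" and n: "n < q ^ L m"
    and \<rho>: "\<And>d y. d < q \<Longrightarrow> y \<in> {0..<1 / real q ^ Suc (L m)} \<Longrightarrow>
         W (real n / real q ^ L m + real d / real q ^ Suc (L m) + y) = \<rho> d * W (real n / real q ^ L m + y)"
    and "i \<le> m" "d < q" "y \<in> {0..<1 / real q ^ Suc (L m)}"
  shows "iterint W i (real n / real q ^ L m + real d / real q ^ Suc (L m) + y)
    = \<rho> d * iterint W i (real n / real q ^ L m + y)"
  using \<open>i \<le> m\<close> \<open>y \<in> _\<close>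
proof (induction i arbitrary: y)
  case 0
  then show ?case using \<rho> \<open>d < q\<close> by simp
next
  case (Suc i)
  define h where "h = 1 / real q ^ Suc (L m)"
  define z where "z e = real n / real q ^ L m + real e * h" for e
  have h: "h > 0" using q by (simp add: h_def)
  have z: "z e + h = real (n * q + e + 1) / real q ^ Suc (L m)" for e
    using q by (simp add: z_def h_def field_simps)
  have N: "n * q + e + 1 \<le> q ^ Suc (L m)" if "e < q" for e
  proof -
    have "n * q + e + 1 \<le> n * q + q" using that by simp
    also have "\<dots> = Suc n * q" by simp
    also have "\<dots> \<le> q ^ L m * q" using n by (intro mult_right_mono) auto
    finally show ?thesis by (simp add: mult.commute)
  qed
  \<comment> \<open>The right ends of the subcells have level \<open>Suc (L m)\<close>. Levels
    decrease strictly, so \<open>Suc (L m) \<le> L i\<close>, and these ends lie on the finer grid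
    where the antiderivative of order \<open>Suc i\<close> is already known to vanish.\<close>
  have end0: "iterint W (Suc i) (z e + h) = 0" if e: "e < q" for e
  proof -
    have "Suc (L m) \<le> L i" using L_less[of i m] Suc.prems m by auto
    then obtain N' where N': "N' \<le> q ^ L i" "z e + h = real N' / real q ^ L i"
      using grid_coarsen[OF _ N[OF e], of "L i"] z by metis
    then show ?thesis using van[of "Suc i"] Suc.prems by (auto simp: vanishes_def simp del: iterint.simps)
  qed
  have le1: "z e + h \<le> 1" if "e < q" for e
    using grid_le_1[OF N[OF that]] unfolding z .
  have z0: "0 \<le> z e" for e using h by (simp add: z_def)
  have y: "0 \<le> y" "y < h" using Suc.prems by (auto simp: h_def)
  have expand: "iterint W (Suc i) (z e + y) = (LBINT x:{y..<h}. iterint W i (z e + x))" if "e < q" for e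
  proof -
    have "iterint W (Suc i) (z e + y) = (LBINT x:{z e + y..<z e + h}. iterint W i x)"
      using iterint_split[of W "z e + y" "z e + h" i] le1[OF that] y z0[of e] W_le_1 end0[OF that] by simp
    also have "\<dots> = (LBINT x:{y..<h}. iterint W i (z e + x))" by (rule set_integral_shift)
    finally show ?thesis .
  qed
  have zd: "real n / real q ^ L m + real d / real q ^ Suc (L m) = z d" "real n / real q ^ L m = z 0"
    by (auto simp: z_def h_def)
  have "iterint W (Suc i) (z d + y) = (LBINT x:{y..<h}. iterint W i (z d + x))"
    by (rule expand) fact
  also have "\<dots> = (LBINT x:{y..<h}. \<rho> d * iterint W i (z 0 + x))"
    using Suc.IH Suc.prems y unfolding zd[symmetric] h_def
    by (intro set_lebesgue_integral_cong) auto
  also have "\<dots> = \<rho> d * (LBINT x:{y..<h}. iterint W i (z 0 + x))" by simp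
  also have "\<dots> = \<rho> d * iterint W (Suc i) (z 0 + y)"
    using expand[of 0] q by simp
  finally show ?case unfolding zd(1) unfolding zd(2) .
qed

text \<open>The cell integral is the sum of the integrals over the \<open>q\<close> subcells. Each
  of them is \<open>\<rho> d\<close> times the first one, so the sum of the factors splits off, and
  it is 0.\<close>

lemma iterint_cell_mean_0:
  assumes m: "m < v" and van: "\<And>i. 1 \<le> i \<Longrightarrow> i \<le> m \<Longrightarrow> vanishes i" and n: "n < q ^ L m"
  shows "(LBINT x:{real n / real q ^ L m..<(real n + 1) / real q ^ L m}. iterint W m x) = 0"
proof -
  obtain \<rho> where \<rho>0: "(\<Sum>d<q. \<rho> d) = 0" and
    \<rho>: "\<And>d y. d < q \<Longrightarrow> y \<in> {0..<1 / real q ^ Suc (L m)} \<Longrightarrow>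
         W (real n / real q ^ L m + real d / real q ^ Suc (L m) + y) = \<rho> d * W (real n / real q ^ L m + y)"
    using digit_copies[OF m n] by blast
  define h where "h = 1 / real q ^ Suc (L m)"
  define z where "z e = real n / real q ^ L m + real e * h" for e
  have h: "h > 0" using q by (simp add: h_def)
  have zq: "z q = (real n + 1) / real q ^ L m" using q by (simp add: z_def h_def field_simps)
  have zq1: "z q \<le> 1"
    unfolding zq using grid_le_1[of "Suc n" "L m"] n by (simp add: add.commute)
  have z0: "0 \<le> z e" for e using h by (simp add: z_def)
  have z1: "z e \<le> 1" if "e \<le> q" for e
  proof -
    have "real e * h \<le> real q * h" using that h by (intro mult_right_mono) auto
    then show ?thesis using zq1 by (simp add: z_def)
  qed
  have z0k: "z 0 \<le> z e" for e using h by (simp add: z_def)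
  have zS: "z (Suc e) = z e + h" for e by (simp add: z_def algebra_simps)
  have step: "(LBINT x:{z e..<z (Suc e)}. iterint W m x) = \<rho> e * (LBINT x:{0..<h}. iterint W m (z 0 + x))"
    if "e < q" for e
  proof -
    have "(LBINT x:{z e..<z (Suc e)}. iterint W m x) = (LBINT x:{z e + 0..<z e + h}. iterint W m x)"
      by (simp add: zS)
    also have "\<dots> = (LBINT x:{0..<h}. iterint W m (z e + x))"
      by (rule set_integral_shift)
    also have "\<dots> = (LBINT x:{0..<h}. \<rho> e * iterint W m (z 0 + x))"
      using iterint_copies[OF m van n \<rho> order_refl that] by (intro set_lebesgue_integral_cong) (auto simp: z_def h_def)
    finally show ?thesis by simp
  qed
  have "(LBINT x:{z 0..<z k}. iterint W m x) = (\<Sum>e<k. \<rho> e) * (LBINT x:{0..<h}. iterint W m (z 0 + x))" if "k \<le> q" for k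
    using that
  proof (induction k)
    case (Suc k)
    have "{z 0..<z (Suc k)} = {z 0..<z k} \<union> {z k..<z (Suc k)}"
      using h z0k[of k] by (auto simp: zS)
    then have "(LBINT x:{z 0..<z (Suc k)}. iterint W m x) =
      (LBINT x:{z 0..<z k}. iterint W m x) + (LBINT x:{z k..<z (Suc k)}. iterint W m x)"
      using z0 z1 Suc.prems W_le_1
      by (simp add: set_integral_Un iterint_set_integrable Suc_le_eq)
    then show ?case using Suc step[of k] by (simp add: algebra_simps)
  qed (auto simp: set_lebesgue_integral_def)
  from this[of q] show ?thesis using \<rho>0 zq by (simp add: z_def)
qed

text \<open>Values at neighbouring grid points differ by a cell integral of the previous
  antiderivative, which is 0; so the value 0 at the right end 1 spreads leftwards over the grid. The
  induction is strong because \<open>iterint_copies\<close> needs all lower orders to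
  vanish.\<close>

lemma iterint_vanishes:
  assumes "1 \<le> m" "m \<le> v"
  shows "vanishes m"
  using assms
proof (induction m rule: less_induct)
  case (less m)
  obtain k where k: "m = Suc k" using less.prems by (cases m) auto
  have kv: "k < v" using k less.prems by simp
  have van: "vanishes i" if "1 \<le> i" "i \<le> k" for i using less that k by auto
  have "iterint W (Suc k) (real N / real q ^ L k) = 0" if "N \<le> q ^ L k" for N
    using that
  proof (induction N rule: inc_induct)
    case base
    then show ?case using q by (simp add: set_lebesgue_integral_def)
  next
    case (step N)
    have "real N / real q ^ L k \<le> real (Suc N) / real q ^ L k" by (simp add: divide_right_mono)
    moreover have "real (Suc N) / real q ^ L k \<le> 1"
      using step q by (simp add: field_simps flip: of_nat_power of_nat_Suc)
    ultimately have "iterint W (Suc k) (real N / real q ^ L k) =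
       (LBINT x:{real N / real q ^ L k..<real (Suc N) / real q ^ L k}. iterint W k x)
       + iterint W (Suc k) (real (Suc N) / real q ^ L k)"
      using W_le_1 by (intro iterint_split) auto
    then show ?case using step iterint_cell_mean_0[OF kv van step(2)] by (simp add: add.commute)
  qed
  then show ?case by (simp add: vanishes_def k del: iterint.simps)
qed

text \<open>The origin lies on every grid. This removes the boundary terms of Taylor's formula whose
  order does not exceed the number of nonzero digits.\<close>

lemma iterint_0_eq_0:
  assumes "1 \<le> m" "m \<le> v" shows "iterint W m 0 = 0"
  using iterint_vanishes[OF assms] unfolding vanishes_def by (metis divide_eq_0_iff le0 of_nat_0)

lemma iterint_mean_0:
  assumes "m < v" "n < q ^ L m"
  shows "(LBINT x:{real n / real q ^ L m..<(real n + 1) / real q ^ L m}. iterint W m x) = 0"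
  using assms by (intro iterint_cell_mean_0 iterint_vanishes) auto

text \<open>The new antiderivative vanishes at the right end of the cell that contains
  \<open>x\<close>. Integration therefore only has to run to this end, and each order gains the
  length of a cell as a factor.\<close>

lemma norm_iterint_le:
  assumes "m \<le> v" "x \<in> {0..<1}"
  shows "norm (iterint W m x) \<le> (\<Prod>i<m. 1 / real q ^ L i)"
  using assms
proof (induction m arbitrary: x)
  case 0
  then show ?case using W_le_1 by simp
next
  case (Suc m)
  define N where "N = nat \<lfloor>x * real q ^ L m\<rfloor>"
  have qpos: "real q ^ L m > 0" using q by simp
  have N: "real N \<le> x * real q ^ L m" "x * real q ^ L m < real N + 1"
    using Suc.prems qpos by (auto simp: N_def of_nat_nat)
  have "real N < real q ^ L m" using N Suc.prems qpos
    by (smt (verit) atLeastLessThan_iff mult_less_cancel_right2)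
  then have Nq: "N < q ^ L m" by (simp flip: of_nat_power)
  let ?e = "real (Suc N) / real q ^ L m"
  have e1: "?e \<le> 1" using Nq qpos by (simp add: field_simps flip: of_nat_power of_nat_Suc)
  have xe: "x \<le> ?e" using N qpos by (simp add: field_simps)
  have "?e - x \<le> 1 / real q ^ L m" using N qpos by (simp add: field_simps)
  have "iterint W (Suc m) x = (LBINT y:{x..<?e}. iterint W m y) + iterint W (Suc m) ?e"
    using W_le_1 Suc.prems xe e1 by (intro iterint_split) auto
  also have "iterint W (Suc m) ?e = 0"
    using iterint_vanishes[of "Suc m"] Suc.prems Nq unfolding vanishes_def
    by (metis One_nat_def Suc_le_eq diff_Suc_1 le_add1 plus_1_eq_Suc)
  finally have "norm (iterint W (Suc m) x) = norm (LBINT y:{x..<?e}. iterint W m y)" by simp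
  also have "\<dots> \<le> (\<Prod>i<m. 1 / real q ^ L i) * measure lborel {x..<?e}"
    using Suc e1 by (intro norm_set_integral_le) (use xe in auto)
  also have "\<dots> \<le> (\<Prod>i<m. 1 / real q ^ L i) * (1 / real q ^ L m)"
    using xe \<open>?e - x \<le> _\<close> by (intro mult_left_mono prod_nonneg) auto
  finally show ?case by simp
qed

end


section \<open>Digits and Walsh functions\<close>

lemma floor_times_power_div:
  assumes "0 < q"
  shows "\<lfloor>x * real q ^ n\<rfloor> div int q ^ m = \<lfloor>x * real q ^ n / real q ^ m\<rfloor>"
  using floor_divide_real_eq_div[of "int (q ^ m)" "x * real q ^ n"] by simp

text \<open>\<open>D n\<close> is the number formed by the first \<open>n\<close> digits. For any
  admissible digit sequence with prefixes \<open>P n\<close>, the upper bounds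
  \<open>(P n + 1) / q ^ n\<close> decrease to \<open>x\<close> and drop strictly at a digit other
  than \<open>q - 1\<close>. Infinitely many such digits make \<open>x\<close> strictly smaller than
  every upper bound, which forces \<open>P n = D n\<close>.\<close>

lemma real_digit_eq:
  assumes q: "q \<ge> 2" and x: "x \<in> {0..<1}"
  shows "real_digit q x l = nat \<lfloor>x * real q ^ Suc l\<rfloor> mod q"
proof -
  define D where "D n = nat \<lfloor>x * real q ^ n\<rfloor>" for n
  define d where "d n = D (Suc n) mod q" for n
  have D0: "D 0 = 0" using x by (simp add: D_def)
  have Dle: "real (D n) \<le> x * real q ^ n" and Dlt: "x * real q ^ n < real (D n) + 1" for n
    using x by (auto simp: D_def of_nat_nat)
  have Deq: "m = D n" if "real m \<le> x * real q ^ n" "x * real q ^ n < real m + 1" for m n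
    using that Dle[of n] Dlt[of n] by linarith
  have DS: "D (Suc n) = q * D n + d n" for n
  proof -
    have "\<lfloor>x * real q ^ Suc n\<rfloor> div int q ^ 1 = \<lfloor>x * real q ^ n\<rfloor>"
      using q by (subst floor_times_power_div) auto
    then have "int (D (Suc n) div q) = int (D n)"
      using x by (simp add: D_def zdiv_int)
    then have "D (Suc n) div q = D n" by (simp only: of_nat_eq_iff)
    then show ?thesis unfolding d_def by (metis div_mult_mod_eq mult.commute)
  qed
  have unique: "e = d" if e: "\<And>n. e n < q" and sums: "(\<lambda>n. real (e n) / real q ^ (n + 1)) sums x"
    and inf: "infinite {n. e n \<noteq> q - 1}" for e
  proof -
    define P where "P = rec_nat 0 (\<lambda>n N. q * N + e n)"
    have P: "P 0 = 0" "P (Suc n) = q * P n + e n" for n by (simp_all add: P_def)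
    have part: "(\<Sum>i<n. real (e i) / real q ^ (i + 1)) = real (P n) / real q ^ n" for n
      using q by (induction n) (simp_all add: P field_simps)
    have lim: "(\<lambda>n. real (P n) / real q ^ n) \<longlonglongrightarrow> x"
      using sums unfolding sums_def part .
    have "(\<lambda>n. 1 / real q ^ n) \<longlonglongrightarrow> 0"
      using q LIMSEQ_inverse_realpow_zero[of "real q"] by (simp add: field_simps)
    from tendsto_add[OF lim this] have limU: "(\<lambda>n. (real (P n) + 1) / real q ^ n) \<longlonglongrightarrow> x"
      by (simp add: add_divide_distrib)
    have stepU: "(real (P (Suc n)) + 1) / real q ^ Suc n = (real (P n) + 1) / real q ^ n - (real q - 1 - real (e n)) / real q ^ Suc n" for n
      using q by (simp add: P field_simps)
    have decU: "decseq (\<lambda>n. (real (P n) + 1) / real q ^ n)"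
      unfolding decseq_Suc_iff
    proof
      fix n
      have "real (e n) \<le> real q - 1" using e[of n] by linarith
      then have "0 \<le> (real q - 1 - real (e n)) / real q ^ Suc n" by simp
      then show "(real (P (Suc n)) + 1) / real q ^ Suc n \<le> (real (P n) + 1) / real q ^ n"
        unfolding stepU by linarith
    qed
    have "P n = D n" for n
    proof (rule Deq)
      have "real (P n) / real q ^ n \<le> x"
        unfolding part[symmetric] using sums by (intro sum_le_suminf[of _ "{..<n}", THEN order_trans])
          (auto simp: sums_iff)
      then show "real (P n) \<le> x * real q ^ n" using q by (simp add: field_simps)
      obtain m where m: "m \<ge> n" "e m \<noteq> q - 1"
        using inf unfolding infinite_nat_iff_unbounded_le by auto
      have "real (e m) < real q - 1" using e[of m] m by linarith
      then have "(real q - 1 - real (e m)) / real q ^ Suc m > 0" using q by simp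
      have "x \<le> (real (P (Suc m)) + 1) / real q ^ Suc m"
        by (rule decseq_ge[OF decU limU])
      also have "\<dots> < (real (P m) + 1) / real q ^ m"
        unfolding stepU using \<open>_ > 0\<close> by linarith
      also have "\<dots> \<le> (real (P n) + 1) / real q ^ n" using decU m by (auto simp: decseq_def)
      finally show "x * real q ^ n < real (P n) + 1" using q by (simp add: field_simps)
    qed
    then show ?thesis using P(2) DS by (metis add_left_cancel ext)
  qed
  have "(\<forall>l. d l < q) \<and> (\<lambda>l. real (d l) / real q ^ (l + 1)) sums x \<and> infinite {l. d l \<noteq> q - 1}"
  proof (intro conjI allI)
    show "d l < q" for l using q by (simp add: d_def)
    have part: "(\<Sum>i<n. real (d i) / real q ^ (i + 1)) = real (D n) / real q ^ n" for n
      using q by (induction n) (simp_all add: D0 DS field_simps)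
    have *: "(\<lambda>n. 1 / real q ^ n) \<longlonglongrightarrow> 0"
      using q LIMSEQ_inverse_realpow_zero[of "real q"] by (simp add: field_simps)
    have lim: "(\<lambda>n. real (D n) / real q ^ n) \<longlonglongrightarrow> x"
    proof (rule tendsto_sandwich)
      show "(\<lambda>n. x - 1 / real q ^ n) \<longlonglongrightarrow> x" using tendsto_diff[OF tendsto_const *, of x] by simp
      show "\<forall>\<^sub>F n in sequentially. x - 1 / real q ^ n \<le> real (D n) / real q ^ n"
      proof (intro always_eventually allI)
        fix n
        have "x \<le> (real (D n) + 1) / real q ^ n"
          using Dlt[of n] q by (simp add: le_divide_eq less_imp_le)
        then show "x - 1 / real q ^ n \<le> real (D n) / real q ^ n" by (simp add: add_divide_distrib)
      qed
      show "\<forall>\<^sub>F n in sequentially. real (D n) / real q ^ n \<le> x"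
        using Dle q by (intro always_eventually allI) (simp add: field_simps)
    qed auto
    then show "(\<lambda>l. real (d l) / real q ^ (l + 1)) sums x" unfolding sums_def part .
    show "infinite {l. d l \<noteq> q - 1}"
    proof
      assume "finite {l. d l \<noteq> q - 1}"
      then obtain N where N: "\<And>l. l \<ge> N \<Longrightarrow> d l = q - 1"
        unfolding finite_nat_set_iff_bounded by (metis (mono_tags, lifting) mem_Collect_eq not_le)
      \<comment> \<open>If all digits from \<open>N\<close> on were \<open>q - 1\<close>, the upper
        bounds would stay constant, and their limit \<open>x\<close> would equal one of them,
        against \<open>Dlt\<close>.\<close>
      have const: "(real (D n) + 1) / real q ^ n = (real (D N) + 1) / real q ^ N" if "n \<ge> N" for n
        using that
      proof (induction n rule: dec_induct)
        case (step n)
        have "real (D (Suc n)) + 1 = real q * (real (D n) + 1)"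
          using q by (simp add: DS N step of_nat_diff algebra_simps)
        then show ?case using step q by simp
      qed simp
      have "(\<lambda>n. (real (D n) + 1) / real q ^ n) \<longlonglongrightarrow> x"
        using tendsto_add[OF lim *] by (simp add: add_divide_distrib)
      moreover have "(\<lambda>n. (real (D n) + 1) / real q ^ n) \<longlonglongrightarrow> (real (D N) + 1) / real q ^ N"
        by (rule tendsto_eventually) (auto simp: eventually_sequentially intro!: exI[of _ N] const)
      ultimately have "x = (real (D N) + 1) / real q ^ N" by (rule LIMSEQ_unique)
      then show False using Dlt[of N] q by simp
    qed
  qed
  then have "real_digit q x = d"
    unfolding real_digit_def by (intro the_equality) (use unique in blast)+
  then show ?thesis by (simp add: d_def D_def)
qed

text \<open>Moving from the first subcell to subcell \<open>d\<close> changes only the digit with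
  index \<open>L\<close>: the earlier digits are determined by \<open>n\<close>, and for the later
  ones the scaled point moves by a multiple of \<open>q\<close>.\<close>

lemma real_digit_cell:
  assumes q: "q \<ge> 2" and n: "n < q ^ L" and d: "d < q" and y: "y \<in> {0..<1 / real q ^ Suc L}"
  shows "real n / real q ^ L + real d / real q ^ Suc L + y \<in> {0..<1}"
    and "real_digit q (real n / real q ^ L + real d / real q ^ Suc L + y) l = (if l = L then d else real_digit q (real n / real q ^ L + y) l)"
proof -
  define X where "X d = real n / real q ^ L + real d / real q ^ Suc L + y" for d :: nat
  have qpos: "real q > 0" using q by simp
  have XS: "\<lfloor>X d * real q ^ Suc L\<rfloor> = int (n * q + d)" if "d < q" for d
    using y qpos by (intro floor_unique) (auto simp: X_def field_simps)
  have X01: "X d \<in> {0..<1}" if d: "d < q" for d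
  proof -
    have "n * q + d + 1 \<le> n * q + q" using d by simp
    also have "\<dots> = Suc n * q" by simp
    also have "\<dots> \<le> q ^ L * q" using n by (intro mult_right_mono) auto
    finally have "n * q + d + 1 \<le> q ^ Suc L" by (simp add: mult.commute)
    then have *: "real (n * q + d + 1) \<le> real (q ^ Suc L)" by (simp only: of_nat_le_iff)
    have "X d * real q ^ Suc L < real_of_int (int (n * q + d)) + 1"
      using XS[OF d] by linarith
    also have "\<dots> \<le> real q ^ Suc L" using * by simp
    finally have "X d < 1" using qpos by (simp add: mult_less_cancel_right2)
    then show ?thesis using y by (auto simp: X_def)
  qed
  show "real n / real q ^ L + real d / real q ^ Suc L + y \<in> {0..<1}" using X01[OF d] by (simp add: X_def)
  have dig: "real_digit q (X e) l = nat \<lfloor>X e * real q ^ Suc l\<rfloor> mod q" if "e < q" for e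
    using real_digit_eq[OF q X01[OF that]] .
  have "real_digit q (X d) l = (if l = L then d else real_digit q (X 0) l)"
  proof (cases l L rule: linorder_cases)
    case less
    have "\<lfloor>X e * real q ^ Suc l\<rfloor> = int n div int q ^ (L - Suc l)" if e: "e < q" for e
    proof -
      have "X e * real q ^ Suc l = X e * real q ^ Suc L / real q ^ (L - l)"
        using qpos less by (simp add: field_simps flip: power_add power_Suc)
      then have "\<lfloor>X e * real q ^ Suc l\<rfloor> = int (n * q + e) div int q ^ (L - l)"
        using floor_times_power_div[of q "X e" "Suc L" "L - l"] XS[OF e] q by simp
      also have "\<dots> = int ((n * q + e) div q ^ (L - l))" by (simp add: zdiv_int)
      also have "q ^ (L - l) = q * q ^ (L - Suc l)"
        using less by (simp flip: power_Suc add: Suc_diff_Suc)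
      also have "(n * q + e) div \<dots> = n div q ^ (L - Suc l)"
        using e by (simp add: div_mult2_eq)
      also have "int \<dots> = int n div int q ^ (L - Suc l)" by (simp add: zdiv_int)
      finally show ?thesis .
    qed
    then show ?thesis using less dig d q by simp
  next
    case equal
    then show ?thesis using dig[OF d] XS[OF d] d by (simp del: of_nat_add of_nat_mult power_Suc)
  next
    case greater
    have "X d * real q ^ Suc l = X 0 * real q ^ Suc l + real_of_int (int (d * q ^ (l - L)))"
      using qpos greater by (simp add: X_def field_simps flip: power_add power_Suc)
    then have "\<lfloor>X d * real q ^ Suc l\<rfloor> = \<lfloor>X 0 * real q ^ Suc l\<rfloor> + int (d * q ^ (l - L))"
      by (metis floor_add_int)
    moreover have "q ^ (l - L) = q * q ^ (l - Suc L)"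
      using greater by (simp flip: power_Suc add: Suc_diff_Suc)
    moreover have "0 \<le> X 0" using X01[of 0] q by auto
    ultimately have "nat \<lfloor>X d * real q ^ Suc l\<rfloor> = nat \<lfloor>X 0 * real q ^ Suc l\<rfloor> + q * (d * q ^ (l - Suc L))"
      by (simp add: nat_add_distrib nat_mult_distrib ac_simps flip: of_nat_power of_nat_mult)
    then show ?thesis using greater dig d q by simp
  qed
  then show "real_digit q (real n / real q ^ L + real d / real q ^ Suc L + y) l = (if l = L then d else real_digit q (real n / real q ^ L + y) l)"
    by (simp add: X_def)
qed

section \<open>Roots of unity and characters of the finite field\<close>

definition root_exp :: "nat \<Rightarrow> nat \<Rightarrow> complex" where
  "root_exp p n = exp (2 * pi * \<i> / of_nat p * of_nat n)"

lemma root_exp_0 [simp]: "root_exp p 0 = 1"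
  by (simp add: root_exp_def)

lemma root_exp_add: "root_exp p (m + n) = root_exp p m * root_exp p n"
  by (simp add: root_exp_def ring_distribs exp_add)

lemma root_exp_sum: "root_exp p (sum f A) = (\<Prod>i\<in>A. root_exp p (f i))"
  by (induction A rule: infinite_finite_induct) (auto simp: root_exp_add)

lemma root_exp_mult: "root_exp p (m * n) = root_exp p m ^ n"
  by (induction n) (auto simp: root_exp_add)

lemma norm_root_exp [simp]: "norm (root_exp p n) = 1"
proof -
  have "root_exp p n = exp (\<i> * of_real (2 * pi / real p * real n))"
    by (simp add: root_exp_def field_simps)
  then show ?thesis by (simp only: norm_exp_i_times)
qed

lemma root_exp_self: "p > 0 \<Longrightarrow> root_exp p p = 1"
  by (simp add: root_exp_def exp_two_pi_i mult.commute)

lemma root_exp_neq_1: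
  assumes "0 < n" "n < p" shows "root_exp p n \<noteq> 1"
proof
  assume "root_exp p n = 1"
  then obtain m :: int where m: "2 * pi * real n / real p = of_int (2 * m) * pi"
    using assms by (auto simp: root_exp_def exp_eq_1)
  then have "real n = of_int m * real p" using assms by (simp add: field_simps)
  then have "int n = m * int p" by (metis of_int_eq_iff of_int_mult of_int_of_nat_eq)
  then have "int p dvd int n" by simp
  then have "p dvd n" by (simp only: int_dvd_int_iff)
  then show False using assms by (auto dest: dvd_imp_le)
qed

lemma sum_root_exp_eq_0:
  assumes "0 < n" "n < p" shows "(\<Sum>c<p. root_exp p (n * c)) = 0"
  using assms root_exp_neq_1[OF assms] root_exp_self[of p]
  by (simp add: root_exp_mult geometric_sum)
    (metis mult.commute power_one root_exp_mult diff_self div_0)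

locale walsh_setting =
  fixes p r q :: nat and \<theta> :: "'a::field" and \<phi> :: "nat \<Rightarrow> 'a"
  assumes p: "p \<ge> 2" and r: "r \<ge> 1" and q_def: "q = p ^ r"
    and basis: "is_power_basis p r \<theta>" and \<phi>: "bij_betw \<phi> {..<q} UNIV" and \<phi>0: "\<phi> 0 = 0"
begin

lemma q: "q \<ge> 2"
  using p r self_le_power[of p r] unfolding q_def by linarith

abbreviation \<eta> :: "nat \<Rightarrow> nat \<Rightarrow> nat" where
  "\<eta> i n \<equiv> Zp_coords p r \<theta> (\<phi> n) i"

lemma bij_coords: "bij_betw (\<lambda>n. Zp_coords p r \<theta> (\<phi> n)) {..<q} (Zp_vectors p r)"
proof -
  have "bij_betw (Zp_coords p r \<theta>) UNIV (Zp_vectors p r)"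
    unfolding Zp_coords_def by (rule bij_betw_the_inv_into) (use basis in \<open>simp add: is_power_basis_def\<close>)
  from bij_betw_trans[OF \<phi> this] show ?thesis by (simp add: comp_def)
qed

lemma coords_0: "Zp_coords p r \<theta> (\<phi> 0) = (\<lambda>i\<in>{1..r}. 0)"
  unfolding Zp_coords_def \<phi>0
proof (rule the_inv_into_f_eq)
  show "inj_on (Zp_combination r \<theta>) (Zp_vectors p r)"
    using basis by (simp add: is_power_basis_def bij_betw_def)
  show "Zp_combination r \<theta> (\<lambda>i\<in>{1..r}. 0) = 0" by (simp add: Zp_combination_def)
  show "(\<lambda>i\<in>{1..r}. 0) \<in> Zp_vectors p r" using p by (simp add: Zp_vectors_def)
qed

definition pairing :: "nat \<Rightarrow> nat \<Rightarrow> nat" where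
  "pairing c d = (\<Sum>i=1..r. \<eta> i c * \<eta> i d)"

lemma pairing_0 [simp]: "pairing c 0 = 0"
  by (simp add: pairing_def coords_0)

text \<open>Orthogonality of a nontrivial character: in coordinates the sum runs over all
  \<open>Z\<^sub>p\<close> vectors and factors, and a coordinate in which the digit \<open>c\<close>
  does not vanish contributes the full sum of powers of a nontrivial root of unity.\<close>

lemma sum_pairing:
  assumes c: "0 < c" "c < q"
  shows "(\<Sum>d<q. root_exp p (pairing c d)) = 0"
proof -
  define e where "e = Zp_coords p r \<theta> (\<phi> c)"
  have e: "e \<in> Zp_vectors p r"
    using bij_betwE[OF bij_coords] c by (auto simp: e_def)
  \<comment> \<open>The zero vector is the image of the digit 0, and distinct digits have distinct
    coordinates.\<close>
  have "e \<noteq> (\<lambda>i\<in>{1..r}. 0)"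
    using bij_betw_imp_inj_on[OF bij_coords] c unfolding e_def coords_0[symmetric] inj_on_def by force
  then obtain i where i: "i \<in> {1..r}" "e i \<noteq> 0"
    using e unfolding Zp_vectors_def by (metis (no_types, lifting) PiE_restrict restrict_ext)
  have "(\<Sum>d<q. root_exp p (pairing c d)) = (\<Sum>g\<in>Zp_vectors p r. root_exp p (\<Sum>i=1..r. e i * g i))"
    unfolding pairing_def e_def by (rule sum.reindex_bij_betw[OF bij_coords])
  also have "\<dots> = (\<Sum>g\<in>Zp_vectors p r. \<Prod>i=1..r. root_exp p (e i * g i))"
    by (simp add: root_exp_sum)
  also have "\<dots> = (\<Prod>i=1..r. \<Sum>g<p. root_exp p (e i * g))"
    unfolding Zp_vectors_def by (rule prod_sum_PiE[symmetric]) auto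
  also have "\<dots> = 0"
    using i e by (auto intro!: prod_zero bexI[of _ i] sum_root_exp_eq_0 simp: Zp_vectors_def PiE_iff)
  finally show ?thesis .
qed

lemma wal1_eq:
  "wal1 p r \<theta> \<phi> k x = (\<Prod>l | q ^ l \<le> k. root_exp p (pairing (nat_digit q k l) (real_digit q x l)))"
  unfolding wal1_def Let_def root_exp_def[symmetric] q_def[symmetric] root_exp_sum pairing_def ..

text \<open>Extended by 0 to the line: outside \<open>[0,1)\<close> there is no digit expansion, and
  the cut-off lets integrals run over all reals.\<close>

definition W :: "nat \<Rightarrow> real \<Rightarrow> complex" where
  "W k x = (if x \<in> {0..<1} then cnj (wal1 p r \<theta> \<phi> k x) else 0)"

lemma norm_W_le_1: "norm (W k x) \<le> 1"
  by (simp add: W_def wal1_eq flip: prod_norm)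

lemma W_eq_0: "x \<notin> {0..<1} \<Longrightarrow> W k x = 0"
  by (simp only: W_def if_False)

lemma W_measurable: "W k \<in> borel_measurable borel"
proof -
  define G where "G l z = cnj (root_exp p (pairing (nat_digit q k l) (nat z mod q)))" for l z
  \<comment> \<open>A digit depends on \<open>x\<close> only through an integer floor, and every
    function on the integers is measurable.\<close>
  have [measurable]: "(\<lambda>x. G l \<lfloor>x * real q ^ Suc l\<rfloor>) \<in> borel_measurable borel" for l
    by (rule measurable_compose[of _ _ "count_space UNIV"]) measurable
  have [measurable]: "Measurable.pred borel (\<lambda>x. x \<in> {0..<1::real})"
    by measurable
  have "W k = (\<lambda>x. if x \<in> {0..<1} then \<Prod>l | q ^ l \<le> k. G l \<lfloor>x * real q ^ Suc l\<rfloor> else 0)"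
    by (auto simp: fun_eq_iff W_def G_def wal1_eq real_digit_eq[OF q] intro!: prod.cong)
  also have "\<dots> \<in> borel_measurable borel"
    by measurable
  finally show ?thesis .
qed

lemma finite_digit_range: "finite {l. q ^ l \<le> k}"
proof (rule finite_subset)
  show "{l. q ^ l \<le> k} \<subseteq> {..k}"
  proof
    fix l assume "l \<in> {l. q ^ l \<le> k}"
    moreover have "l < q ^ l" using q by (intro power_gt_expt) auto
    ultimately show "l \<in> {..k}" by auto
  qed
qed simp

lemma nat_digit_less: "nat_digit q k l < q"
  using q by (simp add: nat_digit_def)

lemma nat_digit_pos_imp: "nat_digit q k l \<noteq> 0 \<Longrightarrow> q ^ l \<le> k"
  unfolding nat_digit_def using div_less by (metis not_le mod_0)

text \<open>Only the factor belonging to \<open>L\<close> sees the subcell. On the first subcell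
  that digit is 0 and the factor is 1, so the factor itself is the ratio; its sum over
  \<open>d\<close> vanishes by \<open>sum_pairing\<close>.\<close>

lemma W_copies:
  assumes L: "nat_digit q k L \<noteq> 0" and n: "n < q ^ L"
  shows "\<exists>\<rho>. (\<Sum>d<q. \<rho> d) = 0 \<and> (\<forall>d<q. \<forall>y\<in>{0..<1 / real q ^ Suc L}.
         W k (real n / real q ^ L + real d / real q ^ Suc L + y) = \<rho> d * W k (real n / real q ^ L + y))"
proof (intro exI[of _ "\<lambda>d. cnj (root_exp p (pairing (nat_digit q k L) d))"] conjI allI impI ballI)
  show "(\<Sum>d<q. cnj (root_exp p (pairing (nat_digit q k L) d))) = 0"
    using sum_pairing[of "nat_digit q k L"] L nat_digit_less by (simp flip: cnj_sum)
  fix d y assume d: "d < q" and y: "y \<in> {0..<1 / real q ^ Suc L}"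
  let ?b = "real n / real q ^ L + y"
  let ?x = "real n / real q ^ L + real d / real q ^ Suc L + y"
  have x: "?x \<in> {0..<1}" by (rule real_digit_cell(1)[OF q n d y])
  have q0: "0 < q" using q by simp
  have x0: "?b \<in> {0..<1}" using real_digit_cell(1)[OF q n q0 y] by simp
  have L_in: "L \<in> {l. q ^ l \<le> k}" using nat_digit_pos_imp[OF L] by simp
  have "real_digit q ?b L = 0" using real_digit_cell(2)[OF q n q0 y, of L] by simp
  then have "wal1 p r \<theta> \<phi> k ?b = (\<Prod>l\<in>{l. q ^ l \<le> k} - {L}. root_exp p (pairing (nat_digit q k l) (real_digit q ?b l)))"
    unfolding wal1_eq by (subst prod.remove[OF finite_digit_range L_in]) simp
  moreover have "wal1 p r \<theta> \<phi> k ?x = root_exp p (pairing (nat_digit q k L) d) *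
     (\<Prod>l\<in>{l. q ^ l \<le> k} - {L}. root_exp p (pairing (nat_digit q k l) (real_digit q ?b l)))"
    unfolding wal1_eq using real_digit_cell(2)[OF q n d y]
    by (subst prod.remove[OF finite_digit_range L_in]) (auto intro!: prod.cong)
  ultimately show "W k ?x = cnj (root_exp p (pairing (nat_digit q k L) d)) * W k ?b"
    using x x0 by (simp only: W_def if_True complex_cnj_mult)
qed

lemma finite_digit_positions: "finite {a. 1 \<le> a \<and> nat_digit q k (a - 1) \<noteq> 0}"
proof (rule finite_subset)
  show "{a. 1 \<le> a \<and> nat_digit q k (a - 1) \<noteq> 0} \<subseteq> Suc ` {l. q ^ l \<le> k}"
    using nat_digit_pos_imp by (auto simp: image_iff) (metis Suc_pred le_eq_less_or_eq less_eq_Suc_le)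
qed (use finite_digit_range in blast)

lemma digit_positions_props:
  fixes k defines "as \<equiv> digit_positions q k"
  shows "i < length as \<Longrightarrow> 1 \<le> as ! i \<and> nat_digit q k (as ! i - 1) \<noteq> 0"
    and "i < j \<Longrightarrow> j < length as \<Longrightarrow> as ! j < as ! i"
proof -
  let ?A = "{a. 1 \<le> a \<and> nat_digit q k (a - 1) \<noteq> 0}"
  have set: "set as = ?A"
    unfolding as_def digit_positions_def using finite_digit_positions by (simp only: set_rev set_sorted_list_of_set)
  show "i < length as \<Longrightarrow> 1 \<le> as ! i \<and> nat_digit q k (as ! i - 1) \<noteq> 0"
    using set nth_mem by blast
  have "sorted_wrt (>) as" unfolding as_def digit_positions_def
    by (simp add: sorted_wrt_rev)
  then show "i < j \<Longrightarrow> j < length as \<Longrightarrow> as ! j < as ! i"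
    by (simp add: sorted_wrt_iff_nth_less)
qed

text \<open>Positions are counted from 1, but a digit at position \<open>a\<close> belongs to the
  power \<open>a - 1\<close> of \<open>q\<close>; hence the levels \<open>a - 1\<close>.\<close>

lemma walsh_structure:
  "walsh_structure q (length (digit_positions q k)) (W k) (\<lambda>i. digit_positions q k ! i - 1)"
proof
  fix i j assume *: "i < j" "j < length (digit_positions q k)"
  show "digit_positions q k ! j - 1 < digit_positions q k ! i - 1"
    using digit_positions_props(2)[OF *] digit_positions_props(1)[OF *(2)] by linarith
next
  fix i n assume "i < length (digit_positions q k)" "n < q ^ (digit_positions q k ! i - 1)"
  then show "\<exists>\<rho>. (\<Sum>d<q. \<rho> d) = 0 \<and> (\<forall>d<q. \<forall>y\<in>{0..<1 / real q ^ Suc (digit_positions q k ! i - 1)}.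
         W k (real n / real q ^ (digit_positions q k ! i - 1) + real d / real q ^ Suc (digit_positions q k ! i - 1) + y) = \<rho> d * W k (real n / real q ^ (digit_positions q k ! i - 1) + y))"
    using digit_positions_props(1)[of i k] by (intro W_copies) auto
qed (use q W_measurable norm_W_le_1 in auto)

end


text \<open>For \<open>m = \<delta>\<close> this is the kernel of the remainder integral; at \<open>t = 0\<close> it is the monomial of
  degree \<open>m - 1\<close> in the Taylor polynomial.\<close>

definition taylor_kernel :: "nat \<Rightarrow> real \<Rightarrow> real \<Rightarrow> real" where
  "taylor_kernel m x t = (if 0 \<le> t \<and> t \<le> x then (x - t) ^ (m - 1) / fact (m - 1) else 0)"

lemma taylor_kernel_measurable [measurable]:
  assumes [measurable]: "f \<in> borel_measurable M" "g \<in> borel_measurable M"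
  shows "(\<lambda>z. taylor_kernel m (f z) (g z)) \<in> borel_measurable M"
  unfolding taylor_kernel_def by measurable

lemma abs_taylor_kernel_le_1:
  assumes "x < 1" shows "\<bar>taylor_kernel m x t\<bar> \<le> 1"
proof (cases "0 \<le> t \<and> t \<le> x")
  case True
  then have "(x - t) ^ (m - 1) \<le> 1" using assms by (intro power_le_one) auto
  then have "(x - t) ^ (m - 1) \<le> fact (m - 1)" using fact_ge_1 by (rule order_trans)
  then have "(x - t) ^ (m - 1) / fact (m - 1) \<le> 1" by (simp add: divide_le_eq_1)
  then show ?thesis using True by (simp add: taylor_kernel_def)
qed (auto simp: taylor_kernel_def)

text \<open>Integration in the second variable raises the order of the kernel by one, which is the
  induction step of \<open>iterint_eq_kernel\<close>. The upper limit may be 1 because the kernel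
  stops at \<open>x < 1\<close>.\<close>

lemma integral_taylor_kernel:
  assumes m: "m \<ge> 1" and t: "0 \<le> t" and x: "x < 1"
  shows "(LBINT y. indicator {t..<1} y * taylor_kernel m x y) = taylor_kernel (Suc m) x t"
proof (cases "t \<le> x")
  case True
  have "(LBINT y. indicator {t..<1} y * taylor_kernel m x y) = (LBINT y. (x - y) ^ (m - 1) / fact (m - 1) * indicator {t..x} y)"
    using t x by (intro Bochner_Integration.integral_cong) (auto simp: taylor_kernel_def indicator_def)
  also have "\<dots> = - ((x - x) ^ m / fact m) - - ((x - t) ^ m / fact m)"
  proof (rule integral_FTC_Icc_real[OF True])
    fix y
    obtain k where k: "m = Suc k" using m by (cases m) auto
    have "((\<lambda>a. - ((x - a) ^ m / fact m)) has_real_derivative - ((real (Suc k) * (0 - 1) * (x - y) ^ k) / fact (Suc k))) (at y)"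
      unfolding k by (auto intro!: derivative_eq_intros simp del: power_Suc fact_Suc of_nat_Suc)
    also have "- ((real (Suc k) * (0 - 1) * (x - y) ^ k) / fact (Suc k)) = (x - y) ^ (m - 1) / fact (m - 1)"
      unfolding k fact_Suc by (simp del: of_nat_Suc)
    finally show "((\<lambda>a. - ((x - a) ^ m / fact m)) has_real_derivative (x - y) ^ (m - 1) / fact (m - 1)) (at y)" .
    show "isCont (\<lambda>a. (x - a) ^ (m - 1) / fact (m - 1)) y" by simp
  qed
  finally show ?thesis using m t True by (simp add: taylor_kernel_def)
next
  case False
  then have *: "indicator {t..<1} y * taylor_kernel m x y = 0" for y
    by (auto simp: taylor_kernel_def indicator_def)
  from False show ?thesis unfolding * by (simp add: taylor_kernel_def)
qed

text \<open>Cauchy's formula for repeated integration, obtained by exchanging the outermost integral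
  with the kernel integral.\<close>

lemma iterint_eq_kernel:
  fixes W :: "real \<Rightarrow> complex"
  assumes W [measurable]: "W \<in> borel_measurable borel" and W1: "\<And>x. norm (W x) \<le> 1"
    and W0: "\<And>x. x \<notin> {0..<1} \<Longrightarrow> W x = 0"
    and m: "m \<ge> 1" and t: "0 \<le> t"
  shows "iterint W m t = (LBINT x. of_real (taylor_kernel m x t) * W x)"
  using m t
proof (induction m arbitrary: t rule: dec_induct)
  case base
  show ?case using base W0
    by (auto simp: set_lebesgue_integral_def taylor_kernel_def indicator_def intro!: Bochner_Integration.integral_cong)
next
  case (step m)
  let ?F = "\<lambda>y x. indicator {t..<1} y * of_real (taylor_kernel m x y) * W x"
  \<comment> \<open>Fubini's theorem applies since the integrand is bounded by 1 and lives on the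
    unit square: the indicator confines \<open>y\<close>, the zero extension of \<open>W\<close>
    confines \<open>x\<close>.\<close>
  have int: "integrable (lborel \<Otimes>\<^sub>M lborel) (case_prod ?F)"
  proof (rule integrableI_bounded_set[where A = "{0..1} \<times> {0..1}" and B = 1])
    show "case_prod ?F \<in> borel_measurable (lborel \<Otimes>\<^sub>M lborel)"
      unfolding split_beta' by measurable
    show "emeasure (lborel \<Otimes>\<^sub>M lborel) ({0..1::real} \<times> {0..1::real}) < \<infinity>"
      by (subst lborel.emeasure_pair_measure_Times) auto
    have le: "norm (?F y x) \<le> 1" for x y
    proof (cases "x \<in> {0..<1}")
      case True
      then have "norm (?F y x) \<le> 1 * 1 * 1"
        unfolding norm_mult using W1 abs_taylor_kernel_le_1[of x m y]
        by (intro mult_mono) (auto simp: indicator_def)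
      then show ?thesis by simp
    qed (use W0 in auto)
    show "AE z in lborel \<Otimes>\<^sub>M lborel. z \<in> {0..1} \<times> {0..1} \<longrightarrow> norm (case_prod ?F z) \<le> 1"
      using le by (intro AE_I2) auto
    have "?F y x = 0" if "(y, x) \<notin> {0..1} \<times> {0..1}" for x y
      using that step.prems W0[of x] by (auto simp: indicator_def not_le)
    then show "AE z in lborel \<Otimes>\<^sub>M lborel. z \<notin> {0..1} \<times> {0..1} \<longrightarrow> case_prod ?F z = 0"
      by (intro AE_I2) (auto split: prod.split)
  qed auto
  have "iterint W (Suc m) t = (LBINT y. LBINT x. ?F y x)"
    using step by (auto simp: set_lebesgue_integral_def indicator_def intro!: Bochner_Integration.integral_cong)
  also have "\<dots> = (LBINT x. LBINT y. ?F y x)"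
    by (rule lborel_pair.Fubini_integral[OF int, symmetric])
  also have "\<dots> = (LBINT x. of_real (taylor_kernel (Suc m) x t) * W x)"
  proof (rule Bochner_Integration.integral_cong[OF refl])
    fix x
    have "(LBINT y. ?F y x) = (LBINT y. of_real (indicator {t..<1} y * taylor_kernel m x y) * W x)"
      by (auto simp: indicator_def intro!: Bochner_Integration.integral_cong)
    also have "\<dots> = of_real (LBINT y. indicator {t..<1} y * taylor_kernel m x y) * W x"
      by (subst integral_complex_of_real[symmetric]) (rule integral_mult_left_zero)
    also have "\<dots> = of_real (taylor_kernel (Suc m) x t) * W x"
    proof (cases "x < 1")
      case True
      then show ?thesis using integral_taylor_kernel[OF step(1) step.prems] by simp
    qed (use W0[of x] in simp)
    finally show "(LBINT y. ?F y x) = of_real (taylor_kernel (Suc m) x t) * W x" .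
  qed
  finally show ?case .
qed


section \<open>Integrals against functions of mean zero\<close>

text \<open>The factors \<open>\<psi>\<close> are controlled on a box only, so their bound is asked
  for only where \<open>g\<close> does not vanish.\<close>

lemma integrable_bounded_mult:
  fixes g \<psi> :: "'a \<Rightarrow> complex"
  assumes g: "integrable M g" and [measurable]: "\<psi> \<in> borel_measurable M"
    and B: "\<And>x. x \<in> space M \<Longrightarrow> g x \<noteq> 0 \<Longrightarrow> norm (\<psi> x) \<le> B"
  shows "integrable M (\<lambda>x. g x * \<psi> x)"
proof (rule Bochner_Integration.integrable_bound)
  show "integrable M (\<lambda>x. \<bar>B\<bar> *\<^sub>R g x)" using g by (rule integrable_scaleR_right)
  show "(\<lambda>x. g x * \<psi> x) \<in> borel_measurable M" using g by measurable
  show "AE x in M. norm (g x * \<psi> x) \<le> norm (\<bar>B\<bar> *\<^sub>R g x)"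
  proof (intro AE_I2)
    fix x assume "x \<in> space M"
    then show "norm (g x * \<psi> x) \<le> norm (\<bar>B\<bar> *\<^sub>R g x)"
      using B[of x] by (cases "g x = 0") (auto simp: norm_mult mult.commute intro!: mult_left_mono)
  qed
qed

lemma not_null_interval:
  assumes "N \<in> null_sets lborel" "s < (t::real)"
  obtains x where "x \<in> {s..<t}" "x \<notin> N"
proof -
  have "\<not> {s..<t} \<subseteq> N"
    using null_sets_subset[OF assms(1), of "{s..<t}"] assms by (auto simp: null_sets_def)
  then obtain x where "x \<in> {s..<t}" "x \<notin> N" by blast
  then show ?thesis by (rule that)
qed

text \<open>If all differences over distances at least \<open>l / 4\<close> were smaller than asserted, then \<open>G\<close> would be
  so close to a constant that its integral against \<open>\<psi>\<close> would be too small.  The null set \<open>N\<close> collects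
  the points at which, in several variables, the sections are not integrable.\<close>

lemma integral_mean_0_le_difference:
  fixes G \<psi> :: "real \<Rightarrow> complex"
  assumes l: "l > 0" and G: "set_integrable lborel {z..<z + l} G"
    and \<psi> [measurable]: "\<psi> \<in> borel_measurable borel"
    and B: "\<And>x. x \<in> {z..<z + l} \<Longrightarrow> norm (\<psi> x) \<le> B"
    and mean: "(LBINT x:{z..<z + l}. \<psi> x) = 0" and N: "N \<in> null_sets lborel"
  shows "\<exists>a b. a \<in> {z..<z + l} \<and> b \<in> {z..<z + l} \<and> a \<notin> N \<and> b \<notin> N \<and> a + l / 4 \<le> b \<and>
    norm (LBINT x:{z..<z + l}. G x * \<psi> x) \<le> 4 * B * l * norm (G a - G b)"
proof -
  let ?I = "{z..<z + l}"
  define K where "K = norm (LBINT x:?I. G x * \<psi> x)"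
  have "norm (\<psi> z) \<le> B" using B[of z] l by simp
  then have B0: "0 \<le> B" using norm_ge_zero order_trans by blast
  \<comment> \<open>One reference point in the first and one in the last quarter: each point of the
    left half is at least \<open>l / 4\<close> before \<open>a4\<close>, and each point of the right
    half at least \<open>l / 4\<close> after \<open>a1\<close>.\<close>
  obtain a1 where a1: "a1 \<in> {z..<z + l/4}" "a1 \<notin> N"
    using not_null_interval[OF N, of z "z + l/4"] l by auto
  obtain a4 where a4: "a4 \<in> {z + 3*l/4..<z + l}" "a4 \<notin> N"
    using not_null_interval[OF N, of "z + 3*l/4" "z + l"] l by auto
  show ?thesis
  proof (rule ccontr)
    assume neg: "\<not> ?thesis"
    have lt: "4 * B * l * norm (G a - G b) < K" if "a \<in> ?I" "b \<in> ?I" "a \<notin> N" "b \<notin> N" "a + l / 4 \<le> b" for a b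
      using neg that unfolding K_def by (meson not_le)
    have K: "0 < K"
    proof -
      have "4 * B * l * norm (G a1 - G a4) < K" using a1 a4 l by (intro lt) auto
      moreover have "0 \<le> 4 * B * l * norm (G a1 - G a4)" using B0 l by simp
      ultimately show ?thesis by linarith
    qed
    have near: "norm ((G x - G a1) * \<psi> x) \<le> K / (2 * l)" if x: "x \<in> ?I" "x \<notin> N" for x
    proof -
      \<comment> \<open>In the left half the comparison with \<open>a1\<close> passes through
        \<open>a4\<close> and costs two differences; hence \<open>2 * K\<close>, which the factor 4
        turns into half of \<open>K\<close> after integration.\<close>
      have "4 * B * l * norm (G x - G a1) \<le> 2 * K"
      proof (cases "x < z + l/2")
        case True
        have "4 * B * l * norm (G x - G a1) \<le> 4 * B * l * (norm (G x - G a4) + norm (G a1 - G a4))"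
          using B0 l norm_triangle_ineq4[of "G x - G a4" "G a1 - G a4"] by (intro mult_left_mono) auto
        also have "\<dots> = 4 * B * l * norm (G x - G a4) + 4 * B * l * norm (G a1 - G a4)"
          by (simp add: algebra_simps)
        also have "\<dots> \<le> K + K"
          using x a1 a4 l True by (intro add_mono less_imp_le lt) auto
        finally show ?thesis by simp
      next
        case False
        then have "4 * B * l * norm (G a1 - G x) < K"
          using x a1 l by (intro lt) auto
        then show ?thesis using K by (simp add: norm_minus_commute)
      qed
      then have "B * norm (G x - G a1) \<le> K / (2 * l)"
        using l by (simp add: field_simps)
      moreover have "norm ((G x - G a1) * \<psi> x) \<le> B * norm (G x - G a1)"
        using B[OF x(1)] unfolding norm_mult by (subst mult.commute) (intro mult_right_mono, auto)
      ultimately show ?thesis by linarith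
    qed
    have int1: "set_integrable lborel ?I \<psi>"
      unfolding set_integrable_def using B l
      by (intro integrableI_bounded_set_indicator[where B = B]) auto
    have int2: "set_integrable lborel ?I (\<lambda>x. G x * \<psi> x)"
    proof -
      have "integrable lborel (\<lambda>x. (indicator ?I x *\<^sub>R G x) * \<psi> x)"
        using G B by (intro integrable_bounded_mult[where B = B]) (auto simp: set_integrable_def split: split_indicator_asm)
      then show ?thesis by (simp add: set_integrable_def)
    qed
    \<comment> \<open>Mean 0 allows the constant \<open>G a1\<close> to be subtracted; by
      \<open>near\<close> this leads to \<open>K \<le> K / 2\<close>.\<close>
    have "(LBINT x:?I. (G x - G a1) * \<psi> x) = (LBINT x:?I. G x * \<psi> x - G a1 * \<psi> x)"
      by (simp add: algebra_simps)
    also have "\<dots> = (LBINT x:?I. G x * \<psi> x) - (LBINT x:?I. G a1 * \<psi> x)"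
      using int1 int2 by (intro set_integral_diff) (auto intro: set_integrable_mult_right)
    also have "\<dots> = (LBINT x:?I. G x * \<psi> x)"
      using mean by simp
    finally have "K = norm (LBINT x:?I. (G x - G a1) * \<psi> x)" by (simp add: K_def)
    also have "\<dots> \<le> K / (2 * l) * measure lborel ?I"
    proof (rule norm_set_integral_le_AE)
      show "AE x in lborel. x \<in> ?I \<longrightarrow> norm ((G x - G a1) * \<psi> x) \<le> K / (2 * l)"
        using AE_not_in[OF N] by eventually_elim (use near in blast)
    qed (use l K in auto)
    also have "\<dots> = K / 2" using l by simp
    finally show False using K by simp
  qed
qed

section \<open>Fubini's theorem for finite products of Lebesgue measure\<close>

interpretation lborel_PiM: product_sigma_finite "\<lambda>_::nat. lborel :: real measure"
  by standard

lemma sigma_finite_PiM_lborel: "finite I \<Longrightarrow> sigma_finite_measure (\<Pi>\<^sub>M j\<in>(I::nat set). (lborel::real measure))"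
  by (rule lborel_PiM.sigma_finite)

text \<open>Reduces the product over \<open>insert i I\<close> to a binary product, from which
  Fubini's theorem is carried over together with the integrability of almost all sections.\<close>

lemma PiM_insert_eq_distr:
  fixes I :: "nat set"
  assumes I: "finite I" "i \<notin> I"
  shows "(\<Pi>\<^sub>M j\<in>insert i I. lborel) = distr ((\<Pi>\<^sub>M j\<in>I. lborel) \<Otimes>\<^sub>M lborel) (\<Pi>\<^sub>M j\<in>insert i I. lborel) (\<lambda>(x, y::real). x(i := y))"
    (is "?P = distr ?Q _ ?f")
proof (rule measure_eqI)
  interpret I: sigma_finite_measure "\<Pi>\<^sub>M j\<in>I. lborel :: real measure"
    by (rule sigma_finite_PiM_lborel) fact
  interpret P: pair_sigma_finite "\<Pi>\<^sub>M j\<in>I. lborel :: real measure" "lborel :: real measure" ..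
  have f [measurable]: "?f \<in> measurable ?Q ?P"
    by (rule measurable_add_dim)
  fix A assume A [measurable]: "A \<in> sets ?P"
  have "emeasure ?P A = (\<integral>\<^sup>+x. indicator A x \<partial>?P)" by simp
  also have "\<dots> = (\<integral>\<^sup>+x. \<integral>\<^sup>+y. indicator A (x(i := y)) \<partial>lborel \<partial>(\<Pi>\<^sub>M j\<in>I. lborel))"
    by (rule lborel_PiM.product_nn_integral_insert) (use I in auto)
  also have "\<dots> = (\<integral>\<^sup>+z. indicator A (?f z) \<partial>?Q)"
    by (subst lborel.nn_integral_fst[symmetric]) auto
  also have "\<dots> = (\<integral>\<^sup>+z. indicator A z \<partial>distr ?Q ?P ?f)"
    by (subst nn_integral_distr) auto
  also have "\<dots> = emeasure (distr ?Q ?P ?f) A" by simp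
  finally show "emeasure ?P A = emeasure (distr ?Q ?P ?f) A" .
qed simp

lemma integrable_PiM_insert:
  fixes f :: "(nat \<Rightarrow> real) \<Rightarrow> 'b::{banach, second_countable_topology}"
  assumes I: "finite I" "i \<notin> I" and f: "integrable (\<Pi>\<^sub>M j\<in>insert i I. lborel) f"
  shows "AE y in lborel. integrable (\<Pi>\<^sub>M j\<in>I. lborel) (\<lambda>x. f (x(i := y)))"
    and "integrable lborel (\<lambda>y. LINT x|(\<Pi>\<^sub>M j\<in>I. lborel). f (x(i := y)))"
    and "integral\<^sup>L (\<Pi>\<^sub>M j\<in>insert i I. lborel) f = (LBINT y. LINT x|(\<Pi>\<^sub>M j\<in>I. lborel). f (x(i := y)))"
proof -
  let ?P = "\<Pi>\<^sub>M j\<in>insert i I. lborel :: real measure"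
  let ?Q = "(\<Pi>\<^sub>M j\<in>I. lborel :: real measure) \<Otimes>\<^sub>M (lborel :: real measure)"
  interpret I: sigma_finite_measure "\<Pi>\<^sub>M j\<in>I. lborel :: real measure"
    by (rule sigma_finite_PiM_lborel) fact
  interpret P: pair_sigma_finite "\<Pi>\<^sub>M j\<in>I. lborel :: real measure" "lborel :: real measure" ..
  have m [measurable]: "(\<lambda>(x, y). x(i := y)) \<in> measurable ?Q ?P"
    by (rule measurable_add_dim)
  have fm [measurable]: "f \<in> borel_measurable ?P" using f by auto
  have int: "integrable ?Q (\<lambda>z. f (case z of (x, y) \<Rightarrow> x(i := y)))"
    using f by (subst (asm) PiM_insert_eq_distr[OF I]) (simp add: integrable_distr_eq)
  then have int': "integrable ?Q (case_prod (\<lambda>x y. f (x(i := y))))"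
    by (simp add: split_beta')
  show "AE y in lborel. integrable (\<Pi>\<^sub>M j\<in>I. lborel) (\<lambda>x. f (x(i := y)))"
    by (rule P.AE_integrable_snd[OF int'])
  show "integrable lborel (\<lambda>y. LINT x|(\<Pi>\<^sub>M j\<in>I. lborel). f (x(i := y)))"
    by (rule P.integrable_snd[OF int'])
  have "integral\<^sup>L ?P f = (LINT z|?Q. f (case z of (x, y) \<Rightarrow> x(i := y)))"
    by (subst PiM_insert_eq_distr[OF I]) (simp add: integral_distr)
  also have "\<dots> = (LBINT y. LINT x|(\<Pi>\<^sub>M j\<in>I. lborel). f (x(i := y)))"
    using P.integral_snd[OF int'] by (simp add: split_beta')
  finally show "integral\<^sup>L ?P f = (LBINT y. LINT x|(\<Pi>\<^sub>M j\<in>I. lborel). f (x(i := y)))" .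
qed

definition cDelta :: "nat set \<Rightarrow> ((nat \<Rightarrow> real) \<Rightarrow> complex) \<Rightarrow> corners \<Rightarrow> complex" where
  "cDelta u h J = (\<Sum>v\<in>Pow u. (-1) ^ card v * h (vertex u J v))"

lemma cDelta_of_real: "cDelta u (\<lambda>x. of_real (g x)) J = of_real (Delta u g J)"
  by (simp add: cDelta_def Delta_def)

text \<open>The subsets are split by whether they contain \<open>i\<close>. The difference thus
  becomes a lower-dimensional difference of a difference of two sections, the form needed for an
  induction on the number of variables.\<close>

lemma cDelta_insert:
  assumes I: "finite I" "i \<notin> I"
  shows "cDelta (insert i I) h (a(i := s), b(i := t)) =
    cDelta I (\<lambda>x. h (x(i := s)) - h (x(i := t))) (a, b)"
proof -
  have v1: "vertex (insert i I) (a(i := s), b(i := t)) v = (vertex I (a, b) v)(i := s)" if "v \<subseteq> I" for v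
    using that I by (auto simp: vertex_def fun_eq_iff)
  have v2: "vertex (insert i I) (a(i := s), b(i := t)) (insert i v) = (vertex I (a, b) v)(i := t)" if "v \<subseteq> I" for v
    using that I by (auto simp: vertex_def fun_eq_iff)
  have inj: "inj_on (insert i) (Pow I)" using I by (intro inj_onI) (metis PowD insert_ident subsetD)
  have card: "card (insert i v) = Suc (card v)" if "v \<subseteq> I" for v
    using that I finite_subset[OF that] by (intro card_insert_disjoint) auto
  have "cDelta (insert i I) h (a(i := s), b(i := t)) =
      (\<Sum>v\<in>Pow I. (-1) ^ card v * h ((vertex I (a, b) v)(i := s)))
    + (\<Sum>v\<in>insert i ` Pow I. (-1) ^ card v * h (vertex (insert i I) (a(i := s), b(i := t)) v))"
    unfolding cDelta_def Pow_insert using I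
    by (subst sum.union_disjoint) (auto simp: v1)
  also have "(\<Sum>v\<in>insert i ` Pow I. (-1) ^ card v * h (vertex (insert i I) (a(i := s), b(i := t)) v))
    = (\<Sum>v\<in>Pow I. - ((-1) ^ card v * h ((vertex I (a, b) v)(i := t))))"
    by (subst sum.reindex[OF inj]) (auto simp: v2 card intro!: sum.cong)
  finally show ?thesis
    unfolding cDelta_def[of I] right_diff_distrib sum_subtractf sum_negf by (simp only: diff_conv_add_uminus)
qed

lemma box_measurable [measurable]:
  "finite w \<Longrightarrow> (\<And>j. j \<in> w \<Longrightarrow> A j \<in> sets borel) \<Longrightarrow> (\<Pi>\<^sub>E j\<in>w. A j) \<in> sets (\<Pi>\<^sub>M j\<in>w. lborel)"
  by (rule sets_PiM_I_finite) auto

lemma indicator_PiE_upd: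
  assumes "i \<notin> w" "x \<in> extensional w"
  shows "indicator (\<Pi>\<^sub>E j\<in>insert i w. A j) (x(i := y)) = (indicator (A i) y * indicator (\<Pi>\<^sub>E j\<in>w. A j) x :: 'b::semiring_1)"
proof -
  have "x(i := y) \<in> (\<Pi>\<^sub>E j\<in>insert i w. A j) \<longleftrightarrow> y \<in> A i \<and> x \<in> (\<Pi>\<^sub>E j\<in>w. A j)"
    using assms by (auto simp: PiE_iff extensional_def fun_upd_def split: if_splits)
  then show ?thesis by (simp add: indicator_def)
qed

text \<open>Integrating out all variables but \<open>i\<close> gives a function \<open>G\<close> of
  one variable, to which \<open>integral_mean_0_le_difference\<close> applies. Then
  \<open>G s - G t\<close> is an integral of the same kind for the difference of the two sections of
  \<open>h\<close>, and the induction hypothesis takes over.\<close>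

lemma integral_box_le_cDelta:
  fixes h :: "(nat \<Rightarrow> real) \<Rightarrow> complex" and \<psi> :: "nat \<Rightarrow> real \<Rightarrow> complex"
  assumes "finite w"
    and l: "\<And>j. j \<in> w \<Longrightarrow> l j > 0"
    and \<psi>: "\<And>j. j \<in> w \<Longrightarrow> \<psi> j \<in> borel_measurable borel"
    and B: "\<And>j x. j \<in> w \<Longrightarrow> x \<in> {z j..<z j + l j} \<Longrightarrow> norm (\<psi> j x) \<le> B j"
    and mean: "\<And>j. j \<in> w \<Longrightarrow> (LBINT x:{z j..<z j + l j}. \<psi> j x) = 0"
    and h: "set_integrable (\<Pi>\<^sub>M j\<in>w. lborel) (\<Pi>\<^sub>E j\<in>w. {z j..<z j + l j}) h"
  shows "\<exists>a b. a \<in> extensional w \<and> b \<in> extensional w \<and>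
    (\<forall>j\<in>w. a j \<in> {z j..<z j + l j} \<and> b j \<in> {z j..<z j + l j} \<and> a j + l j / 4 \<le> b j) \<and>
    norm (LINT x:(\<Pi>\<^sub>E j\<in>w. {z j..<z j + l j})|(\<Pi>\<^sub>M j\<in>w. lborel). h x * (\<Prod>j\<in>w. \<psi> j (x j)))
      \<le> (\<Prod>j\<in>w. 4 * B j * l j) * norm (cDelta w h (a, b))"
  using assms
proof (induction w arbitrary: h rule: finite_induct)
  case empty
  have "(LINT x|(\<Pi>\<^sub>M j\<in>{}. lborel::real measure). g x) = g (\<lambda>_. undefined)" for g :: "(nat \<Rightarrow> real) \<Rightarrow> complex"
    by (simp add: PiM_empty lebesgue_integral_count_space_finite)
  then show ?case
    by (intro exI[of _ "\<lambda>_. undefined"]) (simp add: cDelta_def vertex_def set_lebesgue_integral_def)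
next
  case (insert i w)
  let ?C = "\<lambda>j. {z j..<z j + l j}"
  let ?box = "\<Pi>\<^sub>E j\<in>w. ?C j"
  let ?M = "\<Pi>\<^sub>M j\<in>w. lborel :: real measure"
  \<comment> \<open>\<open>f0\<close> yields the integrable sections of \<open>h\<close>,
    \<open>f1\<close> yields \<open>G\<close>, and \<open>f2\<close> is the integrand to be
    estimated.\<close>
  define f0 where "f0 x = indicator (\<Pi>\<^sub>E j\<in>insert i w. ?C j) x *\<^sub>R h x" for x
  define f1 where "f1 x = f0 x * (\<Prod>j\<in>w. \<psi> j (x j))" for x
  define f2 where "f2 x = f1 x * \<psi> i (x i)" for x
  have \<psi>m: "(\<lambda>x. \<psi> j (x j)) \<in> borel_measurable (\<Pi>\<^sub>M j\<in>insert i w. lborel)" if "j \<in> insert i w" for j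
    using insert.prems(2)[OF that] that by measurable
  have f0: "integrable (\<Pi>\<^sub>M j\<in>insert i w. lborel) f0"
    using insert.prems(5) by (simp add: f0_def[abs_def] set_integrable_def)
  have f1: "integrable (\<Pi>\<^sub>M j\<in>insert i w. lborel) f1"
    unfolding f1_def
  proof (rule integrable_bounded_mult[OF f0, where B = "\<Prod>j\<in>w. B j"])
    show "(\<lambda>x. \<Prod>j\<in>w. \<psi> j (x j)) \<in> borel_measurable (\<Pi>\<^sub>M j\<in>insert i w. lborel)"
      by (intro borel_measurable_prod \<psi>m) auto
    fix x assume "f0 x \<noteq> 0"
    then show "norm (\<Prod>j\<in>w. \<psi> j (x j)) \<le> (\<Prod>j\<in>w. B j)"
      unfolding prod_norm[symmetric] using insert.prems(3)
      by (intro prod_mono) (auto simp: f0_def indicator_def PiE_iff split: if_splits)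
  qed
  have f2: "integrable (\<Pi>\<^sub>M j\<in>insert i w. lborel) f2"
    unfolding f2_def
  proof (rule integrable_bounded_mult[OF f1 \<psi>m, where B = "B i"])
    fix x assume "f1 x \<noteq> 0"
    then show "norm (\<psi> i (x i)) \<le> B i"
      using insert.prems(3)[of i "x i"] by (auto simp: f1_def f0_def indicator_def PiE_iff split: if_splits)
  qed simp
  define G where "G y = (LINT x:?box|?M. h (x(i := y)) * (\<Prod>j\<in>w. \<psi> j (x j)))" for y
  have upd: "(\<Prod>j\<in>w. \<psi> j ((x(i := y)) j)) = (\<Prod>j\<in>w. \<psi> j (x j))" for x y
    using insert.hyps by (intro prod.cong) auto
  have f0_upd: "f0 (x(i := y)) = indicator (?C i) y *\<^sub>R indicator ?box x *\<^sub>R h (x(i := y))"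
    if "x \<in> space ?M" for x y
    using that insert.hyps unfolding f0_def
    by (subst indicator_PiE_upd) (auto simp: space_PiM PiE_def)
  have G: "indicator (?C i) y *\<^sub>R G y = (LINT x|?M. f1 (x(i := y)))" for y
    unfolding G_def set_lebesgue_integral_def integral_scaleR_right[symmetric] f1_def upd
    by (intro Bochner_Integration.integral_cong) (auto simp: f0_upd)
  have Gint: "set_integrable lborel (?C i) G"
    using integrable_PiM_insert(2)[OF insert.hyps f1] by (simp add: set_integrable_def G)
  \<comment> \<open>The exceptional set belongs to \<open>f0\<close>, without the factors
    \<open>\<psi>\<close>, since the induction hypothesis asks for integrability of the section
    difference itself.\<close>
  obtain N where N: "{y \<in> space lborel. \<not> integrable ?M (\<lambda>x. f0 (x(i := y)))} \<subseteq> N"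
      "emeasure lborel N = 0" "N \<in> sets lborel"
    by (rule AE_E[OF integrable_PiM_insert(1)[OF insert.hyps f0]])
  have "\<exists>s t. s \<in> ?C i \<and> t \<in> ?C i \<and> s \<notin> N \<and> t \<notin> N \<and> s + l i / 4 \<le> t \<and>
    norm (LBINT x:?C i. G x * \<psi> i x) \<le> 4 * B i * l i * norm (G s - G t)"
    by (rule integral_mean_0_le_difference) (use insert.prems Gint N in \<open>auto intro!: null_setsI\<close>)
  then obtain s t where st: "s \<in> ?C i" "t \<in> ?C i" "s \<notin> N" "t \<notin> N" "s + l i / 4 \<le> t"
    and le: "norm (LBINT x:?C i. G x * \<psi> i x) \<le> 4 * B i * l i * norm (G s - G t)"
    by blast
  define h' where "h' x = h (x(i := s)) - h (x(i := t))" for x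
  have sect: "set_integrable ?M ?box (\<lambda>x. h (x(i := y)))" if "y \<in> ?C i" "y \<notin> N" for y
  proof -
    have "integrable ?M (\<lambda>x. f0 (x(i := y)))" using N that by auto
    also have "?this \<longleftrightarrow> integrable ?M (\<lambda>x. indicator ?box x *\<^sub>R h (x(i := y)))"
      using that by (intro Bochner_Integration.integrable_cong) (auto simp: f0_upd)
    finally show ?thesis by (simp add: set_integrable_def)
  qed
  have \<psi>m': "(\<lambda>x. \<psi> j (x j)) \<in> borel_measurable ?M" if "j \<in> w" for j
    using insert.prems(2)[OF insertI2[OF that]] that by measurable
  have sect': "set_integrable ?M ?box (\<lambda>x. h (x(i := y)) * (\<Prod>j\<in>w. \<psi> j (x j)))" if y: "y \<in> ?C i" "y \<notin> N" for y
  proof -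
    have "integrable ?M (\<lambda>x. (indicator ?box x *\<^sub>R h (x(i := y))) * (\<Prod>j\<in>w. \<psi> j (x j)))"
    proof (rule integrable_bounded_mult[where B = "\<Prod>j\<in>w. B j"])
      show "integrable ?M (\<lambda>x. indicator ?box x *\<^sub>R h (x(i := y)))"
        using sect[OF y] by (simp add: set_integrable_def)
      show "(\<lambda>x. \<Prod>j\<in>w. \<psi> j (x j)) \<in> borel_measurable ?M"
        by (intro borel_measurable_prod \<psi>m')
      fix x assume "indicator ?box x *\<^sub>R h (x(i := y)) \<noteq> 0"
      then show "norm (\<Prod>j\<in>w. \<psi> j (x j)) \<le> (\<Prod>j\<in>w. B j)"
        unfolding prod_norm[symmetric] using insert.prems(3)
        by (intro prod_mono) (auto simp: indicator_def PiE_iff split: if_splits)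
    qed
    then show ?thesis by (simp add: set_integrable_def)
  qed
  have Gdiff: "G s - G t = (LINT x:?box|?M. h' x * (\<Prod>j\<in>w. \<psi> j (x j)))"
    unfolding G_def h'_def ring_distribs using sect' st by (subst set_integral_diff(2)[symmetric]) auto
  have "set_integrable ?M ?box h'"
    unfolding h'_def using sect st by (intro set_integral_diff) auto
  then have "\<exists>a b. a \<in> extensional w \<and> b \<in> extensional w \<and>
    (\<forall>j\<in>w. a j \<in> ?C j \<and> b j \<in> ?C j \<and> a j + l j / 4 \<le> b j) \<and>
    norm (G s - G t) \<le> (\<Prod>j\<in>w. 4 * B j * l j) * norm (cDelta w h' (a, b))"
    unfolding Gdiff by (intro insert.IH) (use insert.prems in auto)
  then obtain a b where ab: "a \<in> extensional w" "b \<in> extensional w"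
    "\<forall>j\<in>w. a j \<in> ?C j \<and> b j \<in> ?C j \<and> a j + l j / 4 \<le> b j"
    "norm (G s - G t) \<le> (\<Prod>j\<in>w. 4 * B j * l j) * norm (cDelta w h' (a, b))"
    by blast
  have "(LINT x:(\<Pi>\<^sub>E j\<in>insert i w. ?C j)|(\<Pi>\<^sub>M j\<in>insert i w. lborel). h x * (\<Prod>j\<in>insert i w. \<psi> j (x j))) =
    integral\<^sup>L (\<Pi>\<^sub>M j\<in>insert i w. lborel) f2"
    unfolding set_lebesgue_integral_def f2_def f1_def f0_def using insert.hyps
    by (intro Bochner_Integration.integral_cong) (auto simp: mult_ac)
  also have "\<dots> = (LBINT y. LINT x|?M. f2 (x(i := y)))"
    by (rule integrable_PiM_insert(3)[OF insert.hyps f2])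
  also have "\<dots> = (LBINT y. (indicator (?C i) y *\<^sub>R G y) * \<psi> i y)"
    unfolding G f2_def by simp
  also have "\<dots> = (LBINT y:?C i. G y * \<psi> i y)"
    by (simp add: set_lebesgue_integral_def)
  finally have "norm (LINT x:(\<Pi>\<^sub>E j\<in>insert i w. ?C j)|(\<Pi>\<^sub>M j\<in>insert i w. lborel). h x * (\<Prod>j\<in>insert i w. \<psi> j (x j)))
     \<le> 4 * B i * l i * norm (G s - G t)" using le by simp
  also have "\<dots> \<le> 4 * B i * l i * ((\<Prod>j\<in>w. 4 * B j * l j) * norm (cDelta w h' (a, b)))"
  proof (rule mult_left_mono[OF ab(4)])
    have "norm (\<psi> i (z i)) \<le> B i" using insert.prems(1)[of i] by (intro insert.prems(3)) auto
    then have "0 \<le> B i" using norm_ge_zero order_trans by blast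
    then show "0 \<le> 4 * B i * l i" using insert.prems(1)[of i] by simp
  qed
  also have "\<dots> = (\<Prod>j\<in>insert i w. 4 * B j * l j) * norm (cDelta (insert i w) h (a(i := s), b(i := t)))"
    unfolding cDelta_insert[OF insert.hyps] h'_def using insert.hyps by simp
  finally have main: "norm (LINT x:(\<Pi>\<^sub>E j\<in>insert i w. ?C j)|(\<Pi>\<^sub>M j\<in>insert i w. lborel). h x * (\<Prod>j\<in>insert i w. \<psi> j (x j)))
     \<le> (\<Prod>j\<in>insert i w. 4 * B j * l j) * norm (cDelta (insert i w) h (a(i := s), b(i := t)))" .
  have ext: "a(i := s) \<in> extensional (insert i w)" "b(i := t) \<in> extensional (insert i w)"
    using ab(1,2) by (auto simp: extensional_def)
  have "\<forall>j\<in>insert i w. (a(i := s)) j \<in> ?C j \<and> (b(i := t)) j \<in> ?C j \<and> (a(i := s)) j + l j / 4 \<le> (b(i := t)) j"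
    using ab(3) st insert.hyps by auto
  then show ?case using main ext by blast
qed


section \<open>Box partitions and the Vitali variation\<close>

text \<open>The partitioned set is a parameter, so that partitions of the single cells can be glued
  to one of the cube.\<close>

definition is_box_partition :: "nat set \<Rightarrow> (nat \<Rightarrow> real) set \<Rightarrow> corners set \<Rightarrow> bool" where
  "is_box_partition u X P \<longleftrightarrow> finite P
     \<and> (\<forall>(a, b)\<in>P. a \<in> extensional u \<and> b \<in> extensional u \<and> (\<forall>j\<in>u. a j < b j))
     \<and> disjoint_family_on (hbox u) P \<and> (\<Union>J\<in>P. hbox u J) = X"

lemma box_partitions_iff: "P \<in> box_partitions u \<longleftrightarrow> is_box_partition u (cube u) P"
  by (simp add: box_partitions_def is_box_partition_def)

definition product_boxes :: "nat set \<Rightarrow> (nat \<Rightarrow> (real \<times> real) set) \<Rightarrow> corners set" where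
  "product_boxes u S = (\<lambda>c. (\<lambda>j\<in>u. fst (c j), \<lambda>j\<in>u. snd (c j))) ` (\<Pi>\<^sub>E j\<in>u. S j)"

lemma is_box_partition_product:
  assumes u: "finite u" and S: "\<And>j. j \<in> u \<Longrightarrow> finite (S j)"
    and lt: "\<And>j s t. j \<in> u \<Longrightarrow> (s, t) \<in> S j \<Longrightarrow> s < t"
    and disj: "\<And>j s t s' t' x. j \<in> u \<Longrightarrow> (s, t) \<in> S j \<Longrightarrow> (s', t') \<in> S j \<Longrightarrow>
        x \<in> {s..<t} \<Longrightarrow> x \<in> {s'..<t'} \<Longrightarrow> (s, t) = (s', t')"
    and un: "\<And>j. j \<in> u \<Longrightarrow> (\<Union>(s, t)\<in>S j. {s..<t}) = X j"
  shows "is_box_partition u (\<Pi>\<^sub>E j\<in>u. X j) (product_boxes u S)"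
  unfolding is_box_partition_def
proof (intro conjI)
  show "finite (product_boxes u S)"
    unfolding product_boxes_def using u S by (intro finite_imageI finite_PiE)
  show "\<forall>(a, b)\<in>product_boxes u S. a \<in> extensional u \<and> b \<in> extensional u \<and> (\<forall>j\<in>u. a j < b j)"
    using lt by (fastforce simp: product_boxes_def PiE_iff)
  show "disjoint_family_on (hbox u) (product_boxes u S)"
  unfolding disjoint_family_on_def
  proof (intro ballI impI, rule ccontr)
    fix J J' assume J: "J \<in> product_boxes u S" "J' \<in> product_boxes u S" "J \<noteq> J'"
      and "hbox u J \<inter> hbox u J' \<noteq> {}"
    then obtain x where x: "x \<in> hbox u J" "x \<in> hbox u J'" by auto
    obtain c c' where c: "c \<in> (\<Pi>\<^sub>E j\<in>u. S j)" "c' \<in> (\<Pi>\<^sub>E j\<in>u. S j)"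
      and Jc: "J = (\<lambda>j\<in>u. fst (c j), \<lambda>j\<in>u. snd (c j))" "J' = (\<lambda>j\<in>u. fst (c' j), \<lambda>j\<in>u. snd (c' j))"
      using J by (auto simp: product_boxes_def)
    have "c j = c' j" if j: "j \<in> u" for j
    proof -
      have "x j \<in> {fst (c j)..<snd (c j)}" "x j \<in> {fst (c' j)..<snd (c' j)}"
        using x j by (auto simp: hbox_def Jc PiE_iff)
      moreover have "c j \<in> S j" "c' j \<in> S j" using c j by auto
      ultimately show ?thesis
        using disj[OF j, of "fst (c j)" "snd (c j)" "fst (c' j)" "snd (c' j)" "x j"] by simp
    qed
    then have "J = J'" unfolding Jc by (auto intro!: restrict_ext)
    with J show False by simp
  qed
  show "(\<Union>J\<in>product_boxes u S. hbox u J) = (\<Pi>\<^sub>E j\<in>u. X j)"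
  proof (intro equalityI subsetI)
    fix x assume "x \<in> (\<Union>J\<in>product_boxes u S. hbox u J)"
    then obtain c where c: "c \<in> (\<Pi>\<^sub>E j\<in>u. S j)"
      and x: "x \<in> hbox u (\<lambda>j\<in>u. fst (c j), \<lambda>j\<in>u. snd (c j))" by (auto simp: product_boxes_def)
    have "x j \<in> X j" if j: "j \<in> u" for j
    proof -
      have "x j \<in> {fst (c j)..<snd (c j)}" using x j by (auto simp: hbox_def PiE_iff)
      moreover have "c j \<in> S j" using c j by auto
      ultimately show ?thesis unfolding un[OF j, symmetric] by (force simp: split_beta)
    qed
    then show "x \<in> (\<Pi>\<^sub>E j\<in>u. X j)" using x by (auto simp: hbox_def PiE_iff)
  next
    fix x assume x: "x \<in> (\<Pi>\<^sub>E j\<in>u. X j)"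
    have "\<exists>c\<in>S j. x j \<in> {fst c..<snd c}" if j: "j \<in> u" for j
    proof -
      have "x j \<in> X j" using x j by auto
      then show ?thesis unfolding un[OF j, symmetric] by (force simp: split_beta)
    qed
    then obtain c where c: "\<And>j. j \<in> u \<Longrightarrow> c j \<in> S j \<and> x j \<in> {fst (c j)..<snd (c j)}" by metis
    have "x \<in> hbox u (\<lambda>j\<in>u. fst (c j), \<lambda>j\<in>u. snd (c j))"
      using c x by (auto simp: hbox_def PiE_iff)
    moreover have "(\<lambda>j\<in>u. fst (c j), \<lambda>j\<in>u. snd (c j)) \<in> product_boxes u S"
      unfolding product_boxes_def using c
      by (intro image_eqI[of _ _ "restrict c u"]) (auto intro!: restrict_ext)
    ultimately show "x \<in> (\<Union>J\<in>product_boxes u S. hbox u J)" by blast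
  qed
qed

lemma is_box_partition_UN:
  assumes N: "finite N" and P: "\<And>n. n \<in> N \<Longrightarrow> is_box_partition u (X n) (P n)"
    and disj: "disjoint_family_on X N"
  shows "is_box_partition u (\<Union>n\<in>N. X n) (\<Union>n\<in>N. P n)"
  unfolding is_box_partition_def
proof (intro conjI)
  show "finite (\<Union>n\<in>N. P n)" using N P by (auto simp: is_box_partition_def)
  show "\<forall>(a, b)\<in>\<Union>n\<in>N. P n. a \<in> extensional u \<and> b \<in> extensional u \<and> (\<forall>j\<in>u. a j < b j)"
    using P unfolding is_box_partition_def by fast
  have sub: "hbox u J \<subseteq> X n" if "n \<in> N" "J \<in> P n" for n J
    using P[OF that(1)] that(2) unfolding is_box_partition_def by blast
  show "disjoint_family_on (hbox u) (\<Union>n\<in>N. P n)"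
  unfolding disjoint_family_on_def
  proof (intro ballI impI)
    fix J J' assume J: "J \<in> (\<Union>n\<in>N. P n)" "J' \<in> (\<Union>n\<in>N. P n)" "J \<noteq> J'"
    then obtain n n' where n: "n \<in> N" "J \<in> P n" "n' \<in> N" "J' \<in> P n'" by auto
    show "hbox u J \<inter> hbox u J' = {}"
    proof (cases "n = n'")
      case True
      then show ?thesis using P[OF n(1)] n J unfolding is_box_partition_def disjoint_family_on_def by auto
    next
      case False
      then have "X n \<inter> X n' = {}" using disj n by (auto simp: disjoint_family_on_def)
      then show ?thesis using sub[OF n(1,2)] sub[OF n(3,4)] by blast
    qed
  qed
  show "(\<Union>J\<in>\<Union>n\<in>N. P n. hbox u J) = (\<Union>n\<in>N. X n)"
    using P by (auto simp: is_box_partition_def)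
qed

lemma box_partition_containing:
  assumes u: "finite u" and ab: "\<And>j. j \<in> u \<Longrightarrow> z j \<le> a j \<and> a j < b j \<and> b j < (e j :: real)"
    and ext: "a \<in> extensional u" "b \<in> extensional u"
  obtains P where "is_box_partition u (\<Pi>\<^sub>E j\<in>u. {z j..<e j}) P" "(a, b) \<in> P"
proof
  \<comment> \<open>Each side is cut at \<open>a j\<close> and \<open>b j\<close>. The first piece
    is empty if \<open>a j = z j\<close> and is then dropped, since sides of boxes must be
    nondegenerate.\<close>
  define S where "S j = {c \<in> {(z j, a j), (a j, b j), (b j, e j)}. fst c < snd c}" for j
  show "is_box_partition u (\<Pi>\<^sub>E j\<in>u. {z j..<e j}) (product_boxes u S)"
  proof (rule is_box_partition_product[OF u])
    fix j assume j: "j \<in> u"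
    show "finite (S j)" by (simp add: S_def)
    show "(\<Union>(s, t)\<in>S j. {s..<t}) = {z j..<e j}"
    proof (intro equalityI subsetI)
      fix x assume x: "x \<in> {z j..<e j}"
      consider "x < a j" | "a j \<le> x" "x < b j" | "b j \<le> x" by linarith
      then show "x \<in> (\<Union>(s, t)\<in>S j. {s..<t})"
      proof cases
        case 1
        then show ?thesis using x by (intro UN_I[of "(z j, a j)"]) (auto simp: S_def)
      next
        case 2
        then show ?thesis by (intro UN_I[of "(a j, b j)"]) (auto simp: S_def)
      next
        case 3
        then show ?thesis using x by (intro UN_I[of "(b j, e j)"]) (auto simp: S_def)
      qed
    qed (use ab[OF j] in \<open>auto simp: S_def\<close>)
    show "s < t" if "(s, t) \<in> S j" for s t using that by (auto simp: S_def)
    show "(s, t) = (s', t')" if "(s, t) \<in> S j" "(s', t') \<in> S j" "x \<in> {s..<t}" "x \<in> {s'..<t'}" for s t s' t' x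
      using that ab[OF j] by (auto simp: S_def)
  qed
  have eq: "(a, b) = (\<lambda>j\<in>u. fst ((\<lambda>j\<in>u. (a j, b j)) j), \<lambda>j\<in>u. snd ((\<lambda>j\<in>u. (a j, b j)) j))"
    using ext by (auto simp: fun_eq_iff extensional_def)
  have mem: "(\<lambda>j\<in>u. (a j, b j)) \<in> Pi\<^sub>E u S"
    using ab by (auto simp: S_def)
  show "(a, b) \<in> product_boxes u S"
    unfolding product_boxes_def
    by (rule image_eqI[where f = "\<lambda>c. (\<lambda>j\<in>u. fst (c j), \<lambda>j\<in>u. snd (c j))", OF eq mem])
qed

text \<open>The sum inside the variation before the outer root; without the root it is additive over
  the boxes.\<close>

definition partition_sum :: "real \<Rightarrow> real \<Rightarrow> nat set \<Rightarrow> ((nat \<Rightarrow> real) \<Rightarrow> real) \<Rightarrow> corners set \<Rightarrow> real" where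
  "partition_sum lam \<pp> u g P = (\<Sum>J | J \<in> P \<and> (\<forall>v\<subseteq>u. vertex u J v \<in> cube u).
     vol u J * \<bar>Delta u g J / vol u J powr lam\<bar> powr \<pp>)"

lemma Vitali_var_finite_imp_bounded:
  assumes "Vitali_var lam \<pp> u g < \<infinity>" "\<pp> \<ge> 1"
  shows "\<exists>V\<ge>0. \<forall>P\<in>box_partitions u. partition_sum lam \<pp> u g P \<le> V"
proof (intro exI conjI ballI)
  let ?V = "enn2real (Vitali_var lam \<pp> u g)"
  show "0 \<le> ?V powr \<pp>" by simp
  fix P assume P: "P \<in> box_partitions u"
  have nonneg: "0 \<le> partition_sum lam \<pp> u g P"
    unfolding partition_sum_def
  proof (intro sum_nonneg mult_nonneg_nonneg)
    fix J assume "J \<in> {J \<in> P. \<forall>v\<subseteq>u. vertex u J v \<in> cube u}"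
    then have "\<forall>j\<in>u. fst J j < snd J j" using P by (auto simp: box_partitions_def)
    then show "0 \<le> vol u J" by (auto simp: vol_def intro!: prod_nonneg)
  qed simp
  have "ennreal (partition_sum lam \<pp> u g P powr (1 / \<pp>)) \<le> Vitali_var lam \<pp> u g"
    unfolding Vitali_var_def partition_sum_def by (rule SUP_upper[OF P])
  then have "partition_sum lam \<pp> u g P powr (1 / \<pp>) \<le> ?V"
    using assms(1) by (metis enn2real_ennreal enn2real_mono infinity_ennreal_def powr_ge_zero)
  then have "(partition_sum lam \<pp> u g P powr (1 / \<pp>)) powr \<pp> \<le> ?V powr \<pp>"
    using assms by (intro powr_mono2) auto
  then show "partition_sum lam \<pp> u g P \<le> ?V powr \<pp>"
    using assms nonneg by (simp add: powr_powr)
qed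

text \<open>This estimate takes the place of Hoelder's inequality when the differences over all cells are summed.\<close>

lemma le_1_plus_powr:
  fixes t \<pp> :: real
  shows "0 \<le> t \<Longrightarrow> \<pp> \<ge> 1 \<Longrightarrow> t \<le> 1 + t powr \<pp>"
proof (cases "t \<le> 1")
  case False
  assume "\<pp> \<ge> 1"
  have "t powr 1 \<le> t powr \<pp>" by (rule powr_mono) (use False \<open>\<pp> \<ge> 1\<close> in auto)
  then show ?thesis using False by simp
qed (simp add: add_increasing2)

section \<open>Product grids and the estimate on the whole cube\<close>

lemma product_cells_UN:
  assumes "\<And>j. j \<in> u \<Longrightarrow> (\<Union>n\<in>N j. C j n) = X j"
  shows "(\<Union>n\<in>Pi\<^sub>E u N. \<Pi>\<^sub>E j\<in>u. C j (n j)) = (\<Pi>\<^sub>E j\<in>u. X j)"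
proof (intro equalityI subsetI)
  fix x assume x: "x \<in> (\<Pi>\<^sub>E j\<in>u. X j)"
  then have "\<forall>j\<in>u. \<exists>n\<in>N j. x j \<in> C j n" using assms by (blast dest: PiE_mem)
  then obtain n where n: "\<And>j. j \<in> u \<Longrightarrow> n j \<in> N j \<and> x j \<in> C j (n j)" by metis
  then have "restrict n u \<in> Pi\<^sub>E u N" "x \<in> (\<Pi>\<^sub>E j\<in>u. C j (restrict n u j))"
    using x by (auto simp: PiE_iff)
  then show "x \<in> (\<Union>n\<in>Pi\<^sub>E u N. \<Pi>\<^sub>E j\<in>u. C j (n j))" by blast
next
  fix x assume "x \<in> (\<Union>n\<in>Pi\<^sub>E u N. \<Pi>\<^sub>E j\<in>u. C j (n j))"
  then obtain n where n: "n \<in> Pi\<^sub>E u N" "x \<in> (\<Pi>\<^sub>E j\<in>u. C j (n j))" by auto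
  have "x j \<in> X j" if "j \<in> u" for j
    using PiE_mem[OF n(1) that] PiE_mem[OF n(2) that] assms[OF that] by blast
  then show "x \<in> (\<Pi>\<^sub>E j\<in>u. X j)" using n(2) by (simp add: PiE_iff)
qed

lemma product_cells_disjoint:
  assumes "\<And>j. j \<in> u \<Longrightarrow> disjoint_family_on (C j) (N j)"
  shows "disjoint_family_on (\<lambda>n. \<Pi>\<^sub>E j\<in>u. C j (n j)) (Pi\<^sub>E u N)"
  unfolding disjoint_family_on_def
proof (intro ballI impI, rule ccontr)
  fix n m assume nm: "n \<in> Pi\<^sub>E u N" "m \<in> Pi\<^sub>E u N" "n \<noteq> m"
    and "(\<Pi>\<^sub>E j\<in>u. C j (n j)) \<inter> (\<Pi>\<^sub>E j\<in>u. C j (m j)) \<noteq> {}"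
  then obtain x where "x \<in> (\<Pi>\<^sub>E j\<in>u. C j (n j))" "x \<in> (\<Pi>\<^sub>E j\<in>u. C j (m j))" by blast
  then have x: "\<And>j. j \<in> u \<Longrightarrow> x j \<in> C j (n j) \<inter> C j (m j)" by (auto simp: PiE_iff)
  have "n j = m j" if "j \<in> u" for j
    using assms[OF that] x[OF that] nm that unfolding disjoint_family_on_def by (metis PiE_mem empty_iff)
  then have "n = m" using nm by (intro PiE_ext)
  with nm show False by simp
qed

lemma grid_cells:
  fixes M :: nat assumes "M > 0"
  shows "(\<Union>n\<in>{..<M}. {real n / real M..<real n / real M + 1 / real M}) = {0..<1}"
    and "disjoint_family_on (\<lambda>n. {real n / real M..<real n / real M + 1 / real M}) {..<M}"
proof -
  have iff: "x \<in> {real n / real M..<real n / real M + 1 / real M} \<longleftrightarrow> real n \<le> x * M \<and> x * M < real n + 1" for x n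
    using assms by (simp add: divide_le_eq less_divide_eq flip: add_divide_distrib)
  show "(\<Union>n\<in>{..<M}. {real n / real M..<real n / real M + 1 / real M}) = {0..<1}"
  proof (intro equalityI subsetI)
    fix x :: real assume x: "x \<in> {0..<1}"
    define n where "n = nat \<lfloor>x * M\<rfloor>"
    have n: "real n \<le> x * M" "x * M < real n + 1" using x by (auto simp: n_def of_nat_nat)
    have "x * M < M" using x assms by simp
    then have "n < M" using n by linarith
    then show "x \<in> (\<Union>n\<in>{..<M}. {real n / real M..<real n / real M + 1 / real M})"
      using n iff by (intro UN_I[of n]) auto
  next
    fix x assume "x \<in> (\<Union>n\<in>{..<M}. {real n / real M..<real n / real M + 1 / real M})"
    then obtain n where n: "n < M" "real n \<le> x * M" "x * M < real n + 1" using iff by blast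
    have "real n + 1 \<le> M" using n(1) by linarith
    then have "x * real M < 1 * real M" using n by linarith
    then have "x < 1" by (rule mult_right_less_imp_less) simp
    moreover have "0 \<le> x * M" using n by linarith
    then have "0 \<le> x" using assms by (simp add: zero_le_mult_iff)
    ultimately show "x \<in> {0..<1}" by simp
  qed
  show "disjoint_family_on (\<lambda>n. {real n / real M..<real n / real M + 1 / real M}) {..<M}"
    unfolding disjoint_family_on_def
  proof (intro ballI impI, rule ccontr)
    fix n m assume "n \<noteq> m"
      "{real n / real M..<real n / real M + 1 / real M} \<inter> {real m / real M..<real m / real M + 1 / real M} \<noteq> {}"
    then obtain x :: real where "real n \<le> x * M \<and> x * M < real n + 1" "real m \<le> x * M \<and> x * M < real m + 1" using iff by blast
    with \<open>n \<noteq> m\<close> show False by linarith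
  qed
qed

text \<open>Each cell contributes a multiple of \<open>vol0 * T n\<close>, and \<open>step\<close>
  turns this into \<open>vol0 powr lam\<close> times terms whose sum the variation controls. The
  grid enters the bound only through the final product, so the estimate is uniform in
  \<open>M\<close>.\<close>

lemma integral_cube_le_partition_sum:
  fixes h :: "(nat \<Rightarrow> real) \<Rightarrow> real" and \<psi> :: "nat \<Rightarrow> real \<Rightarrow> complex" and M :: "nat \<Rightarrow> nat"
  assumes w: "finite w" and lam: "0 \<le> lam" and \<pp>: "\<pp> \<ge> 1"
    and V: "\<And>P. P \<in> box_partitions w \<Longrightarrow> partition_sum lam \<pp> w h P \<le> V"
    and h: "set_integrable (\<Pi>\<^sub>M j\<in>w. lborel) (cube w) h"
    and M: "\<And>j. j \<in> w \<Longrightarrow> M j > 0"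
    and \<psi>: "\<And>j. j \<in> w \<Longrightarrow> \<psi> j \<in> borel_measurable borel"
    and B: "\<And>j x. j \<in> w \<Longrightarrow> x \<in> {0..<1} \<Longrightarrow> norm (\<psi> j x) \<le> B j"
    and mean: "\<And>j n. j \<in> w \<Longrightarrow> n < M j \<Longrightarrow> (LBINT x:{real n / M j..<real n / M j + 1 / M j}. \<psi> j x) = 0"
  shows "norm (LINT x:cube w|(\<Pi>\<^sub>M j\<in>w. lborel). of_real (h x) * (\<Prod>j\<in>w. \<psi> j (x j)))
    \<le> 4 ^ card w * (1 + 4 ^ card w * V) * (\<Prod>j\<in>w. B j * (1 / M j) powr lam)"
proof -
  let ?N = "\<Pi>\<^sub>E j\<in>w. {..<M j}"
  let ?PM = "\<Pi>\<^sub>M j\<in>w. lborel :: real measure"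
  define C where "C j n = {real n / real (M j)..<real n / real (M j) + 1 / real (M j)}" for j n
  define R where "R n = (\<Pi>\<^sub>E j\<in>w. C j (n j))" for n :: "nat \<Rightarrow> nat"
  define H where "H x = of_real (h x) * (\<Prod>j\<in>w. \<psi> j (x j))" for x
  define vol0 where "vol0 = (\<Prod>j\<in>w. 1 / real (M j))"
  have vol0: "0 < vol0" unfolding vol0_def by (intro prod_pos) (use M in auto)
  have finN: "finite ?N" using w by (intro finite_PiE) auto
  have R_UN: "(\<Union>n\<in>?N. R n) = cube w"
    unfolding R_def cube_def by (rule product_cells_UN) (use grid_cells(1)[OF M] in \<open>simp add: C_def\<close>)
  have R_disj: "disjoint_family_on R ?N"
    unfolding R_def by (rule product_cells_disjoint) (use grid_cells(2)[OF M] in \<open>simp add: C_def\<close>)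
  have R_sets: "R n \<in> sets ?PM" for n unfolding R_def by (rule box_measurable[OF w]) (simp add: C_def)
  have C_sub: "C j n \<subseteq> {0..<1}" if "j \<in> w" "n < M j" for j n
    using grid_cells(1)[OF M[OF that(1)]] that(2) unfolding C_def by blast
  have hR: "set_integrable ?PM (R n) (\<lambda>x. complex_of_real (h x))" if "n \<in> ?N" for n
  proof -
    have "set_integrable ?PM (R n) h"
      by (rule set_integrable_subset[OF h R_sets]) (use that R_UN in blast)
    then have "integrable ?PM (\<lambda>x. complex_of_real (indicator (R n) x *\<^sub>R h x))"
      unfolding set_integrable_def by (rule integrable_of_real)
    then show ?thesis by (simp add: set_integrable_def scaleR_conv_of_real)
  qed
  define good where "good n a b \<longleftrightarrow> a \<in> extensional w \<and> b \<in> extensional w \<and>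
    (\<forall>j\<in>w. a j \<in> C j (n j) \<and> b j \<in> C j (n j) \<and> a j + 1 / M j / 4 \<le> b j) \<and>
    norm (LINT x:R n|?PM. H x) \<le> (\<Prod>j\<in>w. 4 * B j * (1 / M j)) * norm (cDelta w (\<lambda>x. of_real (h x)) (a, b))"
    for n a b
  have "\<exists>a b. good n a b" if n: "n \<in> ?N" for n
    unfolding good_def
    unfolding R_def C_def H_def
  proof (rule integral_box_le_cDelta[OF w])
    show "set_integrable ?PM (\<Pi>\<^sub>E j\<in>w. {real (n j) / real (M j)..<real (n j) / real (M j) + 1 / real (M j)}) (\<lambda>x. complex_of_real (h x))"
      using hR[OF n] by (simp add: R_def C_def)
    fix j assume j: "j \<in> w"
    then have nj: "n j < M j" using n by auto
    show "0 < 1 / real (M j)" using M[OF j] by simp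
    show "\<psi> j \<in> borel_measurable borel" by (rule \<psi>[OF j])
    show "(LBINT x:{real (n j) / real (M j)..<real (n j) / real (M j) + 1 / real (M j)}. \<psi> j x) = 0"
      by (rule mean[OF j nj])
    fix x assume "x \<in> {real (n j) / real (M j)..<real (n j) / real (M j) + 1 / real (M j)}"
    then show "norm (\<psi> j x) \<le> B j" using subsetD[OF C_sub[OF j nj], of x] by (intro B[OF j]) (simp add: C_def)
  qed
  then have "\<forall>n\<in>?N. \<exists>a b. good n a b" by blast
  then obtain a b where "\<forall>n\<in>?N. good n (a n) (b n)" by (auto dest!: bchoice)
  then have ext: "\<And>n. n \<in> ?N \<Longrightarrow> a n \<in> extensional w" "\<And>n. n \<in> ?N \<Longrightarrow> b n \<in> extensional w"
    and ab: "\<And>n j. n \<in> ?N \<Longrightarrow> j \<in> w \<Longrightarrow> a n j \<in> C j (n j) \<and> b n j \<in> C j (n j) \<and> a n j + 1 / M j / 4 \<le> b n j"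
    and le: "\<And>n. n \<in> ?N \<Longrightarrow> norm (LINT x:R n|?PM. H x) \<le> (\<Prod>j\<in>w. 4 * B j * (1 / M j)) * norm (cDelta w (\<lambda>x. of_real (h x)) (a n, b n))"
    unfolding good_def by blast+
  define J where "J n = (a n, b n)" for n
  define T where "T n = \<bar>Delta w h (J n)\<bar>" for n
  define t where "t n = vol w (J n) * \<bar>Delta w h (J n) / vol w (J n) powr lam\<bar> powr \<pp>" for n
  have less: "a n j < b n j" if "n \<in> ?N" "j \<in> w" for n j
  proof -
    have "0 < 1 / real (M j) / 4" using M[OF that(2)] by simp
    then show ?thesis using ab[OF that] by linarith
  qed
  have "\<exists>P. is_box_partition w (R n) P \<and> J n \<in> P" if n: "n \<in> ?N" for n
  proof -
    have "real (n j) / real (M j) \<le> a n j \<and> a n j < b n j \<and> b n j < real (n j) / real (M j) + 1 / real (M j)" if "j \<in> w" for j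
      using ab[OF n that] less[OF n that] by (auto simp: C_def)
    then obtain P where "is_box_partition w (\<Pi>\<^sub>E j\<in>w. {real (n j) / real (M j)..<real (n j) / real (M j) + 1 / real (M j)}) P"
        "(a n, b n) \<in> P"
      by (rule box_partition_containing[OF w _ ext[OF n]])
    then show ?thesis unfolding R_def C_def J_def by blast
  qed
  then obtain P where P: "\<And>n. n \<in> ?N \<Longrightarrow> is_box_partition w (R n) (P n)" "\<And>n. n \<in> ?N \<Longrightarrow> J n \<in> P n"
    by metis
  let ?Q = "\<Union>n\<in>?N. P n"
  have Q: "?Q \<in> box_partitions w"
    unfolding box_partitions_iff R_UN[symmetric] by (rule is_box_partition_UN[OF finN P(1) R_disj])
  \<comment> \<open>Both corners lie in the half-open cell, hence all vertices in the cube, so that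
    no chosen box is omitted from the partition sum.\<close>
  have vertexJ: "vertex w (J n) v \<in> cube w" if "n \<in> ?N" for n v
  proof -
    have "a n j \<in> {0..<1} \<and> b n j \<in> {0..<1}" if j: "j \<in> w" for j
    proof -
      have "n j < M j" using PiE_mem[OF \<open>n \<in> ?N\<close> j] by simp
      from C_sub[OF j this] ab[OF \<open>n \<in> ?N\<close> j] show ?thesis by blast
    qed
    then show ?thesis by (auto simp: vertex_def cube_def J_def)
  qed
  have J_inj: "inj_on J ?N"
  proof (rule inj_onI)
    fix n m assume nm: "n \<in> ?N" "m \<in> ?N" "J n = J m"
    show "n = m"
    proof (rule PiE_ext[OF nm(1,2)])
      fix j assume j: "j \<in> w"
      have "a n j \<in> C j (n j)" "a n j \<in> C j (m j)" using ab[OF nm(1) j] ab[OF nm(2) j] nm(3) by (auto simp: J_def)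
      moreover have "n j < M j" "m j < M j" using nm j by auto
      ultimately show "n j = m j" using grid_cells(2)[OF M[OF j]] unfolding C_def disjoint_family_on_def by blast
    qed
  qed
  have vol_nonneg: "0 \<le> vol w K" if "K \<in> ?Q" for K
    unfolding vol_def
  proof (rule prod_nonneg)
    fix j assume "j \<in> w"
    then have "fst K j < snd K j" using Q that unfolding box_partitions_iff is_box_partition_def by (auto simp: split_beta)
    then show "0 \<le> snd K j - fst K j" by simp
  qed
  \<comment> \<open>Different cells have different boxes, so this is a part of the sum over the
    glued partition; the remaining terms are nonnegative.\<close>
  have "(\<Sum>n\<in>?N. t n) = sum (\<lambda>K. vol w K * \<bar>Delta w h K / vol w K powr lam\<bar> powr \<pp>) (J ` ?N)"
    unfolding t_def by (subst sum.reindex[OF J_inj]) simp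
  also have "\<dots> \<le> partition_sum lam \<pp> w h ?Q"
    unfolding partition_sum_def
  proof (rule sum_mono2)
    have "finite ?Q" using Q unfolding box_partitions_iff is_box_partition_def by blast
    then show "finite {J \<in> ?Q. \<forall>v\<subseteq>w. vertex w J v \<in> cube w}"
      by (rule rev_finite_subset) blast
    show "J ` ?N \<subseteq> {J \<in> ?Q. \<forall>v\<subseteq>w. vertex w J v \<in> cube w}"
      using P(2) vertexJ by blast
    fix K assume "K \<in> {J \<in> ?Q. \<forall>v\<subseteq>w. vertex w J v \<in> cube w} - J ` ?N"
    then have "0 \<le> vol w K" using vol_nonneg by blast
    then show "0 \<le> vol w K * \<bar>Delta w h K / vol w K powr lam\<bar> powr \<pp>" by simp
  qed
  also have "\<dots> \<le> V" by (rule V[OF Q])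
  finally have sum_t: "(\<Sum>n\<in>?N. t n) \<le> V" .
  have volJ: "vol w (J n) \<le> vol0 \<and> vol0 \<le> 4 ^ card w * vol w (J n) \<and> 0 < vol w (J n)" if n: "n \<in> ?N" for n
  proof (intro conjI)
    show "vol w (J n) \<le> vol0" unfolding vol_def vol0_def J_def fst_conv snd_conv
    proof (intro prod_mono conjI)
      fix j assume j: "j \<in> w"
      show "0 \<le> b n j - a n j" using less[OF n j] by simp
      show "b n j - a n j \<le> 1 / real (M j)" using ab[OF n j] unfolding C_def atLeastLessThan_iff by linarith
    qed
    show "0 < vol w (J n)" unfolding vol_def J_def using less[OF n] by (intro prod_pos) auto
    have "vol0 \<le> (\<Prod>j\<in>w. 4 * (b n j - a n j))"
      unfolding vol0_def
    proof (intro prod_mono conjI)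
      fix j assume j: "j \<in> w"
      define e where "e = 1 / real (M j)"
      have "a n j + e / 4 \<le> b n j" using ab[OF n j] by (simp add: e_def)
      then show "1 / real (M j) \<le> 4 * (b n j - a n j)" unfolding e_def[symmetric] by (simp add: field_simps)
    qed simp
    also have "\<dots> = 4 ^ card w * vol w (J n)"
      by (simp only: prod.distrib prod_constant vol_def J_def fst_conv snd_conv)
    finally show "vol0 \<le> 4 ^ card w * vol w (J n)" .
  qed
  \<comment> \<open>The summands 1 from \<open>le_1_plus_powr\<close>, weighted with the cell
    volume, add up to 1 however fine the grid is.\<close>
  have volN: "(\<Sum>n\<in>?N. vol0) = 1"
  proof -
    have "real (card ?N) = (\<Prod>j\<in>w. real (M j))" using w by (simp add: card_PiE)
    then show ?thesis using M w by (simp add: vol0_def prod_dividef)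
  qed
  have step: "vol0 * T n \<le> vol0 powr lam * (vol0 + 4 ^ card w * t n)" if n: "n \<in> ?N" for n
  proof -
    let ?v = "vol w (J n)"
    define U where "U = \<bar>Delta w h (J n) / ?v powr lam\<bar>"
    have v: "0 < ?v" "?v \<le> vol0" "vol0 \<le> 4 ^ card w * ?v" using volJ[OF n] by auto
    have "T n = ?v powr lam * U" using v by (simp add: T_def U_def abs_divide)
    also have "\<dots> \<le> vol0 powr lam * U"
      using v lam by (intro mult_right_mono powr_mono2) (auto simp: U_def)
    finally have "vol0 * T n \<le> vol0 * (vol0 powr lam * U)" using vol0 by (intro mult_left_mono) auto
    also have "\<dots> = vol0 powr lam * (vol0 * U)" by simp
    also have "\<dots> \<le> vol0 powr lam * (vol0 * (1 + U powr \<pp>))"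
      using vol0 \<pp> by (intro mult_left_mono le_1_plus_powr) (auto simp: U_def)
    also have "vol0 * (1 + U powr \<pp>) = vol0 + vol0 * U powr \<pp>" by (simp add: algebra_simps)
    \<comment> \<open>Here the sides of length at least a quarter are used: the cell volume is
      replaced by that of the box, the weight in the variation.\<close>
    also have "vol0 powr lam * (vol0 + vol0 * U powr \<pp>) \<le> vol0 powr lam * (vol0 + (4 ^ card w * ?v) * U powr \<pp>)"
      using v by (intro mult_left_mono add_left_mono mult_right_mono) auto
    finally show ?thesis by (simp add: t_def U_def mult.assoc)
  qed
  have HR: "set_integrable ?PM (R n) H" if n: "n \<in> ?N" for n
  proof -
    have "integrable ?PM (\<lambda>x. (indicator (R n) x *\<^sub>R complex_of_real (h x)) * (\<Prod>j\<in>w. \<psi> j (x j)))"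
    proof (rule integrable_bounded_mult[where B = "\<Prod>j\<in>w. B j"])
      show "integrable ?PM (\<lambda>x. indicator (R n) x *\<^sub>R complex_of_real (h x))"
        using hR[OF n] by (simp add: set_integrable_def)
      show "(\<lambda>x. \<Prod>j\<in>w. \<psi> j (x j)) \<in> borel_measurable ?PM"
      proof (rule borel_measurable_prod)
        fix j assume j: "j \<in> w"
        show "(\<lambda>x. \<psi> j (x j)) \<in> borel_measurable ?PM" using \<psi>[OF j] j by measurable
      qed
      fix x assume "indicator (R n) x *\<^sub>R complex_of_real (h x) \<noteq> 0"
      then have "x \<in> cube w" using R_UN n by (auto simp: indicator_def split: if_splits)
      then show "norm (\<Prod>j\<in>w. \<psi> j (x j)) \<le> (\<Prod>j\<in>w. B j)"
        unfolding prod_norm[symmetric] using B by (intro prod_mono) (auto simp: cube_def PiE_iff)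
    qed
    then show ?thesis by (simp add: set_integrable_def H_def)
  qed
  have "(LINT x:cube w|?PM. H x) = (\<Sum>n\<in>?N. LINT x:R n|?PM. H x)"
    unfolding R_UN[symmetric] by (rule set_integral_finite_Union[OF finN R_disj HR R_sets])
  then have "norm (LINT x:cube w|?PM. H x) = norm (\<Sum>n\<in>?N. LINT x:R n|?PM. H x)" by simp
  also have "\<dots> \<le> (\<Sum>n\<in>?N. (\<Prod>j\<in>w. 4 * B j * (1 / M j)) * T n)"
  proof (rule order_trans[OF norm_sum sum_mono])
    fix n assume "n \<in> ?N"
    from le[OF this] show "norm (LINT x:R n|?PM. H x) \<le> (\<Prod>j\<in>w. 4 * B j * (1 / M j)) * T n"
      unfolding cDelta_of_real T_def J_def norm_of_real .
  qed
  also have "(\<Prod>j\<in>w. 4 * B j * (1 / M j)) = 4 ^ card w * (\<Prod>j\<in>w. B j) * vol0"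
    by (simp only: prod.distrib prod_constant vol0_def)
  also have "(\<Sum>n\<in>?N. 4 ^ card w * (\<Prod>j\<in>w. B j) * vol0 * T n) = 4 ^ card w * (\<Prod>j\<in>w. B j) * (\<Sum>n\<in>?N. vol0 * T n)"
    by (simp add: sum_distrib_left mult.assoc)
  also have "\<dots> \<le> 4 ^ card w * (\<Prod>j\<in>w. B j) * (vol0 powr lam * (1 + 4 ^ card w * V))"
  proof (rule mult_left_mono)
    have "(\<Sum>n\<in>?N. vol0 * T n) \<le> (\<Sum>n\<in>?N. vol0 powr lam * (vol0 + 4 ^ card w * t n))"
      by (rule sum_mono[OF step])
    also have "\<dots> = vol0 powr lam * ((\<Sum>n\<in>?N. vol0) + 4 ^ card w * (\<Sum>n\<in>?N. t n))"
      by (simp add: sum_distrib_left sum.distrib ring_distribs)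
    also have "\<dots> \<le> vol0 powr lam * (1 + 4 ^ card w * V)"
      unfolding volN using sum_t by (intro mult_left_mono add_left_mono) auto
    finally show "(\<Sum>n\<in>?N. vol0 * T n) \<le> vol0 powr lam * (1 + 4 ^ card w * V)" .
    have "0 \<le> B j" if "j \<in> w" for j
    proof -
      have "norm (\<psi> j 0) \<le> B j" using that by (intro B) auto
      with norm_ge_zero show ?thesis by (rule order_trans)
    qed
    then show "0 \<le> 4 ^ card w * (\<Prod>j\<in>w. B j)" by (simp add: prod_nonneg)
  qed
  also have "vol0 powr lam = (\<Prod>j\<in>w. (1 / M j) powr lam)"
    unfolding vol0_def by (rule prod_powr_distrib)
  finally show ?thesis by (simp only: H_def prod.distrib mult_ac)
qed


section \<open>The Hardy and Krause variation\<close>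

lemma epowr_less_top_iff: "epowr x a < \<infinity> \<longleftrightarrow> x < \<infinity>"
  by (auto simp: epowr_def less_top[symmetric])

lemma HK_var_finite_imp:
  assumes "finite u" "HK_var lam \<pp> \<qq> u g < \<infinity>" "w \<subseteq> u"
  shows "proj_integrable u w g" "w \<noteq> {} \<Longrightarrow> Vitali_var lam \<pp> w (proj u w g) < \<infinity>"
proof -
  have all: "\<forall>w\<subseteq>u. proj_integrable u w g"
  proof (rule ccontr)
    assume "\<not> ?thesis"
    then have "HK_var lam \<pp> \<qq> u g = \<infinity>" by (simp only: HK_var_def if_False)
    with assms(2) show False by simp
  qed
  then show "proj_integrable u w g" using assms(3) by blast
  let ?t = "\<lambda>w. epowr (if w = {} then ennreal \<bar>proj u {} g (\<lambda>_. undefined)\<bar> else Vitali_var lam \<pp> w (proj u w g)) \<qq>"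
  have "(\<Sum>w\<in>Pow u. ?t w) < \<infinity>"
    using assms(2) unfolding HK_var_def if_P[OF all] epowr_less_top_iff .
  moreover have "?t w \<le> (\<Sum>w\<in>Pow u. ?t w)" using assms by (intro member_le_sum) auto
  ultimately have "?t w < \<infinity>" by (rule order.strict_trans1[rotated])
  then show "w \<noteq> {} \<Longrightarrow> Vitali_var lam \<pp> w (proj u w g) < \<infinity>"
    unfolding epowr_less_top_iff by simp
qed

lemma integrable_PiM_merge:
  fixes f :: "(nat \<Rightarrow> real) \<Rightarrow> 'b::{banach, second_countable_topology}"
  assumes fin: "finite I" "finite J" and IJ: "I \<inter> J = {}" and f: "integrable (lebesgue_on_coords (I \<union> J)) f"
  shows "integrable (lebesgue_on_coords I) (\<lambda>x. LINT y|lebesgue_on_coords J. f (merge I J (x, y)))"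
proof -
  interpret I: sigma_finite_measure "lebesgue_on_coords I" by (rule sigma_finite_PiM_lborel) fact
  interpret J: sigma_finite_measure "lebesgue_on_coords J" by (rule sigma_finite_PiM_lborel) fact
  interpret P: pair_sigma_finite "lebesgue_on_coords I" "lebesgue_on_coords J" ..
  have "integrable (lebesgue_on_coords I \<Otimes>\<^sub>M lebesgue_on_coords J) (\<lambda>z. f (merge I J z))"
    by (rule integrable_distr[OF measurable_merge]) (simp add: lborel_PiM.distr_merge[OF IJ fin] f)
  then show ?thesis by (intro P.integrable_fst) (simp add: split_beta')
qed

lemma set_integrable_bounded_interval:
  fixes \<psi> :: "real \<Rightarrow> complex"
  assumes [measurable]: "\<psi> \<in> borel_measurable borel" and B: "\<And>x. x \<in> {s..<t} \<Longrightarrow> norm (\<psi> x) \<le> B"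
  shows "set_integrable lborel {s..<t} \<psi>"
  unfolding set_integrable_def
proof (rule integrableI_bounded_set_indicator[where B = B])
  show "emeasure lborel {s..<t} < \<infinity>" by (cases "s \<le> t") auto
  show "AE x in lborel. x \<in> {s..<t} \<longrightarrow> norm (\<psi> x) \<le> B" using B by (intro AE_I2) auto
qed auto

lemma indicator_cube_merge:
  assumes "w \<subseteq> u" "x \<in> extensional w" "y \<in> extensional (u - w)"
  shows "indicator (cube u) (merge w (u - w) (x, y)) = (indicator (cube w) x * indicator (cube (u - w)) y :: real)"
proof -
  have "merge w (u - w) (x, y) \<in> cube u \<longleftrightarrow> x \<in> cube w \<and> y \<in> cube (u - w)"
    using assms by (auto simp: cube_def PiE_iff merge_def extensional_def split: if_splits)
  then show ?thesis by (simp add: indicator_def)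
qed

lemma cube_measurable [measurable]: "finite u \<Longrightarrow> cube u \<in> sets (lebesgue_on_coords u)"
  unfolding cube_def by (rule box_measurable) auto

text \<open>The projection to no variable integrates over all of them, so its existence is
  integrability on the cube. This is where integrability of the derivatives comes from.\<close>

lemma set_integrable_cube_of_proj:
  assumes "finite u" "proj_integrable u {} g"
  shows "set_integrable (lebesgue_on_coords u) (cube u) g"
proof -
  have "set_integrable (lebesgue_on_coords u) (cube u) (\<lambda>y. g (merge {} u (\<lambda>_. undefined, y)))"
    using assms by (simp add: proj_integrable_def cube_def)
  moreover have "merge {} u (\<lambda>_. undefined, y) = y" if "y \<in> cube u" for y
    using that by (auto simp: cube_def PiE_iff merge_def extensional_def)
  ultimately show ?thesis
    by (subst (asm) set_integrable_cong) auto
qed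

text \<open>The factors depend only on the variables in \<open>w\<close>; the inner integral over
  the other variables acts on \<open>g\<close> alone and produces the projection.\<close>

lemma proj_integral:
  assumes u: "finite u" and w: "w \<subseteq> u" and g: "set_integrable (lebesgue_on_coords u) (cube u) g"
    and \<psi>: "\<And>j. j \<in> w \<Longrightarrow> \<psi> j \<in> borel_measurable borel"
    and B: "\<And>j x. j \<in> w \<Longrightarrow> x \<in> {0..<1} \<Longrightarrow> norm (\<psi> j x) \<le> B j"
  shows "set_integrable (lebesgue_on_coords w) (cube w) (proj u w g)"
    and "set_integrable (lebesgue_on_coords u) (cube u) (\<lambda>x. complex_of_real (g x) * (\<Prod>j\<in>w. \<psi> j (x j)))"
    and "(LINT x:cube u|lebesgue_on_coords u. complex_of_real (g x) * (\<Prod>j\<in>w. \<psi> j (x j))) =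
      (LINT x:cube w|lebesgue_on_coords w. complex_of_real (proj u w g x) * (\<Prod>j\<in>w. \<psi> j (x j)))"
proof -
  have fin: "finite w" "finite (u - w)" and disj: "w \<inter> (u - w) = {}" and un: "w \<union> (u - w) = u"
    using u w finite_subset by auto
  define f0 where "f0 x = indicator (cube u) x *\<^sub>R g x" for x
  have f0: "integrable (lebesgue_on_coords u) f0" using g by (simp add: f0_def[abs_def] set_integrable_def)
  have f0_merge: "f0 (merge w (u - w) (x, y)) = indicator (cube w) x * (indicator (cube (u - w)) y * g (merge w (u - w) (x, y)))"
    if "x \<in> space (lebesgue_on_coords w)" "y \<in> space (lebesgue_on_coords (u - w))" for x y
    unfolding f0_def using that w by (subst indicator_cube_merge) (auto simp: space_PiM PiE_def)
  have inner: "(LINT y|lebesgue_on_coords (u - w). f0 (merge w (u - w) (x, y))) = indicator (cube w) x * proj u w g x"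
    if x: "x \<in> space (lebesgue_on_coords w)" for x
  proof -
    have "(LINT y|lebesgue_on_coords (u - w). f0 (merge w (u - w) (x, y))) =
      (LINT y|lebesgue_on_coords (u - w). indicator (cube w) x * (indicator (cube (u - w)) y * g (merge w (u - w) (x, y))))"
      using f0_merge[OF x] by (intro Bochner_Integration.integral_cong) auto
    also have "\<dots> = indicator (cube w) x * proj u w g x"
      by (simp add: proj_def set_lebesgue_integral_def)
    finally show ?thesis .
  qed
  have "integrable (lebesgue_on_coords w) (\<lambda>x. LINT y|lebesgue_on_coords (u - w). f0 (merge w (u - w) (x, y)))"
    using f0 by (intro integrable_PiM_merge[OF fin disj]) (simp only: un)
  also have "?this \<longleftrightarrow> integrable (lebesgue_on_coords w) (\<lambda>x. indicator (cube w) x * proj u w g x)"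
    using inner by (intro Bochner_Integration.integrable_cong) auto
  finally show "set_integrable (lebesgue_on_coords w) (cube w) (proj u w g)"
    by (simp add: set_integrable_def)
  define F where "F x = complex_of_real (f0 x) * (\<Prod>j\<in>w. \<psi> j (x j))" for x
  have F: "integrable (lebesgue_on_coords u) F"
    unfolding F_def
  proof (rule integrable_bounded_mult[where B = "\<Prod>j\<in>w. B j"])
    show "integrable (lebesgue_on_coords u) (\<lambda>x. complex_of_real (f0 x))"
      using f0 by (rule integrable_of_real)
    show "(\<lambda>x. \<Prod>j\<in>w. \<psi> j (x j)) \<in> borel_measurable (lebesgue_on_coords u)"
    proof (rule borel_measurable_prod)
      fix j assume j: "j \<in> w"
      then have "j \<in> u" using w by auto
      then show "(\<lambda>x. \<psi> j (x j)) \<in> borel_measurable (lebesgue_on_coords u)" using \<psi>[OF j] by measurable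
    qed
    fix x assume "complex_of_real (f0 x) \<noteq> 0"
    then have "x \<in> cube u" by (auto simp: f0_def indicator_def split: if_splits)
    then show "norm (\<Prod>j\<in>w. \<psi> j (x j)) \<le> (\<Prod>j\<in>w. B j)"
      unfolding prod_norm[symmetric] using B w by (intro prod_mono) (auto simp: cube_def PiE_iff)
  qed
  then show "set_integrable (lebesgue_on_coords u) (cube u) (\<lambda>x. complex_of_real (g x) * (\<Prod>j\<in>w. \<psi> j (x j)))"
    by (simp add: F_def[abs_def] f0_def set_integrable_def scaleR_conv_of_real mult.assoc)
  have "(LINT x:cube u|lebesgue_on_coords u. complex_of_real (g x) * (\<Prod>j\<in>w. \<psi> j (x j))) = integral\<^sup>L (lebesgue_on_coords (w \<union> (u - w))) F"
    unfolding un by (simp add: F_def[abs_def] f0_def set_lebesgue_integral_def scaleR_conv_of_real mult.assoc)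
  also have "\<dots> = (LINT x|lebesgue_on_coords w. LINT y|lebesgue_on_coords (u - w). F (merge w (u - w) (x, y)))"
    using F by (intro lborel_PiM.product_integral_fold[OF disj fin]) (simp only: un)
  also have "\<dots> = (LINT x|lebesgue_on_coords w. indicator (cube w) x *\<^sub>R (complex_of_real (proj u w g x) * (\<Prod>j\<in>w. \<psi> j (x j))))"
  proof (rule Bochner_Integration.integral_cong[OF refl])
    fix x assume x: "x \<in> space (lebesgue_on_coords w)"
    have "(\<Prod>j\<in>w. \<psi> j (merge w (u - w) (x, y) j)) = (\<Prod>j\<in>w. \<psi> j (x j))" for y
      by (intro prod.cong) (auto simp: merge_def)
    then have "(LINT y|lebesgue_on_coords (u - w). F (merge w (u - w) (x, y))) =
      complex_of_real (LINT y|lebesgue_on_coords (u - w). f0 (merge w (u - w) (x, y))) * (\<Prod>j\<in>w. \<psi> j (x j))"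
      unfolding F_def by (simp flip: integral_complex_of_real)
    then show "(LINT y|lebesgue_on_coords (u - w). F (merge w (u - w) (x, y))) =
      indicator (cube w) x *\<^sub>R (complex_of_real (proj u w g x) * (\<Prod>j\<in>w. \<psi> j (x j)))"
      by (simp add: inner[OF x] scaleR_conv_of_real mult.assoc)
  qed
  finally show "(LINT x:cube u|lebesgue_on_coords u. complex_of_real (g x) * (\<Prod>j\<in>w. \<psi> j (x j))) =
      (LINT x:cube w|lebesgue_on_coords w. complex_of_real (proj u w g x) * (\<Prod>j\<in>w. \<psi> j (x j)))"
    by (simp add: set_lebesgue_integral_def)
qed

text \<open>A mean \<open>m j\<close> survives only on the trivial grid \<open>M j = 1\<close>,
  where the factor \<open>(1 / M j) powr lam\<close> is 1 and claims no decay. The constant stands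
  before the quantifiers over \<open>\<psi>\<close>, \<open>B\<close> and \<open>M\<close>, since
  one constant has to serve all \<open>k\<close>.\<close>

lemma HK_integral_bound:
  assumes u: "finite u" and lam: "0 \<le> lam" and \<pp>: "\<pp> \<ge> 1" and HK: "HK_var lam \<pp> \<qq> u g < \<infinity>"
  shows "\<exists>K\<ge>0. \<forall>(\<psi> :: nat \<Rightarrow> real \<Rightarrow> complex) B (M :: nat \<Rightarrow> nat).
      (\<forall>j\<in>u. M j > 0 \<and> \<psi> j \<in> borel_measurable borel \<and> (\<forall>x\<in>{0..<1}. norm (\<psi> j x) \<le> B j) \<and>
        (M j = 1 \<or> (\<forall>n<M j. (LBINT x:{real n / M j..<real n / M j + 1 / M j}. \<psi> j x) = 0))) \<longrightarrow>
      norm (LINT x:cube u|lebesgue_on_coords u. complex_of_real (g x) * (\<Prod>j\<in>u. \<psi> j (x j)))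
        \<le> K * (\<Prod>j\<in>u. B j * (1 / M j) powr lam)"
proof -
  have g: "set_integrable (lebesgue_on_coords u) (cube u) g"
    by (rule set_integrable_cube_of_proj[OF u HK_var_finite_imp(1)[OF u HK]]) simp
  \<comment> \<open>The test functions and grids are quantified inside \<open>good\<close>, so that
    the constant chosen for \<open>w\<close> depends only on the projection.\<close>
  define good where "good w K \<longleftrightarrow> 0 \<le> K \<and> (\<forall>\<psi> :: nat \<Rightarrow> real \<Rightarrow> complex. \<forall>B M.
      (\<forall>j\<in>w. M j > (0::nat)) \<longrightarrow> (\<forall>j\<in>w. \<psi> j \<in> borel_measurable borel) \<longrightarrow>
      (\<forall>j\<in>w. \<forall>x\<in>{0..<1}. norm (\<psi> j x) \<le> B j) \<longrightarrow>
      (\<forall>j\<in>w. \<forall>n<M j. (LBINT x:{real n / M j..<real n / M j + 1 / M j}. \<psi> j x) = 0) \<longrightarrow>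
      norm (LINT x:cube w|lebesgue_on_coords w. complex_of_real (proj u w g x) * (\<Prod>j\<in>w. \<psi> j (x j)))
        \<le> K * (\<Prod>j\<in>w. B j * (1 / M j) powr lam))" for w K
  have "\<exists>K. good w K" if w: "w \<subseteq> u" for w
  proof (cases "w = {}")
    case True
    have "(LINT x|lebesgue_on_coords {}. F x) = F (\<lambda>_. undefined)" for F :: "(nat \<Rightarrow> real) \<Rightarrow> complex"
      by (simp add: PiM_empty lebesgue_integral_count_space_finite)
    then show ?thesis
      by (intro exI[of _ "\<bar>proj u {} g (\<lambda>_. undefined)\<bar>"]) (simp add: good_def True cube_def set_lebesgue_integral_def)
  next
    case False
    have finw: "finite w" using w u finite_subset by auto
    obtain V where V: "0 \<le> V" "\<And>P. P \<in> box_partitions w \<Longrightarrow> partition_sum lam \<pp> w (proj u w g) P \<le> V"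
      using Vitali_var_finite_imp_bounded[OF HK_var_finite_imp(2)[OF u HK w False] \<pp>] by blast
    show ?thesis
      unfolding good_def
    proof (intro exI[of _ "4 ^ card w * (1 + 4 ^ card w * V)"] conjI allI impI)
      fix \<psi> :: "nat \<Rightarrow> real \<Rightarrow> complex" and B and M :: "nat \<Rightarrow> nat"
      assume *: "\<forall>j\<in>w. M j > 0" "\<forall>j\<in>w. \<psi> j \<in> borel_measurable borel"
        "\<forall>j\<in>w. \<forall>x\<in>{0..<1}. norm (\<psi> j x) \<le> B j"
        "\<forall>j\<in>w. \<forall>n<M j. (LBINT x:{real n / M j..<real n / M j + 1 / M j}. \<psi> j x) = 0"
      show "norm (LINT x:cube w|lebesgue_on_coords w. complex_of_real (proj u w g x) * (\<Prod>j\<in>w. \<psi> j (x j)))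
        \<le> 4 ^ card w * (1 + 4 ^ card w * V) * (\<Prod>j\<in>w. B j * (1 / M j) powr lam)"
        by (rule integral_cube_le_partition_sum[OF finw lam \<pp> V(2)])
          (use * proj_integral(1)[OF u w g, of \<psi> B] in auto)
    qed (use V in auto)
  qed
  then obtain K where good: "\<And>w. w \<subseteq> u \<Longrightarrow> good w (K w)" by metis
  then have K: "\<And>w. w \<subseteq> u \<Longrightarrow> 0 \<le> K w" by (simp add: good_def)
  have bound: "norm (LINT x:cube w|lebesgue_on_coords w. complex_of_real (proj u w g x) * (\<Prod>j\<in>w. \<psi> j (x j)))
        \<le> K w * (\<Prod>j\<in>w. B j * (1 / M j) powr lam)"
    if "w \<subseteq> u" "\<forall>j\<in>w. M j > (0::nat)" "\<forall>j\<in>w. \<psi> j \<in> borel_measurable borel"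
      "\<forall>j\<in>w. \<forall>x\<in>{0..<1}. norm (\<psi> j x) \<le> B j"
      "\<forall>j\<in>w. \<forall>n<M j. (LBINT x:{real n / M j..<real n / M j + 1 / M j}. \<psi> j x) = 0"
    for w and \<psi> :: "nat \<Rightarrow> real \<Rightarrow> complex" and B M
    using good[OF that(1)] that(2-) unfolding good_def by blast
  show ?thesis
  proof (intro exI[of _ "\<Sum>w\<in>Pow u. 2 ^ card w * K w"] conjI allI impI)
    show "0 \<le> (\<Sum>w\<in>Pow u. 2 ^ card w * K w)" using K by (intro sum_nonneg) auto
    fix \<psi> :: "nat \<Rightarrow> real \<Rightarrow> complex" and B :: "nat \<Rightarrow> real" and M :: "nat \<Rightarrow> nat"
    assume "\<forall>j\<in>u. M j > 0 \<and> \<psi> j \<in> borel_measurable borel \<and> (\<forall>x\<in>{0..<1}. norm (\<psi> j x) \<le> B j) \<and>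
        (M j = 1 \<or> (\<forall>n<M j. (LBINT x:{real n / M j..<real n / M j + 1 / M j}. \<psi> j x) = 0))"
    then have M: "\<And>j. j \<in> u \<Longrightarrow> M j > 0" and \<psi>: "\<And>j. j \<in> u \<Longrightarrow> \<psi> j \<in> borel_measurable borel"
      and B: "\<And>j x. j \<in> u \<Longrightarrow> x \<in> {0..<1} \<Longrightarrow> norm (\<psi> j x) \<le> B j"
      and mean: "\<And>j. j \<in> u \<Longrightarrow> M j = 1 \<or> (\<forall>n<M j. (LBINT x:{real n / M j..<real n / M j + 1 / M j}. \<psi> j x) = 0)"
      by blast+
    define m where "m j = (LBINT x:{0..<1}. \<psi> j x)" for j
    define \<beta> where "\<beta> j x = \<psi> j x - m j" for j x
    have cell_sub: "{real n / M j..<real n / M j + 1 / M j} \<subseteq> {0..<1}" if "j \<in> u" "n < M j" for j n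
      using grid_cells(1)[OF M[OF that(1)]] that(2) by blast
    \<comment> \<open>On a nontrivial grid the mean over \<open>[0,1)\<close> is a sum of cell
      means, all of them 0.\<close>
    have m0: "m j = 0" if j: "j \<in> u" "M j \<noteq> 1" for j
    proof -
      have "m j = (\<Sum>n<M j. LBINT x:{real n / M j..<real n / M j + 1 / M j}. \<psi> j x)"
        unfolding m_def grid_cells(1)[OF M[OF j(1)], symmetric]
      proof (rule set_integral_finite_Union[OF _ grid_cells(2)[OF M[OF j(1)]]])
        fix n assume "n \<in> {..<M j}"
        then show "set_integrable lborel {real n / M j..<real n / M j + 1 / M j} (\<psi> j)"
          using \<psi>[OF j(1)] B[OF j(1)] subsetD[OF cell_sub[OF j(1)], of n]
          by (intro set_integrable_bounded_interval[where B = "B j"]) auto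
      qed auto
      then show ?thesis using mean[OF j(1)] j(2) by simp
    qed
    have B0: "0 \<le> B j" if j: "j \<in> u" for j
    proof -
      have "norm (\<psi> j 0) \<le> B j" using j by (intro B) auto
      with norm_ge_zero show ?thesis by (rule order_trans)
    qed
    have mB: "norm (m j) \<le> B j" if j: "j \<in> u" for j
    proof -
      have "norm (m j) \<le> B j * measure lborel {0..<1::real}"
        unfolding m_def using B[OF j] B0[OF j] by (intro norm_set_integral_le_AE AE_I2) auto
      then show ?thesis by simp
    qed
    have m_le: "norm (m j) \<le> B j * (1 / M j) powr lam" if j: "j \<in> u" for j
      using mB[OF j] m0[OF j] B0[OF j] by (cases "M j = 1") auto
    have \<beta>m: "\<beta> j \<in> borel_measurable borel" if j: "j \<in> u" for j
      unfolding \<beta>_def[abs_def] using \<psi>[OF j] by measurable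
    have \<beta>B: "norm (\<beta> j x) \<le> 2 * B j" if j: "j \<in> u" and x: "x \<in> {0..<1}" for j x
      unfolding \<beta>_def using norm_triangle_ineq4[of "\<psi> j x" "m j"] B[OF j x] mB[OF j] by linarith
    have \<beta>0: "(LBINT x:{real n / M j..<real n / M j + 1 / M j}. \<beta> j x) = 0" if j: "j \<in> u" and n: "n < M j" for j n
    proof (cases "M j = 1")
      case True
      have "(LBINT x:{0..<1}. \<beta> j x) = (LBINT x:{0..<1}. \<psi> j x) - (LBINT x:{0..<1::real}. m j)"
        unfolding \<beta>_def using \<psi>[OF j] B[OF j]
        by (intro set_integral_diff set_integrable_bounded_interval[where B = "B j"]
              set_integrable_bounded_interval[where B = "norm (m j)"]) auto
      also have "\<dots> = 0" by (subst set_integral_const) (auto simp: m_def)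
      finally show ?thesis using True n by simp
    next
      case False
      then show ?thesis using mean[OF j] n m0[OF j] by (simp add: \<beta>_def)
    qed
    have each: "norm (LINT x:cube u|lebesgue_on_coords u. complex_of_real (g x) * (\<Prod>j\<in>w. \<beta> j (x j))) * norm (\<Prod>j\<in>u - w. m j)
      \<le> 2 ^ card w * K w * (\<Prod>j\<in>u. B j * (1 / M j) powr lam)" if w: "w \<subseteq> u" for w
    proof -
      have "norm (LINT x:cube u|lebesgue_on_coords u. complex_of_real (g x) * (\<Prod>j\<in>w. \<beta> j (x j)))
        = norm (LINT x:cube w|lebesgue_on_coords w. complex_of_real (proj u w g x) * (\<Prod>j\<in>w. \<beta> j (x j)))"
        using \<beta>m \<beta>B w by (subst proj_integral(3)[OF u w g, of \<beta> "\<lambda>j. 2 * B j"]) auto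
      also have "\<dots> \<le> K w * (\<Prod>j\<in>w. (2 * B j) * (1 / M j) powr lam)"
        using w M \<beta>m \<beta>B \<beta>0 by (intro bound) blast+
      also have "(\<Prod>j\<in>w. (2 * B j) * (1 / M j) powr lam) = 2 ^ card w * (\<Prod>j\<in>w. B j * (1 / M j) powr lam)"
        by (simp add: prod.distrib)
      finally have 1: "norm (LINT x:cube u|lebesgue_on_coords u. complex_of_real (g x) * (\<Prod>j\<in>w. \<beta> j (x j)))
        \<le> K w * (2 ^ card w * (\<Prod>j\<in>w. B j * (1 / M j) powr lam))" .
      have 2: "norm (\<Prod>j\<in>u - w. m j) \<le> (\<Prod>j\<in>u - w. B j * (1 / M j) powr lam)"
        unfolding prod_norm[symmetric] using m_le by (intro prod_mono) auto
      have "norm (LINT x:cube u|lebesgue_on_coords u. complex_of_real (g x) * (\<Prod>j\<in>w. \<beta> j (x j))) * norm (\<Prod>j\<in>u - w. m j)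
        \<le> K w * (2 ^ card w * (\<Prod>j\<in>w. B j * (1 / M j) powr lam)) * (\<Prod>j\<in>u - w. B j * (1 / M j) powr lam)"
        using 1 2 K[OF w] B0 w by (intro mult_mono mult_nonneg_nonneg prod_nonneg) auto
      also have "\<dots> = 2 ^ card w * K w * ((\<Prod>j\<in>u - w. B j * (1 / M j) powr lam) * (\<Prod>j\<in>w. B j * (1 / M j) powr lam))"
        by (simp add: mult_ac)
      also have "(\<Prod>j\<in>u - w. B j * (1 / M j) powr lam) * (\<Prod>j\<in>w. B j * (1 / M j) powr lam) = (\<Prod>j\<in>u. B j * (1 / M j) powr lam)"
        by (rule prod.subset_diff[OF w u, symmetric])
      finally show ?thesis .
    qed
    have int: "set_integrable (lebesgue_on_coords u) (cube u) (\<lambda>x. complex_of_real (g x) * (\<Prod>j\<in>w. \<beta> j (x j)))" if w: "w \<subseteq> u" for w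
      by (rule proj_integral(2)[OF u w g, of \<beta> "\<lambda>j. 2 * B j"]) (use \<beta>m \<beta>B w in auto)
    \<comment> \<open>Expanding the product of the sums \<open>\<beta> j + m j\<close>: the set
      \<open>w\<close> collects the variables in which \<open>\<beta> j\<close> is taken, and
      exactly these remain in the projection.\<close>
    have "(\<Prod>j\<in>u. \<psi> j (x j)) = (\<Sum>w\<in>Pow u. (\<Prod>j\<in>w. \<beta> j (x j)) * (\<Prod>j\<in>u - w. m j))" for x
      using prod_add[OF u, of "\<lambda>j. \<beta> j (x j)" m] by (simp add: \<beta>_def)
    then have "(LINT x:cube u|lebesgue_on_coords u. complex_of_real (g x) * (\<Prod>j\<in>u. \<psi> j (x j))) =
      (LINT x:cube u|lebesgue_on_coords u. \<Sum>w\<in>Pow u. (complex_of_real (g x) * (\<Prod>j\<in>w. \<beta> j (x j))) * (\<Prod>j\<in>u - w. m j))"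
      by (simp add: sum_distrib_left mult.assoc)
    also have "\<dots> = (\<Sum>w\<in>Pow u. LINT x:cube u|lebesgue_on_coords u. (complex_of_real (g x) * (\<Prod>j\<in>w. \<beta> j (x j))) * (\<Prod>j\<in>u - w. m j))"
      using int unfolding set_lebesgue_integral_def scaleR_sum_right set_integrable_def
      by (intro Bochner_Integration.integral_sum) (auto simp: scaleR_conv_of_real mult.assoc[symmetric] intro!: integrable_mult_left)
    also have "norm \<dots> \<le> (\<Sum>w\<in>Pow u. 2 ^ card w * K w * (\<Prod>j\<in>u. B j * (1 / M j) powr lam))"
    proof (rule order_trans[OF norm_sum sum_mono])
      fix w assume "w \<in> Pow u"
      then show "norm (LINT x:cube u|lebesgue_on_coords u. (complex_of_real (g x) * (\<Prod>j\<in>w. \<beta> j (x j))) * (\<Prod>j\<in>u - w. m j))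
        \<le> 2 ^ card w * K w * (\<Prod>j\<in>u. B j * (1 / M j) powr lam)"
        using each[of w] by (simp add: norm_mult)
    qed
    finally show "norm (LINT x:cube u|lebesgue_on_coords u. complex_of_real (g x) * (\<Prod>j\<in>u. \<psi> j (x j)))
      \<le> (\<Sum>w\<in>Pow u. 2 ^ card w * K w) * (\<Prod>j\<in>u. B j * (1 / M j) powr lam)"
      by (simp add: sum_distrib_right)
  qed
qed


section \<open>Taylor expansion in several variables\<close>

lemma sum_PiE_insert:
  assumes "i \<notin> A"
  shows "(\<Sum>g\<in>Pi\<^sub>E (insert i A) B. F g) = (\<Sum>g\<in>Pi\<^sub>E A B. \<Sum>y\<in>B i. F (g(i := y)))"
proof -
  have "(\<Sum>g\<in>Pi\<^sub>E (insert i A) B. F g) = (\<Sum>(g, y)\<in>Pi\<^sub>E A B \<times> B i. F (g(i := y)))"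
    using assms by (intro sum.reindex_bij_witness[of _ "\<lambda>(g, y). g(i := y)" "\<lambda>g. (g(i := undefined), g i)"])
      (auto simp: PiE_def extensional_def)
  then show ?thesis by (simp add: sum.cartesian_product)
qed

lemma compact_PiE_UNIV:
  fixes C :: "'i \<Rightarrow> real set"
  assumes "\<And>i. compact (C i)" shows "compact (Pi\<^sub>E UNIV C)"
  using assms compactin_PiE[of "\<lambda>_. euclidean" UNIV C] by (simp add: euclidean_product_topology)

lemma closed_PiE_UNIV:
  fixes C :: "'i \<Rightarrow> real set"
  assumes "\<And>i. closed (C i)" shows "closed (Pi\<^sub>E UNIV C)"
proof -
  have "Pi\<^sub>E UNIV C = (\<Inter>i. (\<lambda>x. x i) -` C i)" by auto
  then show ?thesis using assms by (auto intro!: closed_INT closed_vimage)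
qed

text \<open>Taylor's formula on \<open>[0,x]\<close>, where the highest derivative is continuous on
  a compact interval. The kernel is 0 outside it, so the remainder can be written over the whole
  line.\<close>

lemma taylor_kernel_sum_integral:
  fixes D :: "nat \<Rightarrow> real \<Rightarrow> real"
  assumes \<delta>: "\<delta> \<ge> 1" and D: "\<And>i t. i < \<delta> \<Longrightarrow> t \<in> {0..<1} \<Longrightarrow> (D i has_vector_derivative D (Suc i) t) (at t within {0..<1})"
    and cont: "continuous_on {0..<1} (D \<delta>)" and x: "x \<in> {0..<1}"
  shows "D 0 x = (\<Sum>i<\<delta>. taylor_kernel (Suc i) x 0 * D i 0) + (LBINT t. taylor_kernel \<delta> x t * D \<delta> t)"
proof -
  have sub: "{0..x} \<subseteq> {0..<1}" using x by auto
  let ?i = "\<lambda>t. ((x - t) ^ (\<delta> - 1) / fact (\<delta> - 1)) *\<^sub>R D \<delta> t"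
  have "D 0 x = (\<Sum>i<\<delta>. ((x - 0) ^ i / fact i) *\<^sub>R D i 0) + integral {0..x} ?i"
  proof (rule Taylor_integral)
    fix m t assume "m < \<delta>" "0 \<le> t" "t \<le> x"
    then show "(D m has_vector_derivative D (Suc m) t) (at t within {0..x})"
      using D[of m t] sub has_vector_derivative_within_subset by (metis atLeastAtMost_iff subsetD)
  qed (use \<delta> x in auto)
  moreover have "integral {0..x} ?i = (LBINT t:{0..x}. ?i t)"
  proof (rule set_borel_integral_eq_integral(2)[symmetric])
    have "continuous_on {0..x} ?i"
      using continuous_on_subset[OF cont sub] by (auto intro!: continuous_intros)
    then show "set_integrable lborel {0..x} ?i" by (rule borel_integrable_atLeastAtMost')
  qed
  moreover have "(LBINT t:{0..x}. ?i t) = (LBINT t. taylor_kernel \<delta> x t * D \<delta> t)"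
    unfolding set_lebesgue_integral_def
    by (intro Bochner_Integration.integral_cong) (auto simp: taylor_kernel_def indicator_def)
  moreover have "taylor_kernel (Suc i) x 0 = (x - 0) ^ i / fact i" for i
    using x by (simp add: taylor_kernel_def)
  ultimately show ?thesis by simp
qed

text \<open>Although \<open>g\<close> may be unbounded on the cube, the kernels vanish off the
  compact box \<open>K\<close> strictly below 1, and \<open>g\<close> is bounded on the points
  reached from there.\<close>

lemma integrable_kernel_continuous:
  fixes g :: "(nat \<Rightarrow> real) \<Rightarrow> real"
  assumes S: "finite S" and u: "u \<subseteq> S" and g: "continuous_on (cube S) g"
    and x: "x \<in> cube S" and c: "c \<in> cube S"
  shows "integrable (lebesgue_on_coords u) (\<lambda>t. (\<Prod>j\<in>u. taylor_kernel \<delta> (x j) (t j)) * g (override_on c t u))"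
proof -
  \<comment> \<open>Points are functions on all naturals. The singleton sides fix the coordinates
    outside \<open>u\<close>, those outside \<open>S\<close> at \<open>undefined\<close>, so that
    \<open>Q\<close> is compact in the full product and contained in the cube.\<close>
  define C where "C j = (if j \<in> u then {0..x j} else {c j})" for j
  define Q where "Q = Pi\<^sub>E UNIV C"
  define K where "K = (\<Pi>\<^sub>E j\<in>u. {0..x j})"
  have finu: "finite u" using u S finite_subset by auto
  have Q: "compact Q" "closed Q" unfolding Q_def
    by (rule compact_PiE_UNIV closed_PiE_UNIV; simp add: C_def)+
  have Q_sub: "Q \<subseteq> cube S"
  proof
    fix y assume "y \<in> Q"
    then have y: "y j \<in> C j" for j by (auto simp: Q_def)
    show "y \<in> cube S"
      unfolding cube_def PiE_iff
    proof (intro conjI ballI)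
      fix j assume "j \<in> S"
      then show "y j \<in> {0..<1}" using y[of j] x c by (auto simp: C_def cube_def PiE_iff split: if_splits)
    next
      show "y \<in> extensional S" unfolding extensional_def
      proof (intro CollectI allI impI)
        fix j assume "j \<notin> S"
        then show "y j = undefined" using y[of j] u c by (auto simp: C_def cube_def PiE_iff extensional_def split: if_splits)
      qed
    qed
  qed
  have contQ: "continuous_on Q g" using g Q_sub by (rule continuous_on_subset)
  then have "bounded (g ` Q)" by (intro compact_imp_bounded compact_continuous_image Q)
  then obtain b where b: "\<And>y. y \<in> Q \<Longrightarrow> norm (g y) \<le> b" unfolding bounded_iff by auto
  \<comment> \<open>Nothing is known about \<open>g\<close> off the cube; cutting it off at the
    closed set \<open>Q\<close> makes it Borel measurable without changing the product with the
    kernels.\<close>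
  define g' where "g' y = (if y \<in> Q then g y else 0)" for y
  have g'm: "g' \<in> borel_measurable borel"
    unfolding g'_def[abs_def] using Q contQ by (intro borel_measurable_continuous_on_if) auto
  have ovm: "(\<lambda>t. override_on c t u) \<in> measurable (lebesgue_on_coords u) borel"
  proof (rule measurable_coordinatewise_then_product)
    fix j show "(\<lambda>t. override_on c t u j) \<in> borel_measurable (lebesgue_on_coords u)"
      by (cases "j \<in> u") (auto simp: override_on_def)
  qed
  have zero: "(\<Prod>j\<in>u. taylor_kernel \<delta> (x j) (t j)) = 0" if "t \<in> space (lebesgue_on_coords u)" "t \<notin> K" for t
  proof -
    have "\<not> (\<forall>j\<in>u. t j \<in> {0..x j})" using that unfolding K_def space_PiM PiE_iff by blast
    then obtain j where "j \<in> u" "t j \<notin> {0..x j}" by blast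
    then show ?thesis using finu by (intro prod_zero) (auto simp: taylor_kernel_def)
  qed
  have inQ: "override_on c t u \<in> Q" if "t \<in> K" for t
    using that by (auto simp: Q_def C_def K_def override_on_def PiE_iff)
  have "integrable (lebesgue_on_coords u) (\<lambda>t. (\<Prod>j\<in>u. taylor_kernel \<delta> (x j) (t j)) * g' (override_on c t u))"
  proof (rule integrableI_bounded_set[where A = K and B = b])
    show "K \<in> sets (lebesgue_on_coords u)" unfolding K_def by (rule box_measurable[OF finu]) auto
    have "(\<lambda>t. \<Prod>j\<in>u. taylor_kernel \<delta> (x j) (t j)) \<in> borel_measurable (lebesgue_on_coords u)"
      by (intro borel_measurable_prod taylor_kernel_measurable) auto
    then show "(\<lambda>t. (\<Prod>j\<in>u. taylor_kernel \<delta> (x j) (t j)) * g' (override_on c t u)) \<in> borel_measurable (lebesgue_on_coords u)"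
      using measurable_compose[OF ovm g'm] by (rule borel_measurable_times)
    have "emeasure (lebesgue_on_coords u) K = (\<Prod>j\<in>u. emeasure lborel {0..x j})"
      unfolding K_def by (rule lborel_PiM.emeasure_PiM[OF finu]) auto
    also have "\<dots> < \<infinity>" using finu by (auto simp: less_top[symmetric] ennreal_prod_eq_top emeasure_lborel_Icc_eq)
    finally show "emeasure (lebesgue_on_coords u) K < \<infinity>" .
    show "AE t in lebesgue_on_coords u. t \<in> K \<longrightarrow> norm ((\<Prod>j\<in>u. taylor_kernel \<delta> (x j) (t j)) * g' (override_on c t u)) \<le> b"
    proof (intro AE_I2 impI)
      fix t assume t: "t \<in> K"
      have "\<bar>\<Prod>j\<in>u. taylor_kernel \<delta> (x j) (t j)\<bar> \<le> (\<Prod>j\<in>u. 1)"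
        unfolding abs_prod using u x by (intro prod_mono conjI abs_taylor_kernel_le_1) (auto simp: cube_def PiE_iff)
      then have "\<bar>\<Prod>j\<in>u. taylor_kernel \<delta> (x j) (t j)\<bar> * norm (g (override_on c t u)) \<le> 1 * b"
        using b[OF inQ[OF t]] by (intro mult_mono) auto
      then show "norm ((\<Prod>j\<in>u. taylor_kernel \<delta> (x j) (t j)) * g' (override_on c t u)) \<le> b"
        using inQ[OF t] by (simp add: g'_def abs_mult)
    qed
    show "AE t in lebesgue_on_coords u. t \<notin> K \<longrightarrow> (\<Prod>j\<in>u. taylor_kernel \<delta> (x j) (t j)) * g' (override_on c t u) = 0"
      using zero by (intro AE_I2) auto
  qed
  also have "?this \<longleftrightarrow> integrable (lebesgue_on_coords u) (\<lambda>t. (\<Prod>j\<in>u. taylor_kernel \<delta> (x j) (t j)) * g (override_on c t u))"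
  proof (rule Bochner_Integration.integrable_cong[OF refl])
    fix t assume "t \<in> space (lebesgue_on_coords u)"
    then show "(\<Prod>j\<in>u. taylor_kernel \<delta> (x j) (t j)) * g' (override_on c t u) = (\<Prod>j\<in>u. taylor_kernel \<delta> (x j) (t j)) * g (override_on c t u)"
      using zero[of t] inQ[of t] by (cases "t \<in> K") (auto simp: g'_def)
  qed
  finally show ?thesis .
qed

text \<open>Variables from \<open>n\<close> on only. The expansion treats the variables in
  descending order, and as the head of the list is differentiated last, raising
  \<open>\<tau> n\<close> merely prepends \<open>n\<close>.\<close>

definition deriv_list :: "nat \<Rightarrow> nat \<Rightarrow> (nat \<Rightarrow> nat) \<Rightarrow> nat list" where
  "deriv_list n s \<tau> = concat (map (\<lambda>j. replicate (\<tau> j) j) [n..<Suc s])"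

lemma mixed_pderiv_eq: "mixed_pderiv s \<tau> f = iter_pderiv (deriv_list 1 s \<tau>) f"
  by (simp add: mixed_pderiv_def deriv_list_def)

lemma deriv_list_upd:
  assumes "n \<le> s"
  shows "deriv_list n s (\<tau>(n := i)) = replicate i n @ deriv_list (Suc n) s \<tau>"
proof -
  have *: "map (\<lambda>j. replicate ((\<tau>(n := i)) j) j) [Suc n..<Suc s] = map (\<lambda>j. replicate (\<tau> j) j) [Suc n..<Suc s]"
    by (rule map_cong) auto
  have upt: "[n..<Suc s] = n # [Suc n..<Suc s]" using assms by (simp add: upt_conv_Cons del: upt_Suc)
  show ?thesis unfolding deriv_list_def upt list.map concat.simps * by simp
qed

lemma count_list_replicate: "count_list (replicate k j) i = (if i = j then k else 0)"
  by (induction k) auto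

lemma count_list_deriv_list:
  "count_list (deriv_list n s \<tau>) i = (if n \<le> i \<and> i \<le> s then \<tau> i else 0)"
proof -
  have "count_list (concat (map (\<lambda>j. replicate (\<tau> j) j) xs)) i = (if i \<in> set xs then \<tau> i else 0)" if "distinct xs" for xs
    using that by (induction xs) (auto simp: count_list_replicate)
  from this[of "[n..<Suc s]"] show ?thesis by (auto simp: deriv_list_def simp del: upt_Suc)
qed

lemma admissible_deriv_list:
  assumes "1 \<le> n" "\<And>j. n \<le> j \<Longrightarrow> j \<le> s \<Longrightarrow> \<tau> j \<le> \<delta>"
  shows "admissible \<delta> s (deriv_list n s \<tau>)"
  unfolding admissible_def count_list_deriv_list
  using assms by (auto simp: deriv_list_def simp del: upt_Suc)

lemma cube_upd: "y \<in> cube S \<Longrightarrow> n \<in> S \<Longrightarrow> t \<in> {0..<1} \<Longrightarrow> y(n := t) \<in> cube S"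
  by (auto simp: cube_def PiE_iff extensional_def)

lemma continuous_iter_pderiv:
  assumes "cont_mixed_pderivs \<delta> s f" "1 \<le> n" "\<And>j. n \<le> j \<Longrightarrow> j \<le> s \<Longrightarrow> \<tau> j \<le> \<delta>"
  shows "continuous_on (cube {1..s}) (iter_pderiv (deriv_list n s \<tau>) f)"
  using assms(1) admissible_deriv_list[of n s \<tau> \<delta>, OF assms(2,3)] unfolding cont_mixed_pderivs_def by blast

lemma taylor_one_variable:
  assumes f: "cont_mixed_pderivs \<delta> s f" and \<delta>: "\<delta> \<ge> 1" and n: "1 \<le> n" "n \<le> s"
    and \<tau>: "\<And>j. Suc n \<le> j \<Longrightarrow> j \<le> s \<Longrightarrow> \<tau> j \<le> \<delta>" and y: "y \<in> cube {1..s}"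
  defines "G \<equiv> \<lambda>i. iter_pderiv (deriv_list n s (\<tau>(n := i))) f"
  shows "iter_pderiv (deriv_list (Suc n) s \<tau>) f y =
    (\<Sum>i<\<delta>. taylor_kernel (Suc i) (y n) 0 * G i (y(n := 0))) + (LBINT t. taylor_kernel \<delta> (y n) t * G \<delta> (y(n := t)))"
proof -
  have yn: "y n \<in> {0..<1}" using y n by (auto simp: cube_def)
  have adm: "admissible \<delta> s (deriv_list n s (\<tau>(n := i)))" if "i \<le> \<delta>" for i
    using that n \<tau> by (intro admissible_deriv_list) auto
  have "G 0 (y(n := y n)) = (\<Sum>i<\<delta>. taylor_kernel (Suc i) (y n) 0 * G i (y(n := 0))) + (LBINT t. taylor_kernel \<delta> (y n) t * G \<delta> (y(n := t)))"
  proof (rule taylor_kernel_sum_integral[OF \<delta> _ _ yn])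
    fix i t assume i: "i < \<delta>" and t: "t \<in> {0..<1::real}"
    have list: "deriv_list n s (\<tau>(n := Suc i)) = n # deriv_list n s (\<tau>(n := i))"
      using n by (simp add: deriv_list_upd)
    have "has_pderiv_on_cube {1..s} n (G i)"
      using f adm[of "Suc i"] i unfolding cont_mixed_pderivs_def G_def list[symmetric] by (metis list Suc_leI)
    then have "(\<lambda>t'. G i ((y(n := t))(n := t'))) differentiable at ((y(n := t)) n) within {0..<1}"
      unfolding has_pderiv_on_cube_def using cube_upd[OF y _ t, of n] n by auto
    then have "((\<lambda>t'. G i (y(n := t'))) has_vector_derivative vector_derivative (\<lambda>t'. G i (y(n := t'))) (at t within {0..<1})) (at t within {0..<1})"
      by (simp add: vector_derivative_works)
    also have "vector_derivative (\<lambda>t'. G i (y(n := t'))) (at t within {0..<1}) = G (Suc i) (y(n := t))"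
      unfolding G_def list by (simp add: iter_pderiv_def pderiv_at_def)
    finally show "((\<lambda>t'. G i (y(n := t'))) has_vector_derivative G (Suc i) (y(n := t))) (at t within {0..<1})" .
  next
    have "continuous_on (cube {1..s}) (G \<delta>)"
      using f adm[of \<delta>] unfolding cont_mixed_pderivs_def G_def by auto
    moreover have "continuous_on {0..<1} (\<lambda>t. y(n := t))"
    proof (rule continuous_on_coordinatewise_then_product)
      fix i show "continuous_on {0..<1} (\<lambda>t. (y(n := t)) i)"
        by (cases "i = n") (auto intro!: continuous_intros)
    qed
    moreover have "(\<lambda>t. y(n := t)) ` {0..<1} \<subseteq> cube {1..s}" using cube_upd[OF y] n by auto
    ultimately show "continuous_on {0..<1} (\<lambda>t. G \<delta> (y(n := t)))"
      by (rule continuous_on_compose2)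
  qed
  moreover have "deriv_list n s (\<tau>(n := 0)) = deriv_list (Suc n) s \<tau>" using n by (simp add: deriv_list_upd)
  ultimately show ?thesis by (simp add: G_def)
qed

definition top_set :: "nat \<Rightarrow> nat \<Rightarrow> nat \<Rightarrow> (nat \<Rightarrow> nat) \<Rightarrow> nat set" where
  "top_set \<delta> n s \<tau> = {j \<in> {n..s}. \<tau> j = \<delta>}"

definition zero_from :: "nat \<Rightarrow> nat \<Rightarrow> (nat \<Rightarrow> real) \<Rightarrow> nat \<Rightarrow> real" where
  "zero_from n s x = (\<lambda>j. if n \<le> j \<and> j \<le> s then 0 else x j)"

text \<open>A term of the expansion in the variables \<open>n\<close> to \<open>s\<close>: these are
  set to 0 or replaced by integration variables, while the variables below \<open>n\<close> still
  have their values from \<open>x\<close>.\<close>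

definition taylor_term :: "nat \<Rightarrow> nat \<Rightarrow> ((nat \<Rightarrow> real) \<Rightarrow> real) \<Rightarrow> nat \<Rightarrow> (nat \<Rightarrow> nat) \<Rightarrow> (nat \<Rightarrow> real) \<Rightarrow> real" where
  "taylor_term \<delta> s f n \<tau> x =
    (\<Prod>j\<in>{n..s} - top_set \<delta> n s \<tau>. taylor_kernel (Suc (\<tau> j)) (x j) 0) *
    (LINT t|lebesgue_on_coords (top_set \<delta> n s \<tau>). (\<Prod>j\<in>top_set \<delta> n s \<tau>. taylor_kernel \<delta> (x j) (t j)) *
       iter_pderiv (deriv_list n s \<tau>) f (override_on (zero_from n s x) t (top_set \<delta> n s \<tau>)))"

lemma zero_from_cube: "x \<in> cube {1..s} \<Longrightarrow> 1 \<le> n \<Longrightarrow> zero_from n s x \<in> cube {1..s}"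
  by (auto simp: zero_from_def cube_def PiE_iff extensional_def)

text \<open>Taylor's formula in variable \<open>n\<close> is applied inside the integral. Orders
  \<open>i < \<delta>\<close> give boundary terms with \<open>n\<close> set to 0; order
  \<open>\<delta>\<close> gives the remainder, which makes \<open>n\<close> an integration
  variable.\<close>

lemma taylor_term_step:
  assumes f: "cont_mixed_pderivs \<delta> s f" and \<delta>: "\<delta> \<ge> 1" and n: "1 \<le> n" "n \<le> s"
    and x: "x \<in> cube {1..s}" and \<tau>: "\<tau> \<in> (\<Pi>\<^sub>E j\<in>{Suc n..s}. {0..\<delta>})"
  shows "taylor_term \<delta> s f (Suc n) \<tau> x = (\<Sum>i\<in>{0..\<delta>}. taylor_term \<delta> s f n (\<tau>(n := i)) x)"
proof -
  define U where "U = top_set \<delta> (Suc n) s \<tau>"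
  have U_sub: "U \<subseteq> {Suc n..s}" and nU: "n \<notin> U" and finU: "finite U"
    by (auto simp: U_def top_set_def)
  have ins: "{n..s} = insert n {Suc n..s}" using n by auto
  define A where "A = (\<Prod>j\<in>{Suc n..s} - U. taylor_kernel (Suc (\<tau> j)) (x j) 0)"
  define P where "P t = (\<Prod>j\<in>U. taylor_kernel \<delta> (x j) (t j))" for t
  define G where "G i = iter_pderiv (deriv_list n s (\<tau>(n := i))) f" for i
  define G0 where "G0 = iter_pderiv (deriv_list (Suc n) s \<tau>) f"
  define c where "c = zero_from (Suc n) s x"
  define c' where "c' = zero_from n s x"
  have c: "c \<in> cube {1..s}" "c' \<in> cube {1..s}"
    unfolding c_def c'_def by (rule zero_from_cube[OF x]; use n in simp)+
  have \<tau>_le: "\<And>j. Suc n \<le> j \<Longrightarrow> j \<le> s \<Longrightarrow> \<tau> j \<le> \<delta>" using \<tau> by (auto simp: PiE_iff)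
  have contG: "continuous_on (cube {1..s}) (G i)" if "i \<le> \<delta>" for i
    unfolding G_def by (rule continuous_iter_pderiv[OF f n(1)]) (use that \<tau>_le in auto)
  have contG0: "continuous_on (cube {1..s}) G0"
    unfolding G0_def by (rule continuous_iter_pderiv[OF f]) (use \<tau>_le in auto)
  have U1: "U \<subseteq> {1..s}" "insert n U \<subseteq> {1..s}" using U_sub n by auto
  define F where "F t = (\<Prod>j\<in>insert n U. taylor_kernel \<delta> (x j) (t j)) * G \<delta> (override_on c' t (insert n U))" for t
  have intF: "integrable (lebesgue_on_coords (insert n U)) F"
    unfolding F_def by (rule integrable_kernel_continuous[OF _ U1(2) contG x c(2)]) auto
  have int0: "integrable (lebesgue_on_coords U) (\<lambda>t. P t * G0 (override_on c t U))"
    unfolding P_def by (rule integrable_kernel_continuous[OF _ U1(1) contG0 x c(1)]) auto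
  have intG: "integrable (lebesgue_on_coords U) (\<lambda>t. P t * G i (override_on c' t U))" if "i \<le> \<delta>" for i
    unfolding P_def by (rule integrable_kernel_continuous[OF _ U1(1) contG[OF that] x c(2)]) auto
  have ov0: "(override_on c t U)(n := 0) = override_on c' t U" for t
    using nU n by (auto simp: override_on_def c_def c'_def zero_from_def fun_eq_iff)
  have ovz: "override_on c' (t(n := z)) (insert n U) = (override_on c t U)(n := z)" for t z
    using nU n by (auto simp: override_on_def c_def c'_def zero_from_def fun_eq_iff)
  have ovn: "override_on c t U n = x n" for t
    using nU by (simp add: override_on_def c_def zero_from_def)
  have FP: "F (t(n := z)) = P t * (taylor_kernel \<delta> (x n) z * G \<delta> ((override_on c t U)(n := z)))" for t z
  proof -
    have "(\<Prod>j\<in>U. taylor_kernel \<delta> (x j) ((t(n := z)) j)) = P t"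
      unfolding P_def using nU by (intro prod.cong) auto
    then show ?thesis unfolding F_def ovz using nU finU by (simp add: mult_ac)
  qed
  \<comment> \<open>Where \<open>P t = 0\<close> both sides vanish. This case must be separated,
    because \<open>t\<close> may then lie outside the cube, where the derivatives mean
    nothing.\<close>
  have point: "P t * G0 (override_on c t U) =
      (\<Sum>i<\<delta>. taylor_kernel (Suc i) (x n) 0 * (P t * G i (override_on c' t U))) + (LBINT z. F (t(n := z)))" for t
  proof (cases "P t = 0")
    case True
    then show ?thesis by (simp add: FP)
  next
    case False
    then have "taylor_kernel \<delta> (x j) (t j) \<noteq> 0" if "j \<in> U" for j
      using finU that by (auto simp: P_def)
    then have "t j \<in> {0..x j}" if "j \<in> U" for j
      using that by (force simp: taylor_kernel_def split: if_splits)
    then have t: "t j \<in> {0..<1}" if "j \<in> U" for j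
      using that x U1 by (force simp: cube_def PiE_iff)
    have y: "override_on c t U \<in> cube {1..s}"
      using t c(1) U1 by (auto simp: override_on_def cube_def PiE_iff extensional_def)
    have "G0 (override_on c t U) = (\<Sum>i<\<delta>. taylor_kernel (Suc i) (x n) 0 * G i (override_on c' t U))
        + (LBINT z. taylor_kernel \<delta> (x n) z * G \<delta> ((override_on c t U)(n := z)))"
      using taylor_one_variable[OF f \<delta> n \<tau>_le y] unfolding G_def G0_def ovn ov0 by simp
    then show ?thesis by (simp add: FP distrib_left sum_distrib_left mult_ac)
  qed
  have intS: "integrable (lebesgue_on_coords U) (\<lambda>t. \<Sum>i<\<delta>. taylor_kernel (Suc i) (x n) 0 * (P t * G i (override_on c' t U)))"
    using intG by (intro Bochner_Integration.integrable_sum integrable_mult_right) auto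
  have "(LINT t|lebesgue_on_coords (insert n U). F t) = (LINT t|lebesgue_on_coords U. (LBINT z. F (t(n := z))))"
    by (rule lborel_PiM.product_integral_insert[OF finU nU intF])
  also have "\<dots> = (LINT t|lebesgue_on_coords U. P t * G0 (override_on c t U) -
      (\<Sum>i<\<delta>. taylor_kernel (Suc i) (x n) 0 * (P t * G i (override_on c' t U))))"
    by (simp only: point add_diff_cancel_left')
  also have "\<dots> = (LINT t|lebesgue_on_coords U. P t * G0 (override_on c t U)) -
      (LINT t|lebesgue_on_coords U. (\<Sum>i<\<delta>. taylor_kernel (Suc i) (x n) 0 * (P t * G i (override_on c' t U))))"
    by (rule Bochner_Integration.integral_diff[OF int0 intS])
  also have "(LINT t|lebesgue_on_coords U. (\<Sum>i<\<delta>. taylor_kernel (Suc i) (x n) 0 * (P t * G i (override_on c' t U)))) =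
      (\<Sum>i<\<delta>. taylor_kernel (Suc i) (x n) 0 * (LINT t|lebesgue_on_coords U. P t * G i (override_on c' t U)))"
    using intG by (subst Bochner_Integration.integral_sum) auto
  finally have split: "(LINT t|lebesgue_on_coords U. P t * G0 (override_on c t U)) =
      (\<Sum>i<\<delta>. taylor_kernel (Suc i) (x n) 0 * (LINT t|lebesgue_on_coords U. P t * G i (override_on c' t U)))
      + (LINT t|lebesgue_on_coords (insert n U). F t)" by simp
  have low: "taylor_term \<delta> s f n (\<tau>(n := i)) x =
      A * (taylor_kernel (Suc i) (x n) 0 * (LINT t|lebesgue_on_coords U. P t * G i (override_on c' t U)))" if "i < \<delta>" for i
  proof -
    have top: "top_set \<delta> n s (\<tau>(n := i)) = U"
      unfolding U_def top_set_def ins using that by auto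
    have "{n..s} - U = insert n ({Suc n..s} - U)" using ins nU by auto
    then have "(\<Prod>j\<in>{n..s} - U. taylor_kernel (Suc ((\<tau>(n := i)) j)) (x j) 0) =
      taylor_kernel (Suc i) (x n) 0 * (\<Prod>j\<in>{Suc n..s} - U. taylor_kernel (Suc ((\<tau>(n := i)) j)) (x j) 0)"
      by simp
    also have "(\<Prod>j\<in>{Suc n..s} - U. taylor_kernel (Suc ((\<tau>(n := i)) j)) (x j) 0) = A"
      unfolding A_def by (intro prod.cong) auto
    finally show ?thesis unfolding taylor_term_def top by (simp add: P_def G_def c'_def mult_ac)
  qed
  have high: "taylor_term \<delta> s f n (\<tau>(n := \<delta>)) x = A * (LINT t|lebesgue_on_coords (insert n U). F t)"
  proof -
    have top: "top_set \<delta> n s (\<tau>(n := \<delta>)) = insert n U"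
      unfolding U_def top_set_def ins by auto
    have "{n..s} - insert n U = {Suc n..s} - U" using ins nU by auto
    then have "(\<Prod>j\<in>{n..s} - insert n U. taylor_kernel (Suc ((\<tau>(n := \<delta>)) j)) (x j) 0) = A"
      unfolding A_def by (intro prod.cong) auto
    then show ?thesis unfolding taylor_term_def top F_def G_def c'_def by simp
  qed
  have set: "{0..\<delta>} = insert \<delta> {..<\<delta>}" by auto
  have "taylor_term \<delta> s f (Suc n) \<tau> x = A * (LINT t|lebesgue_on_coords U. P t * G0 (override_on c t U))"
    by (simp add: taylor_term_def A_def U_def P_def G0_def c_def)
  also have "\<dots> = (\<Sum>i\<in>{0..\<delta>}. taylor_term \<delta> s f n (\<tau>(n := i)) x)"
    unfolding split set by (simp add: low high distrib_left sum_distrib_left)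
  finally show ?thesis .
qed

lemma taylor_expansion_aux:
  assumes f: "cont_mixed_pderivs \<delta> s f" and \<delta>: "\<delta> \<ge> 1" and n: "1 \<le> n" "n \<le> Suc s" and x: "x \<in> cube {1..s}"
  shows "f x = (\<Sum>\<tau>\<in>(\<Pi>\<^sub>E j\<in>{n..s}. {0..\<delta>}). taylor_term \<delta> s f n \<tau> x)"
  using n(2,1)
proof (induction n rule: inc_induct)
  case base
  \<comment> \<open>With no variable expanded the only term is \<open>f x\<close>, integrated over a
    single point of mass 1.\<close>
  have "measure (lebesgue_on_coords {}) (space (lebesgue_on_coords {})) = 1"
    by (simp add: PiM_empty)
  moreover have "zero_from (Suc s) s x = x" by (auto simp: zero_from_def)
  ultimately show ?case
    by (simp add: taylor_term_def top_set_def deriv_list_def iter_pderiv_def)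
next
  case (step n)
  have "f x = (\<Sum>\<tau>\<in>(\<Pi>\<^sub>E j\<in>{Suc n..s}. {0..\<delta>}). taylor_term \<delta> s f (Suc n) \<tau> x)"
    using step by simp
  also have "\<dots> = (\<Sum>\<tau>\<in>(\<Pi>\<^sub>E j\<in>{Suc n..s}. {0..\<delta>}). \<Sum>i\<in>{0..\<delta>}. taylor_term \<delta> s f n (\<tau>(n := i)) x)"
    using step by (intro sum.cong taylor_term_step[OF f \<delta> _ _ x]) auto
  also have "\<dots> = (\<Sum>\<tau>\<in>(\<Pi>\<^sub>E j\<in>insert n {Suc n..s}. {0..\<delta>}). taylor_term \<delta> s f n \<tau> x)"
    by (rule sum_PiE_insert[symmetric]) simp
  also have "insert n {Suc n..s} = {n..s}" using step by auto
  finally show ?case .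
qed

lemma taylor_expansion:
  assumes f: "cont_mixed_pderivs \<delta> s f" and \<delta>: "\<delta> \<ge> 1" and x: "x \<in> cube {1..s}"
  shows "f x = (\<Sum>\<tau>\<in>(\<Pi>\<^sub>E j\<in>{1..s}. {0..\<delta>}).
    (\<Prod>j\<in>{1..s} - {j\<in>{1..s}. \<tau> j = \<delta>}. taylor_kernel (Suc (\<tau> j)) (x j) 0) *
    (LINT t|lebesgue_on_coords {j\<in>{1..s}. \<tau> j = \<delta>}. (\<Prod>j\<in>{j\<in>{1..s}. \<tau> j = \<delta>}. taylor_kernel \<delta> (x j) (t j)) *
       mixed_pderiv s \<tau> f (merge {j\<in>{1..s}. \<tau> j = \<delta>} ({1..s} - {j\<in>{1..s}. \<tau> j = \<delta>}) (t, \<lambda>_. 0))))"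
proof -
  \<comment> \<open>The two functions also agree outside \<open>{1..s}\<close>: a point of the cube
    is \<open>undefined\<close> there, as is \<open>merge\<close>.\<close>
  have ov: "override_on (zero_from 1 s x) t {j\<in>{1..s}. \<tau> j = \<delta>} = merge {j\<in>{1..s}. \<tau> j = \<delta>} ({1..s} - {j\<in>{1..s}. \<tau> j = \<delta>}) (t, \<lambda>_. 0)" for t \<tau>
    using x by (auto simp: override_on_def zero_from_def merge_def fun_eq_iff cube_def PiE_iff extensional_def)
  have "f x = (\<Sum>\<tau>\<in>(\<Pi>\<^sub>E j\<in>{1..s}. {0..\<delta>}). taylor_term \<delta> s f 1 \<tau> x)"
    by (rule taylor_expansion_aux[OF f \<delta> _ _ x]) auto
  then show ?thesis
    unfolding taylor_term_def top_set_def mixed_pderiv_eq ov .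
qed


section \<open>The bound for the Walsh coefficients\<close>

text \<open>The integrable factor on the double space that makes Fubini's theorem applicable in
  \<open>taylor_term_integral\<close>; the kernels and Walsh functions multiply it by bounded
  amounts.\<close>

lemma integrable_indicator_times:
  assumes S: "finite S" and u: "finite u" and g: "integrable (lebesgue_on_coords u) (g :: _ \<Rightarrow> real)"
  shows "integrable (lebesgue_on_coords S \<Otimes>\<^sub>M lebesgue_on_coords u) (\<lambda>z. indicator (cube S) (fst z) * g (snd z))"
proof -
  interpret I: sigma_finite_measure "lebesgue_on_coords S" by (rule sigma_finite_PiM_lborel) fact
  interpret J: sigma_finite_measure "lebesgue_on_coords u" by (rule sigma_finite_PiM_lborel) fact
  interpret P: pair_sigma_finite "lebesgue_on_coords S" "lebesgue_on_coords u" ..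
  have [measurable]: "g \<in> borel_measurable (lebesgue_on_coords u)" using g by auto
  have cS [measurable]: "cube S \<in> sets (lebesgue_on_coords S)" unfolding cube_def by (rule box_measurable[OF S]) auto
  have fin: "emeasure (lebesgue_on_coords S) (cube S) < \<infinity>"
    unfolding cube_def by (subst lborel_PiM.emeasure_PiM[OF S]) auto
  show ?thesis
  proof (rule P.Fubini_integrable)
    show "integrable (lebesgue_on_coords S) (\<lambda>x. LINT y|lebesgue_on_coords u. norm (indicator (cube S) (fst (x, y)) * g (snd (x, y))))"
      using fin by (simp add: abs_mult integrable_real_indicator)
    show "AE x in lebesgue_on_coords S. integrable (lebesgue_on_coords u) (\<lambda>y. indicator (cube S) (fst (x, y)) * g (snd (x, y)))"
      using g by (intro AE_I2) auto
  qed measurable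
qed

text \<open>After exchanging the integrals, the integral over \<open>x\<close> for fixed
  \<open>t\<close> is a product of one-dimensional ones. By \<open>iterint_eq_kernel\<close> each is
  an antiderivative of \<open>w j\<close>, taken at \<open>t j\<close> for \<open>j\<close> in
  \<open>u\<close> and at 0 otherwise.\<close>

lemma taylor_term_integral:
  fixes w :: "nat \<Rightarrow> real \<Rightarrow> complex" and m :: "nat \<Rightarrow> nat"
  assumes S: "finite S" and u: "u \<subseteq> S" and \<delta>: "\<delta> \<ge> 1" and m: "\<And>j. m j \<ge> 1"
    and w: "\<And>j. w j \<in> borel_measurable borel" and w1: "\<And>j x. norm (w j x) \<le> 1"
    and w0: "\<And>j x. x \<notin> {0..<1} \<Longrightarrow> w j x = 0"
    and g: "set_integrable (lebesgue_on_coords u) (cube u) g"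
  defines "R \<equiv> \<lambda>x. (\<Prod>j\<in>S - u. taylor_kernel (m j) (x j) 0) *
      (LINT t|lebesgue_on_coords u. (\<Prod>j\<in>u. taylor_kernel \<delta> (x j) (t j)) * g t)"
  shows "set_integrable (lebesgue_on_coords S) (cube S) (\<lambda>x. complex_of_real (R x) * (\<Prod>j\<in>S. w j (x j)))"
    and "(LINT x:cube S|lebesgue_on_coords S. complex_of_real (R x) * (\<Prod>j\<in>S. w j (x j))) =
      (\<Prod>j\<in>S - u. iterint (w j) (m j) 0) *
      (LINT t:cube u|lebesgue_on_coords u. complex_of_real (g t) * (\<Prod>j\<in>u. iterint (w j) \<delta> (t j)))"
proof -
  have finu: "finite u" using S u finite_subset by auto
  interpret I: sigma_finite_measure "lebesgue_on_coords S" by (rule sigma_finite_PiM_lborel) fact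
  interpret J: sigma_finite_measure "lebesgue_on_coords u" by (rule sigma_finite_PiM_lborel) fact
  interpret P: pair_sigma_finite "lebesgue_on_coords S" "lebesgue_on_coords u" ..
  let ?MS = "lebesgue_on_coords S" and ?Mu = "lebesgue_on_coords u"
  define g' where "g' t = indicator (cube u) t * g t" for t
  have g': "integrable ?Mu g'" using g by (simp add: g'_def[abs_def] set_integrable_def)
  define \<kappa> where "\<kappa> t j x = (if j \<in> u then taylor_kernel \<delta> x (t j) else taylor_kernel (m j) x 0)" for t j x
  define \<psi> where "\<psi> z = (\<Prod>j\<in>S. w j (fst z j)) * complex_of_real (\<Prod>j\<in>S. \<kappa> (snd z) j (fst z j))" for z
  define \<Phi> where "\<Phi> z = complex_of_real (indicator (cube S) (fst z) * g' (snd z)) * \<psi> z" for z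
  have \<psi>m: "\<psi> \<in> borel_measurable (?MS \<Otimes>\<^sub>M ?Mu)"
  proof -
    have 1: "(\<lambda>z. w j (fst z j)) \<in> borel_measurable (?MS \<Otimes>\<^sub>M ?Mu)" if j: "j \<in> S" for j
      using w[of j] j by measurable
    have 2: "(\<lambda>z. \<kappa> (snd z) j (fst z j)) \<in> borel_measurable (?MS \<Otimes>\<^sub>M ?Mu)" if j: "j \<in> S" for j
    proof -
      have f: "(\<lambda>z. fst z j) \<in> borel_measurable (?MS \<Otimes>\<^sub>M ?Mu)" using j by measurable
      show ?thesis
      proof (cases "j \<in> u")
        case True
        then have "(\<lambda>z. snd z j) \<in> borel_measurable (?MS \<Otimes>\<^sub>M ?Mu)" by measurable
        with f show ?thesis unfolding \<kappa>_def if_P[OF True] by (rule taylor_kernel_measurable)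
      next
        case False
        show ?thesis unfolding \<kappa>_def if_not_P[OF False] by (rule taylor_kernel_measurable[OF f]) simp
      qed
    qed
    have "(\<lambda>z. \<Prod>j\<in>S. \<kappa> (snd z) j (fst z j)) \<in> borel_measurable (?MS \<Otimes>\<^sub>M ?Mu)"
      by (intro borel_measurable_prod 2)
    then have "(\<lambda>z. complex_of_real (\<Prod>j\<in>S. \<kappa> (snd z) j (fst z j))) \<in> borel_measurable (?MS \<Otimes>\<^sub>M ?Mu)"
      by (rule measurable_compose) (rule borel_measurable_continuous_onI, intro continuous_intros)
    then show ?thesis unfolding \<psi>_def[abs_def]
      by (intro borel_measurable_times borel_measurable_prod 1)
  qed
  have \<Phi>: "integrable (?MS \<Otimes>\<^sub>M ?Mu) \<Phi>"
    unfolding \<Phi>_def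
  proof (rule integrable_bounded_mult[OF _ \<psi>m, where B = 1])
    show "integrable (?MS \<Otimes>\<^sub>M ?Mu) (\<lambda>z. complex_of_real (indicator (cube S) (fst z) * g' (snd z)))"
      by (rule integrable_of_real, rule integrable_indicator_times[OF S finu g'])
    fix z assume "complex_of_real (indicator (cube S) (fst z) * g' (snd z)) \<noteq> 0"
    then have z: "fst z \<in> cube S" by (auto simp: indicator_def split: if_splits)
    have "norm (\<psi> z) = (\<Prod>j\<in>S. norm (w j (fst z j)) * \<bar>\<kappa> (snd z) j (fst z j)\<bar>)"
      by (simp add: \<psi>_def norm_mult prod.distrib abs_prod flip: prod_norm of_real_prod)
    also have "\<dots> \<le> (\<Prod>j\<in>S. 1 * 1)"
    proof (intro prod_mono conjI mult_mono w1)
      fix j assume "j \<in> S"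
      then have "fst z j < 1" using z by (auto simp: cube_def PiE_iff)
      then show "\<bar>\<kappa> (snd z) j (fst z j)\<bar> \<le> 1" by (auto simp: \<kappa>_def intro!: abs_taylor_kernel_le_1)
    qed auto
    finally show "norm (\<psi> z) \<le> 1" by simp
  qed
  have \<Phi>': "integrable (?MS \<Otimes>\<^sub>M ?Mu) (case_prod (\<lambda>x t. \<Phi> (x, t)))" using \<Phi> by simp
  have \<kappa>_split: "(\<Prod>j\<in>S. \<kappa> t j (x j)) = (\<Prod>j\<in>S - u. taylor_kernel (m j) (x j) 0) * (\<Prod>j\<in>u. taylor_kernel \<delta> (x j) (t j))" for t x
    unfolding prod.subset_diff[OF u S, of "\<lambda>j. \<kappa> t j (x j)"] by (simp add: \<kappa>_def)
  have inner_t: "(LINT t|?Mu. \<Phi> (x, t)) = indicator (cube S) x *\<^sub>R (complex_of_real (R x) * (\<Prod>j\<in>S. w j (x j)))"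
    for x
  proof (cases "x \<in> cube S")
    case True
    have "(LINT t|?Mu. \<Phi> (x, t)) = (LINT t|?Mu. complex_of_real ((\<Prod>j\<in>S - u. taylor_kernel (m j) (x j) 0) *
        ((\<Prod>j\<in>u. taylor_kernel \<delta> (x j) (t j)) * g t)) * (\<Prod>j\<in>S. w j (x j)))"
    proof (rule Bochner_Integration.integral_cong[OF refl])
      fix t assume t: "t \<in> space ?Mu"
      \<comment> \<open>Cutting \<open>g\<close> off at the cube is harmless: if \<open>t\<close>
        leaves the cube in coordinate \<open>j\<close>, then \<open>x j < 1\<close> makes the kernel
        vanish.\<close>
      have "(\<Prod>j\<in>u. taylor_kernel \<delta> (x j) (t j)) * g' t = (\<Prod>j\<in>u. taylor_kernel \<delta> (x j) (t j)) * g t"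
      proof (cases "t \<in> cube u")
        case False
        then have "\<not> (\<forall>j\<in>u. t j \<in> {0..<1})" using t unfolding cube_def space_PiM PiE_iff by blast
        then obtain j where j: "j \<in> u" "t j \<notin> {0..<1}" by blast
        have "x j < 1" using True j u by (auto simp: cube_def PiE_iff)
        with j have "(\<Prod>j\<in>u. taylor_kernel \<delta> (x j) (t j)) = 0"
          using finu by (intro prod_zero) (auto simp: taylor_kernel_def intro!: bexI[of _ j])
        then show ?thesis by simp
      qed (simp add: g'_def)
      then show "\<Phi> (x, t) = complex_of_real ((\<Prod>j\<in>S - u. taylor_kernel (m j) (x j) 0) *
        ((\<Prod>j\<in>u. taylor_kernel \<delta> (x j) (t j)) * g t)) * (\<Prod>j\<in>S. w j (x j))"
        unfolding \<Phi>_def \<psi>_def \<kappa>_split fst_conv snd_conv using True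
        by (auto simp: mult_ac simp flip: of_real_mult of_real_prod)
    qed
    also have "\<dots> = complex_of_real (R x) * (\<Prod>j\<in>S. w j (x j))"
      unfolding R_def integral_mult_left_zero integral_complex_of_real integral_mult_right_zero ..
    finally show ?thesis using True by simp
  qed (simp add: \<Phi>_def)
  show "set_integrable ?MS (cube S) (\<lambda>x. complex_of_real (R x) * (\<Prod>j\<in>S. w j (x j)))"
    using P.integrable_fst[OF \<Phi>'] unfolding inner_t set_integrable_def .
  have inner_x: "(LINT x|?MS. \<Phi> (x, t)) = (\<Prod>j\<in>S - u. iterint (w j) (m j) 0) *
      (indicator (cube u) t *\<^sub>R (complex_of_real (g t) * (\<Prod>j\<in>u. iterint (w j) \<delta> (t j))))" for t
  proof (cases "t \<in> cube u")
    case True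
    have "(LINT x|?MS. \<Phi> (x, t)) = (LINT x|?MS. complex_of_real (g t) * (\<Prod>j\<in>S. complex_of_real (\<kappa> t j (x j)) * w j (x j)))"
    proof (rule Bochner_Integration.integral_cong[OF refl])
      fix x assume x: "x \<in> space ?MS"
      have "complex_of_real (indicator (cube S) x) * (\<Prod>j\<in>S. w j (x j)) = (\<Prod>j\<in>S. w j (x j))"
      proof (cases "x \<in> cube S")
        case False
        then have "\<not> (\<forall>j\<in>S. x j \<in> {0..<1})" using x unfolding cube_def space_PiM PiE_iff by blast
        then have "(\<Prod>j\<in>S. w j (x j)) = 0" using S w0 by (intro prod_zero) auto
        then show ?thesis by simp
      qed simp
      then show "\<Phi> (x, t) = complex_of_real (g t) * (\<Prod>j\<in>S. complex_of_real (\<kappa> t j (x j)) * w j (x j))"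
        unfolding \<Phi>_def \<psi>_def using True by (auto simp: g'_def prod.distrib mult_ac)
    qed
    also have "\<dots> = complex_of_real (g t) * (LINT x|?MS. (\<Prod>j\<in>S. complex_of_real (\<kappa> t j (x j)) * w j (x j)))"
      by (rule integral_mult_right_zero)
    also have "(LINT x|?MS. (\<Prod>j\<in>S. complex_of_real (\<kappa> t j (x j)) * w j (x j))) = (\<Prod>j\<in>S. LBINT x. complex_of_real (\<kappa> t j x) * w j x)"
    proof (rule lborel_PiM.product_integral_prod[OF S])
      fix j assume "j \<in> S"
      show "integrable lborel (\<lambda>x. complex_of_real (\<kappa> t j x) * w j x)"
      proof (rule integrableI_bounded_set[where A = "{0..<1}" and B = 1])
        have "\<kappa> t j \<in> borel_measurable borel"
          unfolding \<kappa>_def[abs_def] by (cases "j \<in> u") (simp_all add: taylor_kernel_measurable)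
        then show "(\<lambda>x. complex_of_real (\<kappa> t j x) * w j x) \<in> borel_measurable lborel"
          using w[of j] by measurable
        have "norm (complex_of_real (\<kappa> t j x) * w j x) \<le> 1 * 1" if "x \<in> {0..<1}" for x
          unfolding norm_mult using that w1 by (intro mult_mono) (auto simp: \<kappa>_def intro!: abs_taylor_kernel_le_1)
        then show "AE x in lborel. x \<in> {0..<1} \<longrightarrow> norm (complex_of_real (\<kappa> t j x) * w j x) \<le> 1"
          by (intro AE_I2) simp
        show "AE x in lborel. x \<notin> {0..<1} \<longrightarrow> complex_of_real (\<kappa> t j x) * w j x = 0"
          using w0 by (intro AE_I2) simp
      qed auto
    qed
    also have "\<dots> = (\<Prod>j\<in>S - u. LBINT x. complex_of_real (\<kappa> t j x) * w j x) * (\<Prod>j\<in>u. LBINT x. complex_of_real (\<kappa> t j x) * w j x)"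
      by (rule prod.subset_diff[OF u S])
    also have "(\<Prod>j\<in>S - u. LBINT x. complex_of_real (\<kappa> t j x) * w j x) = (\<Prod>j\<in>S - u. iterint (w j) (m j) 0)"
      using iterint_eq_kernel[OF w w1 w0 m, of 0] by (intro prod.cong) (auto simp: \<kappa>_def)
    also have "(\<Prod>j\<in>u. LBINT x. complex_of_real (\<kappa> t j x) * w j x) = (\<Prod>j\<in>u. iterint (w j) \<delta> (t j))"
    proof (rule prod.cong[OF refl])
      fix j assume j: "j \<in> u"
      then have "0 \<le> t j" using True by (auto simp: cube_def PiE_iff)
      from iterint_eq_kernel[OF w w1 w0 \<delta> this] show "(LBINT x. complex_of_real (\<kappa> t j x) * w j x) = iterint (w j) \<delta> (t j)"
        using j by (simp add: \<kappa>_def)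
    qed
    finally show ?thesis using True by (simp add: mult_ac)
  qed (simp add: \<Phi>_def g'_def)
  have "(LINT x:cube S|?MS. complex_of_real (R x) * (\<Prod>j\<in>S. w j (x j))) = (LINT x|?MS. LINT t|?Mu. \<Phi> (x, t))"
    by (simp only: set_lebesgue_integral_def inner_t)
  also have "\<dots> = (LINT t|?Mu. LINT x|?MS. \<Phi> (x, t))"
    by (rule P.Fubini_integral[OF \<Phi>', symmetric])
  also have "\<dots> = (\<Prod>j\<in>S - u. iterint (w j) (m j) 0) *
      (LINT t:cube u|?Mu. complex_of_real (g t) * (\<Prod>j\<in>u. iterint (w j) \<delta> (t j)))"
    unfolding inner_x set_lebesgue_integral_def by (rule integral_mult_right_zero)
  finally show "(LINT x:cube S|?MS. complex_of_real (R x) * (\<Prod>j\<in>S. w j (x j))) =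
      (\<Prod>j\<in>S - u. iterint (w j) (m j) 0) *
      (LINT t:cube u|?Mu. complex_of_real (g t) * (\<Prod>j\<in>u. iterint (w j) \<delta> (t j)))" .
qed


section \<open>Antiderivatives of Walsh functions and the digit weight\<close>

context walsh_setting
begin

abbreviation positions :: "nat \<Rightarrow> nat list" where
  "positions k \<equiv> digit_positions q k"

text \<open>A level is a position less one, so each factor is \<open>q\<close> times the power of
  \<open>q\<close> in the digit weight; these surplus factors end up in the constant.\<close>

lemma prod_levels_eq:
  assumes "n \<le> length (positions k)"
  shows "(\<Prod>i<n. 1 / real q ^ (positions k ! i - 1)) = real q ^ n * real q powr (- real (sum_list (take n (positions k))))"
proof -
  have q0: "real q > 0" using q by simp
  have "(\<Prod>i<n. 1 / real q ^ (positions k ! i - 1)) = (\<Prod>i<n. real q * real q powr (- real (positions k ! i)))"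
  proof (rule prod.cong[OF refl])
    fix i assume "i \<in> {..<n}"
    then have "1 \<le> positions k ! i" using assms digit_positions_props(1)[of i k] by auto
    then obtain a where "positions k ! i = Suc a" by (cases "positions k ! i") auto
    then show "1 / real q ^ (positions k ! i - 1) = real q * real q powr (- real (positions k ! i))"
      using q0 by (simp add: powr_minus powr_realpow field_simps del: of_nat_Suc)
  qed
  also have "\<dots> = real q ^ n * real q powr (\<Sum>i<n. - real (positions k ! i))"
    using q0 by (simp add: prod.distrib powr_sum)
  also have "(\<Sum>i<n. - real (positions k ! i)) = - real (sum_list (take n (positions k)))"
    using assms by (simp add: sum_list_sum_nth sum_negf atLeast0LessThan min_absorb2)
  finally show ?thesis .
qed

text \<open>With at most \<open>\<delta>\<close> nonzero digits the weight adds all positions, and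
  they are exhausted after as many integrations as there are digits. The exponent
  \<open>Suc \<delta>\<close> leaves room for the case of more digits in
  \<open>iterint_cells\<close>.\<close>

lemma norm_iterint_le_weight:
  assumes v: "length (positions k) \<le> \<delta>" and m: "length (positions k) \<le> m" and x: "x \<in> {0..<1}"
  shows "norm (iterint (W k) m x) \<le> real q ^ Suc \<delta> * real q powr (- mu1 q \<delta> lam k)"
proof -
  interpret walsh_structure q "length (positions k)" "W k" "\<lambda>i. positions k ! i - 1"
    by (rule walsh_structure)
  let ?c = "\<Prod>i<length (positions k). 1 / real q ^ (positions k ! i - 1)"
  have "norm (iterint (W k) m x) \<le> ?c"
    by (rule norm_iterint_mono[OF norm_iterint_le _ m x]) (auto intro!: prod_nonneg)
  also have "?c = real q ^ length (positions k) * real q powr (- mu1 q \<delta> lam k)"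
    using v by (subst prod_levels_eq) (auto simp: mu1_def Let_def)
  also have "\<dots> \<le> real q ^ Suc \<delta> * real q powr (- mu1 q \<delta> lam k)"
    using v q by (intro mult_right_mono power_increasing) auto
  finally show ?thesis .
qed

text \<open>A boundary value of order \<open>m\<close> vanishes if there are at least
  \<open>m\<close> nonzero digits; otherwise there are fewer than \<open>\<delta>\<close>, and the
  full decay is available.\<close>

lemma norm_iterint_0_le_weight:
  assumes m: "1 \<le> m" "m \<le> \<delta>"
  shows "norm (iterint (W k) m 0) \<le> real q ^ Suc \<delta> * real q powr (- mu1 q \<delta> lam k)"
proof (cases "m \<le> length (positions k)")
  case True
  interpret walsh_structure q "length (positions k)" "W k" "\<lambda>i. positions k ! i - 1"
    by (rule walsh_structure)
  show ?thesis using iterint_0_eq_0[OF m(1) True] by simp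
next
  case False
  then show ?thesis using m by (intro norm_iterint_le_weight) auto
qed

text \<open>If \<open>k\<close> has at most \<open>\<delta>\<close> nonzero digits, the only cell is \<open>[0,1)\<close>, and the mean need not vanish;
  otherwise the cells sit at the level of the nonzero digit number \<open>\<delta> + 1\<close>.\<close>

lemma iterint_cells:
  assumes lam: "0 < lam" "lam \<le> 1"
  obtains B and M :: nat where "M > 0" "\<And>x. x \<in> {0..<1} \<Longrightarrow> norm (iterint (W k) \<delta> x) \<le> B"
    "M = 1 \<or> (\<forall>n<M. (LBINT x:{real n / M..<real n / M + 1 / M}. iterint (W k) \<delta> x) = 0)"
    "B * (1 / M) powr lam \<le> real q ^ Suc \<delta> * real q powr (- mu1 q \<delta> lam k)"
proof (cases "length (positions k) \<le> \<delta>")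
  case True
  show ?thesis
    by (rule that[of 1 "real q ^ Suc \<delta> * real q powr (- mu1 q \<delta> lam k)"])
      (use norm_iterint_le_weight[OF True True] in auto)
next
  case False
  interpret walsh_structure q "length (positions k)" "W k" "\<lambda>i. positions k ! i - 1"
    by (rule walsh_structure)
  have q0: "real q > 0" using q by simp
  let ?a = "positions k ! \<delta>"
  have a: "1 \<le> ?a" using digit_positions_props(1)[of \<delta> k] False by auto
  define B where "B = (\<Prod>i<\<delta>. 1 / real q ^ (positions k ! i - 1))"
  define M where "M = q ^ (?a - 1)"
  have B: "B = real q ^ \<delta> * real q powr (- real (sum_list (take \<delta> (positions k))))"
    unfolding B_def using False by (intro prod_levels_eq) simp
  show ?thesis
  proof (rule that)
    show "M > 0" using q by (simp add: M_def)
    show "norm (iterint (W k) \<delta> x) \<le> B" if "x \<in> {0..<1}" for x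
      unfolding B_def using norm_iterint_le[of \<delta> x] that False by simp
    show "M = 1 \<or> (\<forall>n<M. (LBINT x:{real n / M..<real n / M + 1 / M}. iterint (W k) \<delta> x) = 0)"
      using iterint_mean_0[of \<delta>] False by (auto simp: M_def add_divide_distrib)
    have "real M = real q powr (real ?a - 1)"
      using q0 a by (simp add: M_def powr_realpow[symmetric] of_nat_diff)
    then have "(1 / M) powr lam = (real q powr (- (real ?a - 1))) powr lam"
      by (simp only: powr_minus_divide)
    \<comment> \<open>The cell level is the position less one, which costs the factor
      \<open>q powr lam \<le> q\<close>, the last of the \<open>Suc \<delta>\<close>
      factors.\<close>
    also have "\<dots> = real q powr lam * real q powr (- (lam * real ?a))"
      by (simp add: powr_powr powr_add[symmetric] algebra_simps)
    also have "\<dots> \<le> real q powr 1 * real q powr (- (lam * real ?a))"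
      using lam q by (intro mult_right_mono powr_mono) auto
    finally have "B * (1 / M) powr lam \<le> B * (real q * real q powr (- (lam * real ?a)))"
      using q0 by (intro mult_left_mono) (auto simp: B)
    also have "\<dots> = real q ^ Suc \<delta> * (real q powr (- real (sum_list (take \<delta> (positions k)))) * real q powr (- (lam * real ?a)))"
      by (simp add: B mult_ac)
    also have "real q powr (- real (sum_list (take \<delta> (positions k)))) * real q powr (- (lam * real ?a))
      = real q powr (- mu1 q \<delta> lam k)"
      using False by (simp add: mu1_def Let_def powr_add[symmetric])
    finally show "B * (1 / M) powr lam \<le> real q ^ Suc \<delta> * real q powr (- mu1 q \<delta> lam k)" .
  qed
qed

end


lemma (in walsh_setting) cnj_wal_eq:
  assumes "x \<in> cube {1..s}"
  shows "cnj (wal p r \<theta> \<phi> s k x) = (\<Prod>j\<in>{1..s}. W (k j) (x j))"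
proof -
  have "cnj (wal1 p r \<theta> \<phi> (k j) (x j)) = W (k j) (x j)" if "j \<in> {1..s}" for j
    using assms that by (auto simp: W_def cube_def PiE_iff)
  then show ?thesis unfolding wal_def cnj_prod by (rule prod.cong[OF refl])
qed

text \<open>The weight is a finite number, and \<open>\<infinity>\<close> divided by it is
  \<open>\<infinity>\<close>, also for weight 0. So a finite quotient has a finite
  numerator.\<close>

lemma N_functional_finite_imp:
  assumes N: "N_functional \<delta> lam \<pp> \<qq> \<rr> \<gamma> s f < \<infinity>"
    and \<tau>: "\<tau> \<in> (\<Pi>\<^sub>E j\<in>{1..s}. {0..\<delta>})"
  shows "HK_var lam \<pp> \<qq> {j\<in>{1..s}. \<tau> j = \<delta>}
    (\<lambda>x. mixed_pderiv s \<tau> f (merge {j\<in>{1..s}. \<tau> j = \<delta>} ({1..s} - {j\<in>{1..s}. \<tau> j = \<delta>}) (x, \<lambda>_. 0))) < \<infinity>"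
proof -
  let ?HK = "\<lambda>\<tau>. HK_var lam \<pp> \<qq> {j\<in>{1..s}. \<tau> j = \<delta>}
    (\<lambda>x. mixed_pderiv s \<tau> f (merge {j\<in>{1..s}. \<tau> j = \<delta>} ({1..s} - {j\<in>{1..s}. \<tau> j = \<delta>}) (x, \<lambda>_. 0)))"
  let ?t = "\<lambda>\<tau>. epowr (?HK \<tau>) \<rr> / ennreal (\<gamma> {j\<in>{1..s}. \<tau> j > 0})"
  have "(\<Sum>\<tau>\<in>(\<Pi>\<^sub>E j\<in>{1..s}. {0..\<delta>}). ?t \<tau>) < \<infinity>"
    using N unfolding N_functional_def Let_def epowr_less_top_iff .
  moreover have "?t \<tau> \<le> (\<Sum>\<tau>\<in>(\<Pi>\<^sub>E j\<in>{1..s}. {0..\<delta>}). ?t \<tau>)"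
    using \<tau> by (intro member_le_sum finite_PiE) auto
  ultimately have "?t \<tau> < \<infinity>" by (rule order.strict_trans1[rotated])
  then have "epowr (?HK \<tau>) \<rr> < \<infinity>"
    by (auto simp: less_top[symmetric] ennreal_divide_eq_top_iff)
  then show ?thesis unfolding epowr_less_top_iff .
qed

text \<open>The constants \<open>K \<tau>\<close> are fixed before \<open>k\<close>; the dependence
  on \<open>k\<close> is confined to the factors \<open>E k j\<close>, whose product gives the digit
  weight.\<close>

lemma (in walsh_setting) walsh_coeff_bound:
  assumes \<delta>: "\<delta> \<ge> 1" and lam: "0 < lam" "lam \<le> 1" and \<pp>: "\<pp> \<ge> 1"
    and f: "cont_mixed_pderivs \<delta> s f" and N: "N_functional \<delta> lam \<pp> \<qq> \<rr> \<gamma> s f < \<infinity>"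
  shows "\<exists>C\<ge>0. \<forall>k. norm (walsh_coeff p r \<theta> \<phi> s f k) \<le> C * real q powr (- mu q \<delta> lam s k)"
proof -
  let ?S = "{1..s}" and ?T = "\<Pi>\<^sub>E j\<in>{1..s}. {0..\<delta>}"
  let ?MS = "lebesgue_on_coords {1..s}"
  define u where "u \<tau> = {j\<in>{1..s}. \<tau> j = \<delta>}" for \<tau> :: "nat \<Rightarrow> nat"
  define g where "g \<tau> t = mixed_pderiv s \<tau> f (merge (u \<tau>) (?S - u \<tau>) (t, \<lambda>_. 0))" for \<tau> t
  define R where "R \<tau> x = (\<Prod>j\<in>?S - u \<tau>. taylor_kernel (Suc (\<tau> j)) (x j) 0) *
    (LINT t|lebesgue_on_coords (u \<tau>). (\<Prod>j\<in>u \<tau>. taylor_kernel \<delta> (x j) (t j)) * g \<tau> t)" for \<tau> x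
  \<comment> \<open>One bound for the boundary values as well as for the remainder factors, so that
    every \<open>\<tau>\<close> leads to the same product over all variables.\<close>
  define E where "E k j = real q ^ Suc \<delta> * real q powr (- mu1 q \<delta> lam (k j))" for k :: "nat \<Rightarrow> nat" and j
  have E0: "0 \<le> E k j" for k j by (simp add: E_def)
  have u_sub: "u \<tau> \<subseteq> ?S" and fin_u: "finite (u \<tau>)" for \<tau> by (auto simp: u_def)
  have HK: "HK_var lam \<pp> \<qq> (u \<tau>) (g \<tau>) < \<infinity>" if "\<tau> \<in> ?T" for \<tau>
    unfolding g_def u_def by (rule N_functional_finite_imp[OF N that])
  have g_int: "set_integrable (lebesgue_on_coords (u \<tau>)) (cube (u \<tau>)) (g \<tau>)" if "\<tau> \<in> ?T" for \<tau>
    by (rule set_integrable_cube_of_proj[OF fin_u HK_var_finite_imp(1)[OF fin_u HK[OF that]]]) simp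
  have f_eq: "f x = (\<Sum>\<tau>\<in>?T. R \<tau> x)" if "x \<in> cube ?S" for x
    using taylor_expansion[OF f \<delta> that] unfolding R_def g_def u_def .
  have "\<exists>K\<ge>0. \<forall>k. norm (LINT t:cube (u \<tau>)|lebesgue_on_coords (u \<tau>). complex_of_real (g \<tau> t) * (\<Prod>j\<in>u \<tau>. iterint (W (k j)) \<delta> (t j)))
      \<le> K * (\<Prod>j\<in>u \<tau>. E k j)" if \<tau>: "\<tau> \<in> ?T" for \<tau>
  proof -
    from HK_integral_bound[OF fin_u less_imp_le[OF lam(1)] \<pp> HK[OF \<tau>]]
    obtain K where K: "0 \<le> K" and bound: "\<And>(\<psi> :: nat \<Rightarrow> real \<Rightarrow> complex) B (M :: nat \<Rightarrow> nat).
      \<forall>j\<in>u \<tau>. M j > 0 \<and> \<psi> j \<in> borel_measurable borel \<and> (\<forall>x\<in>{0..<1}. norm (\<psi> j x) \<le> B j) \<and>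
        (M j = 1 \<or> (\<forall>n<M j. (LBINT x:{real n / M j..<real n / M j + 1 / M j}. \<psi> j x) = 0)) \<Longrightarrow>
      norm (LINT x:cube (u \<tau>)|lebesgue_on_coords (u \<tau>). complex_of_real (g \<tau> x) * (\<Prod>j\<in>u \<tau>. \<psi> j (x j)))
        \<le> K * (\<Prod>j\<in>u \<tau>. B j * (1 / M j) powr lam)"
      by blast
    show ?thesis
    proof (intro exI[of _ K] conjI allI)
      fix k :: "nat \<Rightarrow> nat"
      have "\<exists>B M. M > (0::nat) \<and> (\<forall>x\<in>{0..<1}. norm (iterint (W (k j)) \<delta> x) \<le> B) \<and>
        (M = 1 \<or> (\<forall>n<M. (LBINT x:{real n / M..<real n / M + 1 / M}. iterint (W (k j)) \<delta> x) = 0)) \<and>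
        B * (1 / M) powr lam \<le> E k j" for j
        unfolding E_def using iterint_cells[OF lam, of "k j" \<delta>] by metis
      then obtain B M where BM: "\<And>j. M j > (0::nat)" "\<And>j x. x\<in>{0..<1} \<Longrightarrow> norm (iterint (W (k j)) \<delta> x) \<le> B j"
        "\<And>j. M j = 1 \<or> (\<forall>n<M j. (LBINT x:{real n / M j..<real n / M j + 1 / M j}. iterint (W (k j)) \<delta> x) = 0)"
        "\<And>j. B j * (1 / M j) powr lam \<le> E k j" by metis
      have "norm (LINT x:cube (u \<tau>)|lebesgue_on_coords (u \<tau>). complex_of_real (g \<tau> x) * (\<Prod>j\<in>u \<tau>. iterint (W (k j)) \<delta> (x j)))
        \<le> K * (\<Prod>j\<in>u \<tau>. B j * (1 / M j) powr lam)"
        using BM iterint_measurable[OF W_measurable] by (intro bound) blast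
      also have "\<dots> \<le> K * (\<Prod>j\<in>u \<tau>. E k j)"
      proof (intro mult_left_mono[OF _ K] prod_mono conjI BM)
        fix j
        have "norm (iterint (W (k j)) \<delta> 0) \<le> B j" by (rule BM) simp
        with norm_ge_zero have "0 \<le> B j" by (rule order_trans)
        then show "0 \<le> B j * (1 / M j) powr lam" by simp
      qed
      finally show "norm (LINT t:cube (u \<tau>)|lebesgue_on_coords (u \<tau>). complex_of_real (g \<tau> t) * (\<Prod>j\<in>u \<tau>. iterint (W (k j)) \<delta> (t j)))
        \<le> K * (\<Prod>j\<in>u \<tau>. E k j)" .
    qed (rule K)
  qed
  then have "\<forall>\<tau>\<in>?T. \<exists>K. 0 \<le> K \<and> (\<forall>k. norm (LINT t:cube (u \<tau>)|lebesgue_on_coords (u \<tau>). complex_of_real (g \<tau> t) * (\<Prod>j\<in>u \<tau>. iterint (W (k j)) \<delta> (t j)))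
      \<le> K * (\<Prod>j\<in>u \<tau>. E k j))" by blast
  from bchoice[OF this] obtain K where "\<forall>\<tau>\<in>?T. 0 \<le> K \<tau> \<and> (\<forall>k. norm (LINT t:cube (u \<tau>)|lebesgue_on_coords (u \<tau>). complex_of_real (g \<tau> t) * (\<Prod>j\<in>u \<tau>. iterint (W (k j)) \<delta> (t j)))
      \<le> K \<tau> * (\<Prod>j\<in>u \<tau>. E k j))" ..
  then have K0: "\<And>\<tau>. \<tau> \<in> ?T \<Longrightarrow> 0 \<le> K \<tau>"
    and K: "\<And>\<tau> k. \<tau> \<in> ?T \<Longrightarrow> norm (LINT t:cube (u \<tau>)|lebesgue_on_coords (u \<tau>). complex_of_real (g \<tau> t) * (\<Prod>j\<in>u \<tau>. iterint (W (k j)) \<delta> (t j)))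
      \<le> K \<tau> * (\<Prod>j\<in>u \<tau>. E k j)" by blast+
  define c where "c = (\<Sum>\<tau>\<in>?T. K \<tau>)"
  have c0: "0 \<le> c" unfolding c_def using K0 by (rule sum_nonneg)
  have "norm (walsh_coeff p r \<theta> \<phi> s f k) \<le> (c * (real q ^ Suc \<delta>) ^ s) * real q powr (- mu q \<delta> lam s k)" for k
  proof -
    define F where "F \<tau> x = complex_of_real (R \<tau> x) * (\<Prod>j\<in>?S. W (k j) (x j))" for \<tau> x
    have F: "set_integrable ?MS (cube ?S) (F \<tau>)"
        "(LINT x:cube ?S|?MS. F \<tau> x) = (\<Prod>j\<in>?S - u \<tau>. iterint (W (k j)) (Suc (\<tau> j)) 0) *
      (LINT t:cube (u \<tau>)|lebesgue_on_coords (u \<tau>). complex_of_real (g \<tau> t) * (\<Prod>j\<in>u \<tau>. iterint (W (k j)) \<delta> (t j)))"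
      if "\<tau> \<in> ?T" for \<tau>
      unfolding F_def R_def
      by (rule taylor_term_integral[OF finite_atLeastAtMost u_sub \<delta> _ W_measurable norm_W_le_1 W_eq_0 g_int[OF that]]; simp)+
    have bound: "norm (LINT x:cube ?S|?MS. F \<tau> x) \<le> K \<tau> * (\<Prod>j\<in>?S. E k j)" if \<tau>: "\<tau> \<in> ?T" for \<tau>
    proof -
      have "norm (\<Prod>j\<in>?S - u \<tau>. iterint (W (k j)) (Suc (\<tau> j)) 0) \<le> (\<Prod>j\<in>?S - u \<tau>. E k j)"
        unfolding prod_norm[symmetric] E_def
      proof (intro prod_mono conjI norm_iterint_0_le_weight)
        fix j assume "j \<in> ?S - u \<tau>"
        then have "\<tau> j \<le> \<delta>" "\<tau> j \<noteq> \<delta>" using \<tau> by (auto simp: u_def PiE_iff)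
        then show "Suc (\<tau> j) \<le> \<delta>" by simp
      qed auto
      then have "norm (LINT x:cube ?S|?MS. F \<tau> x) \<le> (\<Prod>j\<in>?S - u \<tau>. E k j) * (K \<tau> * (\<Prod>j\<in>u \<tau>. E k j))"
        unfolding F(2)[OF \<tau>] norm_mult using K[OF \<tau>, of k] E0
        by (intro mult_mono prod_nonneg) auto
      also have "\<dots> = K \<tau> * (\<Prod>j\<in>?S. E k j)"
        unfolding prod.subset_diff[OF u_sub finite_atLeastAtMost, of "E k" \<tau>] by simp
      finally show ?thesis .
    qed
    have "walsh_coeff p r \<theta> \<phi> s f k = (LINT x:cube ?S|?MS. (\<Sum>\<tau>\<in>?T. F \<tau> x))"
      unfolding walsh_coeff_def
    proof (rule set_lebesgue_integral_cong)
      show "cube ?S \<in> sets ?MS" by (rule cube_measurable) simp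
      show "\<forall>x. x \<in> cube ?S \<longrightarrow> complex_of_real (f x) * cnj (wal p r \<theta> \<phi> s k x) = (\<Sum>\<tau>\<in>?T. F \<tau> x)"
        using f_eq cnj_wal_eq[of _ s k] by (simp add: F_def sum_distrib_right)
    qed
    also have "\<dots> = (\<Sum>\<tau>\<in>?T. LINT x:cube ?S|?MS. F \<tau> x)"
      using F(1) unfolding set_lebesgue_integral_def scaleR_sum_right set_integrable_def
      by (intro Bochner_Integration.integral_sum) auto
    also have "norm \<dots> \<le> (\<Sum>\<tau>\<in>?T. K \<tau> * (\<Prod>j\<in>?S. E k j))"
      by (rule order_trans[OF norm_sum sum_mono]) (rule bound)
    also have "\<dots> = c * (\<Prod>j\<in>?S. E k j)" by (simp add: c_def sum_distrib_right)
    also have "(\<Prod>j\<in>?S. E k j) = (real q ^ Suc \<delta>) ^ s * real q powr (- mu q \<delta> lam s k)"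
      using q by (simp add: E_def prod.distrib mu_def powr_sum[symmetric] sum_negf del: power_Suc)
    finally show ?thesis by (simp only: mult.assoc)
  qed
  then show ?thesis using c0 by (intro exI[of _ "c * (real q ^ Suc \<delta>) ^ s"]) auto
qed

theorem theorem3p8:
  fixes p r q s \<delta> :: nat
    and lam \<pp> \<qq> \<rr> :: real
    and \<theta> :: "'a::field"
    and \<phi> :: "nat \<Rightarrow> 'a"
    and \<gamma> :: "nat set \<Rightarrow> real"
    and f :: "(nat \<Rightarrow> real) \<Rightarrow> real"
  assumes "prime p" and "r \<ge> 1" and "q = p ^ r"
    and "card (UNIV :: 'a set) = q"
    and "is_power_basis p r \<theta>"
    and "bij_betw \<phi> {..<q} UNIV" and "\<phi> 0 = 0"
    and "s \<ge> 1" and "\<delta> \<ge> 1"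
    and "0 < lam" and "lam \<le> 1"
    and "\<pp> \<ge> 1" and "\<qq> \<ge> 1" and "\<rr> \<ge> 1"
    and "\<forall>v \<subseteq> {1..}. \<gamma> v \<ge> 0"
    and "cont_mixed_pderivs \<delta> s f"
    and "N_functional \<delta> lam \<pp> \<qq> \<rr> \<gamma> s f < \<infinity>"
  shows "\<exists>C>0. \<forall>k :: nat \<Rightarrow> nat. (\<exists>j\<in>{1..s}. k j \<noteq> 0) \<longrightarrow>
           cmod (walsh_coeff p r \<theta> \<phi> s f k) \<le> C * real q powr (- mu q \<delta> lam s k)"
proof -
  interpret walsh_setting p r q \<theta> \<phi>
    using assms prime_ge_2_nat[of p] by unfold_locales auto
  obtain C where C: "C \<ge> 0" "\<And>k. cmod (walsh_coeff p r \<theta> \<phi> s f k) \<le> C * real q powr (- mu q \<delta> lam s k)"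
    using walsh_coeff_bound[OF assms(9-12,16,17)] by blast
  \<comment> \<open>\<open>C\<close> may be 0, so it is increased by 1 to be positive.\<close>
  have "cmod (walsh_coeff p r \<theta> \<phi> s f k) \<le> (C + 1) * real q powr (- mu q \<delta> lam s k)" for k
    using C(2)[of k] by (rule order_trans) (intro mult_right_mono, auto)
  then show ?thesis using C(1) by (intro exI[of _ "C + 1"]) auto
qed

end
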